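(* Let $\mathcal C$ be a constraint that is admissible for $[0,1]$, let $l\ge i_k$ (with $l\ge 1$), and for each large enough $n$ let $(m_1^{(n)},\dots,m_n^{(n)})$ be drawn from the uniform distribution on $\mathcal M_n^{\mathcal C}([0,1])$. Define for $(m_1,\dots,m_l)\in\mathbb R^l$ $$I(m_1,\dots,m_l):=\begin{cases}-\log(m_{l+1}^+-m_{l+1}^-),&(m_1,\dots,m_l)\in\mathcal M_l^{\mathcal C}([0,1]),\\ \infty,&\text{else.}\end{cases}$$ Then $(m_1^{(n)},\dots,m_l^{(n)})$ satisfies a large deviations principle on $\mathbb R^l$ with speed $n$ and good rate function $I(\,\cdot\,)-I(m_1(\mu^{\mathcal C}),\dots,m_l(\mu^{\mathcal C}))$.
   Context: For a Borel set $E\subset\mathbb R$, $\mathcal P(E)$ is the set of Borel probability measures on $E$ possessing moments of all orders, $m_j(\mu):=\int x^j\,d\mu(x)$, and $\mathcal M_n(E):=\{(m_1(\mu),\dots,m_n(\mu)):\mu\in\mathcal P(E)\}$. A constraint $\mathcal C=\{m_{i_1}=c_{i_1},\dots,m_{i_k}=c_{i_k}\}$ consists of finitely many integers $1\le i_1<\dots<i_k$ and real values $c_{i_1},\dots,c_{i_k}$; $k=0$ (no constraint) is allowed, with $i_k:=0$. Put $\mathcal P^{\mathcal C}(E):=\{\mu\in\mathcal P(E): m_{i_j}(\mu)=c_{i_j},\ 1\le j\le k\}$ and $\mathcal M^{\mathcal C}_n(E):=\{(m_1(\mu),\dots,m_n(\mu)):\mu\in\mathcal P^{\mathcal C}(E)\}$.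 $\mathcal C$ is admissible for $E$ if $\mathcal M^{\mathcal C}_{i_k}(E)\cap\operatorname{Int}\mathcal M_{i_k}(E)\neq\emptyset$ (automatic if $k=0$). Uniform distribution: for $n\ge i_k$, $\mathcal M_n^{\mathcal C}([0,1])$ is identified with its projection to the $n-k$ unconstrained coordinates $(m_j,\ 1\le j\le n,\ j\ne i_1,\dots,i_k)$, a compact convex subset of $[0,1]^{n-k}$ of positive Lebesgue measure; the uniform distribution on $\mathcal M_n^{\mathcal C}([0,1])$ is the push-forward, under this identification, of normalized $(n-k)$-dimensional Lebesgue measure on the projection. Given $(m_1,\dots,m_l)\in\mathcal M_l([0,1])$, the set of $m_{l+1}$ with $(m_1,\dots,m_{l+1})\in\mathcal M_{l+1}([0,1])$ is an interval $[m_{l+1}^-,m_{l+1}^+]$. Convention: $-\log 0=+\infty$. $\mu^0(dx):=\frac{1}{\pi\sqrt{x(1-x)}}dx$ on $[0,1]$ is the arcsine distribution; $\mathcal K(\mu^0|\mu):=\int\log\frac{d\mu^0}{d\mu}\,d\mu^0$ if $\mu^0\ll\mu$ and $\infty$ otherwise; $\mu^{\mathcal C}$ is the unique minimizer of $\mu\mapsto\mathcal K(\mu^0|\mu)$ over $\mathcal P^{\mathcal C}([0,1])$. A sequence of laws $\mathbb P_n$ on a topological space $\mathcal X$ (with Borel $\sigma$-field) satisfies a large deviations principle (LDP) with speed $b_n\to\infty$ and rate function $J:\mathcal X\to[0,\infty]$ if $J$ is lower semicontinuous and for all measurable $\Gamma$: $-\inf_{\operatorname{Int}\Gamma}J\le\liminf_n\frac1{b_n}\log\mathbb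 P_n(\Gamma)\le\limsup_n\frac1{b_n}\log\mathbb P_n(\Gamma)\le-\inf_{\overline\Gamma}J$. $J$ is good if $J^{-1}((-\infty,\alpha])$ is compact for all $\alpha\ge0$. Random variables satisfy an LDP if their laws do. *)

theory Defs
  imports "HOL-Probability.Probability"
begin

section \<open>Moment spaces\<close>

text \<open>A vector \<open>(x\<^sub>1, \<dots>, x\<^sub>n)\<close> is an extensional function on \<open>{1..n}\<close>, so the dimension
  is an ordinary natural number.  The topology of \<open>\<real>\<^sup>n\<close> is the product topology, and its
  Borel \<open>\<sigma>\<close>-algebra is that of \<open>PiM {1..n} (\<lambda>_. borel)\<close>.\<close>

definition real_space :: "nat \<Rightarrow> (nat \<Rightarrow> real) topology" where
  "real_space n = product_topology (\<lambda>_. euclideanreal) {1..n}"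

definition moment :: "real measure \<Rightarrow> nat \<Rightarrow> real" where
  "moment \<mu> j = (\<integral>x. x ^ j \<partial>\<mu>)"

definition moment_vector :: "nat \<Rightarrow> real measure \<Rightarrow> nat \<Rightarrow> real" where
  "moment_vector n \<mu> = (\<lambda>j\<in>{1..n}. moment \<mu> j)"

definition prob_moments :: "real set \<Rightarrow> real measure set" where
  "prob_moments E =
     {\<mu>. prob_space \<mu> \<and> sets \<mu> = sets (restrict_space borel E) \<and>
         (\<forall>j::nat. integrable \<mu> (\<lambda>x. x ^ j))}"

definition moment_space :: "real set \<Rightarrow> nat \<Rightarrow> (nat \<Rightarrow> real) set" where
  "moment_space E n = moment_vector n ` prob_moments E"

section \<open>Constraints\<close>

text \<open>A constraint \<open>{m\<^bsub>i\<^sub>1\<^esub> = c\<^bsub>i\<^sub>1\<^esub>, \<dots>, m\<^bsub>i\<^sub>k\<^esub> = c\<^bsub>i\<^sub>k\<^esub>}\<close> is the finite partial function \<open>i\<^sub>j \<mapsto> c\<^bsub>i\<^sub>j\<^esub>\<close>;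
  \<open>top_index\<close> is \<open>i\<^sub>k\<close>, with value 0 for the empty constraint.\<close>

type_synonym constr = "nat \<rightharpoonup> real"

definition is_constraint :: "constr \<Rightarrow> bool" where
  "is_constraint C \<longleftrightarrow> finite (dom C) \<and> 0 \<notin> dom C"

definition top_index :: "constr \<Rightarrow> nat" where
  "top_index C = Max (insert 0 (dom C))"

definition constr_prob_moments :: "constr \<Rightarrow> real set \<Rightarrow> real measure set" where
  "constr_prob_moments C E =
     {\<mu> \<in> prob_moments E. \<forall>i\<in>dom C. C i = Some (moment \<mu> i)}"

definition constr_moment_space :: "constr \<Rightarrow> real set \<Rightarrow> nat \<Rightarrow> (nat \<Rightarrow> real) set" where
  "constr_moment_space C E n = moment_vector n ` constr_prob_moments C E"

definition admissible :: "constr \<Rightarrow> real set \<Rightarrow> bool" where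
  "admissible C E \<longleftrightarrow>
     constr_moment_space C E (top_index C) \<inter>
       (real_space (top_index C) interior_of moment_space E (top_index C)) \<noteq> {}"

section \<open>The uniform distribution on a constrained moment space\<close>

definition free_indices :: "constr \<Rightarrow> nat \<Rightarrow> nat set" where
  "free_indices C n = {1..n} - dom C"

definition free_projection :: "constr \<Rightarrow> nat \<Rightarrow> (nat \<Rightarrow> real) set" where
  "free_projection C n =
     (\<lambda>x. restrict x (free_indices C n)) ` constr_moment_space C {0..1} n"

definition insert_constr :: "constr \<Rightarrow> nat \<Rightarrow> (nat \<Rightarrow> real) \<Rightarrow> nat \<Rightarrow> real" where
  "insert_constr C n y = (\<lambda>j\<in>{1..n}. case C j of None \<Rightarrow> y j | Some c \<Rightarrow> c)"

definition uniform_constr_moments :: "constr \<Rightarrow> nat \<Rightarrow> (nat \<Rightarrow> real) measure" where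
  "uniform_constr_moments C n =
     distr (uniform_measure (PiM (free_indices C n) (\<lambda>_. lborel)) (free_projection C n))
       (PiM {1..n} (\<lambda>_. borel)) (insert_constr C n)"

text \<open>The law of the first \<open>l\<close> coordinates of a random vector that is uniformly distributed on
  the \<open>n\<close>-th constrained moment space (meaningful for \<open>n \<ge> l\<close>).\<close>

definition first_moments_law :: "constr \<Rightarrow> nat \<Rightarrow> nat \<Rightarrow> (nat \<Rightarrow> real) measure" where
  "first_moments_law C l n =
     distr (uniform_constr_moments C n) (PiM {1..l} (\<lambda>_. borel)) (\<lambda>x. restrict x {1..l})"

section \<open>Arcsine distribution and the minimizer of relative entropy\<close>

definition arcsine :: "real measure" where
  "arcsine = density (restrict_space lborel {0..1})
     (\<lambda>x. ennreal (1 / (pi * sqrt (x * (1 - x)))))"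

text \<open>\<open>rel_entropy \<nu> \<mu>\<close> is \<open>\<integral> log (d\<nu>/d\<mu>) d\<nu>\<close>; note the argument order of the library constants.
  The negative part of \<open>log (d\<nu>/d\<mu>)\<close> is always \<open>\<nu>\<close>-integrable, so for \<open>\<nu> \<lless> \<mu>\<close> failure of
  integrability means that the integral is \<open>\<infinity>\<close>.\<close>

definition rel_entropy :: "real measure \<Rightarrow> real measure \<Rightarrow> ereal" where
  "rel_entropy \<nu> \<mu> =
     (if absolutely_continuous \<mu> \<nu> \<and> integrable \<nu> (entropy_density (exp 1) \<mu> \<nu>)
      then ereal (KL_divergence (exp 1) \<mu> \<nu>) else \<infinity>)"

definition entropy_minimizer :: "constr \<Rightarrow> real measure" where
  "entropy_minimizer C =
     (THE \<mu>. is_arg_min (rel_entropy arcsine) (\<lambda>\<mu>. \<mu> \<in> constr_prob_moments C {0..1}) \<mu>)"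

section \<open>Large deviations\<close>

text \<open>Logarithm on \<open>[0,\<infinity>)\<close> with \<open>log 0 = -\<infinity>\<close>; the library has \<open>ln 0 = 0\<close>.\<close>

definition elog :: "real \<Rightarrow> ereal" where
  "elog x = (if x \<le> 0 then -\<infinity> else ereal (ln x))"

definition borel_of :: "'a topology \<Rightarrow> 'a measure" where
  "borel_of X = sigma (topspace X) {U. openin X U}"

definition lower_semicontinuous :: "'a topology \<Rightarrow> ('a \<Rightarrow> ereal) \<Rightarrow> bool" where
  "lower_semicontinuous X J \<longleftrightarrow> (\<forall>a. openin X {x \<in> topspace X. a < J x})"

text \<open>As only the limit matters, the \<open>P n\<close> need to be Borel probability measures only for
  large \<open>n\<close>.\<close>

definition LDP :: "'a topology \<Rightarrow> (nat \<Rightarrow> 'a measure) \<Rightarrow> (nat \<Rightarrow> real) \<Rightarrow> ('a \<Rightarrow> ereal) \<Rightarrow> bool" where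
  "LDP X P b J \<longleftrightarrow>
     (\<forall>\<^sub>F n in sequentially. prob_space (P n) \<and> sets (P n) = sets (borel_of X)) \<and>
     filterlim b at_top sequentially \<and>
     (\<forall>x\<in>topspace X. 0 \<le> J x) \<and>
     lower_semicontinuous X J \<and>
     (\<forall>\<Gamma>\<in>sets (borel_of X).
        - (INF x\<in>X interior_of \<Gamma>. J x) \<le> liminf (\<lambda>n. ereal (1 / b n) * elog (measure (P n) \<Gamma>)) \<and>
        limsup (\<lambda>n. ereal (1 / b n) * elog (measure (P n) \<Gamma>)) \<le> - (INF x\<in>X closure_of \<Gamma>. J x))"

definition good_rate :: "'a topology \<Rightarrow> ('a \<Rightarrow> ereal) \<Rightarrow> bool" where
  "good_rate X J \<longleftrightarrow> (\<forall>\<alpha>::real. 0 \<le> \<alpha> \<longrightarrow> compactin X {x \<in> topspace X. J x \<le> ereal \<alpha>})"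

section \<open>The functional \<open>I\<close>\<close>

definition next_moments :: "nat \<Rightarrow> (nat \<Rightarrow> real) \<Rightarrow> real set" where
  "next_moments l x = {t. x(Suc l := t) \<in> moment_space {0..1} (Suc l)}"

definition rate_I :: "constr \<Rightarrow> nat \<Rightarrow> (nat \<Rightarrow> real) \<Rightarrow> ereal" where
  "rate_I C l x =
     (if x \<in> constr_moment_space C {0..1} l
      then - elog (Sup (next_moments l x) - Inf (next_moments l x)) else \<infinity>)"

end

theory Submission
  imports Defs "HOL-Complex_Analysis.Complex_Analysis"
begin

text \<open>Write \<open>w\<^sub>l(x) = m\<^sup>+\<^bsub>l+1\<^esub> - m\<^sup>-\<^bsub>l+1\<^esub>\<close> for the width of the fibre over \<open>x\<close>.  Over an interior point,
  \<open>w\<^bsub>l+1\<^esub>(x, t) = (t - m\<^sup>-) (m\<^sup>+ - t) / w\<^sub>l(x)\<close>, so by iterated integration the first \<open>l\<close> moments have density proportional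
  to \<open>w\<^sub>l\<^sup>n\<^sup>-\<^sup>l\<close> with respect to Lebesgue measure on the free coordinates.  As \<open>w\<^sub>l\<close> is concave and upper semicontinuous,
  Laplace's method gives the principle with rate \<open>- log w\<^sub>l + max log w\<^sub>l\<close>.

  The recursion for the widths comes from the Bernstein-Szego measures \<open>N q(x)\<^sup>-\<^sup>1 \<mu>\<^sup>0(dx)\<close>, where \<open>q((1 + cos t) / 2) = |h(e\<^sup>i\<^sup>t)|\<^sup>2\<close>
  and \<open>h\<close> is produced by the Szego recursion: they realise every point of positive width, and \<open>w\<^sub>l = N / 4\<^sup>l\<close> there.
  Since \<open>\<integral> log q d\<mu>\<^sup>0 = log |h(0)|\<^sup>2 = 0\<close>, the same measures minimise the relative entropy with prescribed first \<open>l\<close> moments,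
  with minimum \<open>- log (4\<^sup>l w\<^sub>l)\<close>; hence the moments of \<open>\<mu>\<^sup>C\<close> maximise \<open>w\<^sub>l\<close>.\<close>

section \<open>Measures on the unit interval\<close>

text \<open>The widths are controlled by a duality bound. The polynomial \<open>T\<close> has degree
  \<open>l + 1\<close>, leading coefficient \<open>2 * 4 ^ l\<close>, and |T| \<le> q on the unit
  interval. Two measures with common moments up to order \<open>l\<close> give \<open>q\<close> the
  same integral, so their moments of order \<open>l + 1\<close> differ by at most that integral
  divided by \<open>4 ^ l\<close>. For the measure built from the same \<open>q\<close> this is
  \<open>N / 4 ^ l\<close>, and the recursion steps with |s| < 1 fill an open interval of that
  length, so the bound is sharp. The obstacle is the boundary: vectors of width zero come from no
  Bernstein-Szego measure. At the first order where a moment hits an end point, suitable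
  \<open>q\<close> have arbitrarily small integral. By duality this forces the width to vanish;
  since the entropy is at least \<open>- ln r + 1\<close> minus the integral of
  \<open>q / r\<close>, it also forces infinite entropy. Concavity of the width enters twice: for
  uniqueness of the minimiser, where the polynomial of a midpoint tests two measures at once, and
  for lower bounds on volumes, where boxes are shrunk towards a point.\<close>

abbreviation unit_probs :: "real measure set" where
  "unit_probs \<equiv> prob_moments {0..1}"

lemma unit_prob_integrable:
  fixes f :: "real \<Rightarrow> real"
  assumes "prob_space \<mu>" and s: "sets \<mu> = sets (restrict_space borel {0..1})"
    and f: "continuous_on {0..1} f"
  shows "integrable \<mu> f"
proof -
  interpret prob_space \<mu> by fact
  have sp: "space \<mu> = {0..1}"
    using sets_eq_imp_space_eq[OF s] by (simp add: space_restrict_space)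
  have "bounded (f ` {0..1})"
    by (intro compact_imp_bounded compact_continuous_image f compact_Icc)
  then obtain B where B: "\<And>x. x \<in> {0..1} \<Longrightarrow> norm (f x) \<le> B"
    unfolding bounded_iff by blast
  have "f \<in> borel_measurable \<mu>"
    using borel_measurable_continuous_on_restrict[OF f] measurable_cong_sets[OF s refl] by blast
  then show ?thesis
    using B by (intro integrable_const_bound[where B = B]) (auto simp: sp)
qed

lemma unit_probs_iff:
  "\<mu> \<in> unit_probs \<longleftrightarrow> prob_space \<mu> \<and> sets \<mu> = sets (restrict_space borel {0..1})"
  unfolding prob_moments_def by (auto intro!: unit_prob_integrable continuous_intros)

lemma space_unit_probs: "\<mu> \<in> unit_probs \<Longrightarrow> space \<mu> = {0..1}"
  using sets_eq_imp_space_eq[of \<mu> "restrict_space borel {0..1}"]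
  by (simp add: unit_probs_iff space_restrict_space)

lemma unit_probs_measurable:
  "\<mu> \<in> unit_probs \<Longrightarrow> measurable \<mu> N = measurable (restrict_space borel {0..1}) N"
  by (rule measurable_cong_sets) (auto simp: unit_probs_iff)

lemma unit_probs_integrable [intro]:
  fixes f :: "real \<Rightarrow> real"
  shows "\<mu> \<in> unit_probs \<Longrightarrow> continuous_on {0..1} f \<Longrightarrow> integrable \<mu> f"
  by (auto simp: unit_probs_iff intro: unit_prob_integrable)

lemma unit_probs_one: "\<mu> \<in> unit_probs \<Longrightarrow> (\<integral>x. 1 \<partial>\<mu>) = (1::real)"
  by (simp add: unit_probs_iff prob_space.prob_space)

lemma unit_probs_le:
  fixes f g :: "real \<Rightarrow> real"
  assumes "\<mu> \<in> unit_probs" "continuous_on {0..1} f" "continuous_on {0..1} g"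
    and "\<And>x. x \<in> {0..1} \<Longrightarrow> f x \<le> g x"
  shows "(\<integral>x. f x \<partial>\<mu>) \<le> (\<integral>x. g x \<partial>\<mu>)"
  using assms by (intro integral_mono unit_probs_integrable) (auto simp: space_unit_probs)

lemma unit_probs_nonneg:
  fixes f :: "real \<Rightarrow> real"
  assumes "\<mu> \<in> unit_probs" and "\<And>x. x \<in> {0..1} \<Longrightarrow> 0 \<le> f x"
  shows "0 \<le> (\<integral>x. f x \<partial>\<mu>)"
  using assms by (intro integral_nonneg_AE AE_I2) (auto simp: space_unit_probs)

lemma moment_unit:
  assumes "\<mu> \<in> unit_probs" shows "moment \<mu> j \<in> {0..1}"
proof -
  have "(\<integral>x. x ^ j \<partial>\<mu>) \<le> (\<integral>x. 1 \<partial>\<mu>)"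
    using assms by (intro unit_probs_le) (auto intro!: continuous_intros simp: power_le_one)
  then show ?thesis
    using assms unit_probs_nonneg[of \<mu> "\<lambda>x. x ^ j"] by (auto simp: moment_def unit_probs_iff prob_space.prob_space)
qed

section \<open>Sums and reweightings of measures\<close>

text \<open>The sum is used only through its integrals; additivity passes from indicators to all
  nonnegative measurable functions by induction on their construction.\<close>

lemma sum_of_measures:
  assumes s: "sets M2 = sets M1"
  obtains M where "sets M = sets M1"
    "\<And>f :: 'a \<Rightarrow> ennreal. f \<in> borel_measurable M1 \<Longrightarrow> (\<integral>\<^sup>+x. f x \<partial>M) = (\<integral>\<^sup>+x. f x \<partial>M1) + (\<integral>\<^sup>+x. f x \<partial>M2)"
proof -
  define M where "M = measure_of (space M1) (sets M1) (\<lambda>A. emeasure M1 A + emeasure M2 A)"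
  have sM: "sets M = sets M1" "space M = space M1"
    by (auto simp: M_def sets.sets_measure_of_eq)
  have sp: "space M2 = space M1" by (rule sets_eq_imp_space_eq[OF s])
  have em: "emeasure M A = emeasure M1 A + emeasure M2 A" if "A \<in> sets M1" for A
  proof (rule emeasure_measure_of[OF M_def])
    show "sets M1 \<subseteq> Pow (space M1)" by (rule sets.space_closed)
    show "A \<in> sets M" by (simp add: sM that)
    show "positive (sets M) (\<lambda>A. emeasure M1 A + emeasure M2 A)" by (simp add: positive_def)
    show "countably_additive (sets M) (\<lambda>A. emeasure M1 A + emeasure M2 A)"
    proof (rule countably_additiveI)
      fix A :: "nat \<Rightarrow> 'a set" assume A: "range A \<subseteq> sets M" "disjoint_family A"
      then show "(\<Sum>i. emeasure M1 (A i) + emeasure M2 (A i)) = emeasure M1 (\<Union>(range A)) + emeasure M2 (\<Union>(range A))"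
        by (subst suminf_add[symmetric]) (auto simp: suminf_emeasure sM s)
    qed
  qed
  have "(\<integral>\<^sup>+x. f x \<partial>M) = (\<integral>\<^sup>+x. f x \<partial>M1) + (\<integral>\<^sup>+x. f x \<partial>M2)"
    if "f \<in> borel_measurable M1" for f :: "'a \<Rightarrow> ennreal"
    using that
  proof (induction rule: borel_measurable_induct)
    case (cong f g)
    have "(\<integral>\<^sup>+x. g x \<partial>N) = (\<integral>\<^sup>+x. f x \<partial>N)" if "space N = space M1" for N
      using that cong(3) by (intro nn_integral_cong) simp
    then show ?case using cong.IH cong(4) by (simp add: sM sp)
  next
    case (set A)
    then show ?case by (simp add: sM s em)
  next
    case (mult u c)
    have "u \<in> borel_measurable M" "u \<in> borel_measurable M2"
      using mult(2) by (auto simp: measurable_cong_sets[OF sM(1) refl] measurable_cong_sets[OF s refl])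
    then show ?case using mult by (simp add: nn_integral_cmult distrib_left)
  next
    case (add u v)
    have "u \<in> borel_measurable M" "u \<in> borel_measurable M2" "v \<in> borel_measurable M" "v \<in> borel_measurable M2"
      using add by (auto simp: measurable_cong_sets[OF sM(1) refl] measurable_cong_sets[OF s refl])
    then show ?case using add by (simp add: nn_integral_add algebra_simps)
  next
    case (seq U)
    have m: "U i \<in> borel_measurable M" "U i \<in> borel_measurable M2" for i
      using seq(1) by (auto simp: measurable_cong_sets[OF sM(1) refl] measurable_cong_sets[OF s refl])
    have "(\<integral>\<^sup>+x. (SUP i. U i) x \<partial>N) = (SUP i. \<integral>\<^sup>+x. U i x \<partial>N)" if "\<And>i. U i \<in> borel_measurable N" for N
      using nn_integral_monotone_convergence_SUP[OF \<open>incseq U\<close> that] by (simp add: image_image)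
    moreover have "incseq (\<lambda>i. \<integral>\<^sup>+x. U i x \<partial>N)" for N
      using \<open>incseq U\<close> by (auto simp: incseq_def le_fun_def intro!: nn_integral_mono)
    ultimately show ?case using m seq.hyps seq.IH by (simp add: ennreal_SUP_add)
  qed
  with sM that show ?thesis by blast
qed

text \<open>Nonconstant weights are the point: the constants \<open>1 - t\<close> and
  \<open>t\<close> give mixtures, while \<open>x\<close> and \<open>1 - x\<close> shift moments by
  one order.\<close>

lemma combine_unit_probs:
  fixes g1 g2 :: "real \<Rightarrow> real"
  assumes \<nu>: "\<nu>1 \<in> unit_probs" "\<nu>2 \<in> unit_probs"
    and g: "continuous_on {0..1} g1" "continuous_on {0..1} g2"
      "\<And>x. x \<in> {0..1} \<Longrightarrow> 0 \<le> g1 x" "\<And>x. x \<in> {0..1} \<Longrightarrow> 0 \<le> g2 x"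
    and one: "(\<integral>x. g1 x \<partial>\<nu>1) + (\<integral>x. g2 x \<partial>\<nu>2) = 1"
  obtains \<nu> where "\<nu> \<in> unit_probs"
    "\<And>f :: real \<Rightarrow> real. continuous_on {0..1} f \<Longrightarrow>
       (\<integral>x. f x \<partial>\<nu>) = (\<integral>x. g1 x * f x \<partial>\<nu>1) + (\<integral>x. g2 x * f x \<partial>\<nu>2)"
proof -
  let ?R = "restrict_space borel {0..1::real}"
  have s: "sets \<nu>1 = sets ?R" "sets \<nu>2 = sets ?R" using \<nu> by (auto simp: unit_probs_iff)
  have "sets (density \<nu>2 g2) = sets (density \<nu>1 g1)" by (simp add: s)
  then obtain M where M: "sets M = sets (density \<nu>1 g1)"
    "\<And>f :: real \<Rightarrow> ennreal. f \<in> borel_measurable (density \<nu>1 g1) \<Longrightarrow>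
      (\<integral>\<^sup>+x. f x \<partial>M) = (\<integral>\<^sup>+x. f x \<partial>density \<nu>1 g1) + (\<integral>\<^sup>+x. f x \<partial>density \<nu>2 g2)"
    by (rule sum_of_measures) blast
  have meas: "f \<in> borel_measurable \<nu>1 \<and> f \<in> borel_measurable \<nu>2" if "continuous_on {0..1} f" for f :: "real \<Rightarrow> real"
    using borel_measurable_continuous_on_restrict[OF that] \<nu> by (simp add: unit_probs_measurable)
  have nn: "(\<integral>\<^sup>+x. ennreal (f x) \<partial>M) = (\<integral>\<^sup>+x. ennreal (g1 x * f x) \<partial>\<nu>1) + (\<integral>\<^sup>+x. ennreal (g2 x * f x) \<partial>\<nu>2)"
    if "continuous_on {0..1} f" for f :: "real \<Rightarrow> real"
  proof -
    have "(\<integral>\<^sup>+x. ennreal (g1 x) * ennreal (f x) \<partial>\<nu>1) = (\<integral>\<^sup>+x. ennreal (g1 x * f x) \<partial>\<nu>1)"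
      using \<nu> g by (intro nn_integral_cong) (auto simp: ennreal_mult' space_unit_probs)
    moreover have "(\<integral>\<^sup>+x. ennreal (g2 x) * ennreal (f x) \<partial>\<nu>2) = (\<integral>\<^sup>+x. ennreal (g2 x * f x) \<partial>\<nu>2)"
      using \<nu> g by (intro nn_integral_cong) (auto simp: ennreal_mult' space_unit_probs)
    ultimately show ?thesis
      using meas[OF that] meas[OF g(1)] meas[OF g(2)] by (subst M(2)) (auto simp: nn_integral_density)
  qed
  have fin: "(\<integral>\<^sup>+x. ennreal (f x) \<partial>\<nu>) < \<infinity>" if "\<nu> \<in> unit_probs" "continuous_on {0..1} f" for \<nu> and f :: "real \<Rightarrow> real"
    using unit_probs_integrable[OF that] by (simp add: real_integrable_def less_top)
  have fin12: "(\<integral>\<^sup>+x. ennreal (g1 x * f x) \<partial>\<nu>1) < \<infinity>" "(\<integral>\<^sup>+x. ennreal (g2 x * f x) \<partial>\<nu>2) < \<infinity>"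
    if "continuous_on {0..1} f" for f :: "real \<Rightarrow> real"
    using that g \<nu> by (intro fin continuous_intros; simp)+
  \<comment> \<open>Additivity is known for nonnegative integrands only, so \<open>f\<close> is
    split into its positive and negative parts, all of whose integrals are finite.\<close>
  have int: "(\<integral>x. f x \<partial>M) = (\<integral>x. g1 x * f x \<partial>\<nu>1) + (\<integral>x. g2 x * f x \<partial>\<nu>2)" if f: "continuous_on {0..1} f" for f :: "real \<Rightarrow> real"
  proof -
    have f': "continuous_on {0..1} (\<lambda>x. - f x)" using f by (rule continuous_on_minus)
    have i: "integrable M f"
      using nn[OF f] nn[OF f'] fin12[OF f] fin12[OF f'] M(1) meas[OF f]
      by (auto simp: real_integrable_def ennreal_add_eq_top cong: measurable_cong_sets)
    have i12: "integrable \<nu>1 (\<lambda>x. g1 x * f x)" "integrable \<nu>2 (\<lambda>x. g2 x * f x)"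
      using \<nu> f g by (auto intro!: continuous_intros)
    show ?thesis
      unfolding real_lebesgue_integral_def[OF i] real_lebesgue_integral_def[OF i12(1)] real_lebesgue_integral_def[OF i12(2)]
      using nn[OF f] nn[OF f'] fin12[OF f] fin12[OF f'] by (simp add: enn2real_plus)
  qed
  have "emeasure M (space M) = (\<integral>\<^sup>+x. ennreal 1 \<partial>M)" by simp
  also have "\<dots> = (\<integral>\<^sup>+x. ennreal (g1 x) \<partial>\<nu>1) + (\<integral>\<^sup>+x. ennreal (g2 x) \<partial>\<nu>2)"
    by (subst nn) auto
  also have "(\<integral>\<^sup>+x. ennreal (g1 x) \<partial>\<nu>1) = ennreal (\<integral>x. g1 x \<partial>\<nu>1)"
    using \<nu> g by (intro nn_integral_eq_integral) (auto simp: space_unit_probs intro!: AE_I2)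
  also have "(\<integral>\<^sup>+x. ennreal (g2 x) \<partial>\<nu>2) = ennreal (\<integral>x. g2 x \<partial>\<nu>2)"
    using \<nu> g by (intro nn_integral_eq_integral) (auto simp: space_unit_probs intro!: AE_I2)
  also have "ennreal (\<integral>x. g1 x \<partial>\<nu>1) + ennreal (\<integral>x. g2 x \<partial>\<nu>2) = 1"
    using one \<nu> g unit_probs_nonneg[of \<nu>1 g1] unit_probs_nonneg[of \<nu>2 g2] by (simp flip: ennreal_plus)
  finally have "prob_space M" by (rule prob_spaceI)
  then have "M \<in> unit_probs" using M(1) s by (simp add: unit_probs_iff)
  then show ?thesis using int that by blast
qed

section \<open>Moment spaces\<close>

abbreviation moments :: "nat \<Rightarrow> (nat \<Rightarrow> real) set" where
  "moments \<equiv> moment_space {0..1}"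

abbreviation constr_moments :: "constr \<Rightarrow> nat \<Rightarrow> (nat \<Rightarrow> real) set" where
  "constr_moments C \<equiv> constr_moment_space C {0..1}"

abbreviation real_borel :: "nat \<Rightarrow> (nat \<Rightarrow> real) measure" where
  "real_borel n \<equiv> PiM {1..n} (\<lambda>_. borel)"

abbreviation poly_mean :: "real measure \<Rightarrow> real poly \<Rightarrow> real" where
  "poly_mean \<mu> p \<equiv> \<integral>x. poly p x \<partial>\<mu>"

definition width :: "nat \<Rightarrow> (nat \<Rightarrow> real) \<Rightarrow> real" where
  "width n x = Sup (next_moments n x) - Inf (next_moments n x)"

definition mix :: "nat \<Rightarrow> real \<Rightarrow> (nat \<Rightarrow> real) \<Rightarrow> (nat \<Rightarrow> real) \<Rightarrow> nat \<Rightarrow> real" where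
  "mix n t x y = (\<lambda>j\<in>{1..n}. (1 - t) * x j + t * y j)"

lemma moment_vector_eq_iff:
  "moment_vector n \<mu> = moment_vector n \<nu> \<longleftrightarrow> (\<forall>j\<in>{1..n}. moment \<mu> j = moment \<nu> j)"
  by (auto simp: moment_vector_def fun_eq_iff restrict_def)

lemma moment_vector_restrict:
  "m \<le> n \<Longrightarrow> restrict (moment_vector n \<mu>) {1..m} = moment_vector m \<mu>"
  by (auto simp: moment_vector_def fun_eq_iff restrict_def)

lemma moment_vector_Suc:
  "moment_vector (Suc n) \<mu> = (moment_vector n \<mu>)(Suc n := moment \<mu> (Suc n))"
  by (auto simp: moment_vector_def fun_eq_iff restrict_def)

lemma unit_moments_extensional: "x \<in> moments n \<Longrightarrow> x \<in> extensional {1..n}"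
  by (auto simp: moment_space_def moment_vector_def)

lemma unit_moments_unit: "x \<in> moments n \<Longrightarrow> j \<in> {1..n} \<Longrightarrow> x j \<in> {0..1}"
  using moment_unit by (auto simp: moment_space_def moment_vector_def)

lemma unit_moments_restrict: "x \<in> moments n \<Longrightarrow> m \<le> n \<Longrightarrow> restrict x {1..m} \<in> moments m"
  by (auto simp: moment_space_def moment_vector_restrict simp del: One_nat_def)

text \<open>Extensionality fixes the value of \<open>x\<close> at \<open>Suc n\<close>, which the
  update overwrites and which membership of the updated vector therefore does not determine.\<close>

lemma next_moments_iff:
  assumes x: "x \<in> extensional {1..n}"
  shows "t \<in> next_moments n x \<longleftrightarrow>
    (\<exists>\<nu>\<in>unit_probs. moment_vector n \<nu> = x \<and> moment \<nu> (Suc n) = t)"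
proof -
  have "x(Suc n := t) = moment_vector (Suc n) \<nu> \<longleftrightarrow> moment_vector n \<nu> = x \<and> moment \<nu> (Suc n) = t" for \<nu>
  proof
    assume eq: "x(Suc n := t) = moment_vector (Suc n) \<nu>"
    have "moment_vector n \<nu> j = x j" for j
    proof (cases "j \<in> {1..n}")
      case True
      then show ?thesis using fun_cong[OF eq, of j] by (auto simp: moment_vector_def)
    next
      case False
      then show ?thesis using x by (auto simp: moment_vector_def extensional_def)
    qed
    then show "moment_vector n \<nu> = x \<and> moment \<nu> (Suc n) = t"
      using fun_cong[OF eq, of "Suc n"] by (auto simp: moment_vector_def)
  qed (auto simp: moment_vector_Suc)
  then show ?thesis by (auto simp: next_moments_def moment_space_def image_iff)
qed

lemma unit_moments_Suc_next:
  assumes "x \<in> moments (Suc n)"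
  shows "x (Suc n) \<in> next_moments n (restrict x {1..n})"
proof -
  have "(restrict x {1..n})(Suc n := x (Suc n)) = x"
    using unit_moments_extensional[OF assms] by (auto simp: fun_eq_iff restrict_def extensional_def)
  then show ?thesis using assms by (simp add: next_moments_def)
qed

lemma unit_probs_poly_integrable: "\<nu> \<in> unit_probs \<Longrightarrow> integrable \<nu> (\<lambda>x. poly p x)"
  by (intro unit_probs_integrable continuous_intros)

lemma integral_poly_moments:
  assumes "\<nu> \<in> unit_probs"
  shows "poly_mean \<nu> p = (\<Sum>i\<le>degree p. coeff p i * moment \<nu> i)"
  unfolding poly_altdef moment_def using assms
  by (subst Bochner_Integration.integral_sum) (auto intro!: continuous_intros)

lemma moment_0: "\<nu> \<in> unit_probs \<Longrightarrow> moment \<nu> 0 = 1"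
  by (simp add: moment_def unit_probs_iff prob_space.prob_space)

lemma integral_poly_cong:
  assumes "\<nu> \<in> unit_probs" "\<mu> \<in> unit_probs" "moment_vector n \<nu> = moment_vector n \<mu>" "degree p \<le> n"
  shows "poly_mean \<nu> p = poly_mean \<mu> p"
proof -
  have "moment \<nu> i = moment \<mu> i" if "i \<le> degree p" for i
    using assms that by (cases "i = 0") (auto simp: moment_vector_eq_iff moment_0)
  then show ?thesis using assms by (simp add: integral_poly_moments)
qed

lemma mixture_unit_probs:
  assumes "\<nu>1 \<in> unit_probs" "\<nu>2 \<in> unit_probs" "0 \<le> t" "t \<le> 1"
  obtains \<nu> where "\<nu> \<in> unit_probs" "\<And>j. moment \<nu> j = (1 - t) * moment \<nu>1 j + t * moment \<nu>2 j"
    "\<And>f :: real \<Rightarrow> real. continuous_on {0..1} f \<Longrightarrow>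
       (\<integral>x. f x \<partial>\<nu>) = (1 - t) * (\<integral>x. f x \<partial>\<nu>1) + t * (\<integral>x. f x \<partial>\<nu>2)"
proof -
  have one: "(\<integral>x. 1 - t \<partial>\<nu>1) + (\<integral>x. t \<partial>\<nu>2) = 1"
    using assms by (simp add: unit_probs_iff prob_space.prob_space)
  obtain \<nu> where \<nu>: "\<nu> \<in> unit_probs" and
    *: "\<And>f :: real \<Rightarrow> real. continuous_on {0..1} f \<Longrightarrow>
       (\<integral>x. f x \<partial>\<nu>) = (\<integral>x. (1 - t) * f x \<partial>\<nu>1) + (\<integral>x. t * f x \<partial>\<nu>2)"
    by (rule combine_unit_probs[OF assms(1,2) _ _ _ _ one]) (use assms in auto)
  show ?thesis
  proof (intro that[OF \<nu>])
    show "(\<integral>x. f x \<partial>\<nu>) = (1 - t) * (\<integral>x. f x \<partial>\<nu>1) + t * (\<integral>x. f x \<partial>\<nu>2)"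
      if "continuous_on {0..1} f" for f :: "real \<Rightarrow> real"
      using *[OF that] by simp
    show "moment \<nu> j = (1 - t) * moment \<nu>1 j + t * moment \<nu>2 j" for j
      unfolding moment_def using *[of "\<lambda>x. x ^ j"] by (simp add: continuous_on_power)
  qed
qed

lemma unit_moments_mix:
  assumes "x \<in> moments n" "y \<in> moments n" "0 \<le> t" "t \<le> 1"
  shows "mix n t x y \<in> moments n"
proof -
  obtain \<nu>1 \<nu>2 where \<nu>: "\<nu>1 \<in> unit_probs" "\<nu>2 \<in> unit_probs" "x = moment_vector n \<nu>1" "y = moment_vector n \<nu>2"
    using assms by (auto simp: moment_space_def)
  obtain \<nu> where "\<nu> \<in> unit_probs" "\<And>j. moment \<nu> j = (1 - t) * moment \<nu>1 j + t * moment \<nu>2 j"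
    by (rule mixture_unit_probs[OF \<nu>(1,2) assms(3,4)]) blast
  then show ?thesis
    unfolding moment_space_def by (intro image_eqI[of _ _ \<nu>]) (auto simp: mix_def moment_vector_def \<nu>)
qed

lemma unit_moments_nonempty_next:
  assumes "x \<in> moments n"
  shows "next_moments n x \<noteq> {}"
  using assms next_moments_iff[OF unit_moments_extensional[OF assms]] by (auto simp: moment_space_def)

lemma next_moments_unit: "next_moments n x \<subseteq> {0..1}"
  using unit_moments_unit[of _ "Suc n" "Suc n"] by (fastforce simp: next_moments_def)

lemma next_moments_diff_le_width:
  assumes "t1 \<in> next_moments n x" "t2 \<in> next_moments n x"
  shows "t2 - t1 \<le> width n x"
proof -
  have "bdd_above (next_moments n x)" "bdd_below (next_moments n x)"
    using next_moments_unit by (meson bdd_above_Icc bdd_above_mono bdd_below_Icc bdd_below_mono)+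
  then have "t2 \<le> Sup (next_moments n x)" "Inf (next_moments n x) \<le> t1"
    using assms by (auto intro: cSup_upper cInf_lower)
  then show ?thesis by (simp add: width_def)
qed

text \<open>Helly's selection theorem, applied on the whole line; clipping brings the limit back to the unit
  interval without an argument about its support.\<close>

lemma unit_moments_seq_compact:
  assumes X: "\<And>k. X k \<in> moments n"
  obtains r :: "nat \<Rightarrow> nat" and x where "strict_mono r" "x \<in> moments n"
    "\<And>j. j \<in> {1..n} \<Longrightarrow> (\<lambda>i. X (r i) j) \<longlonglongrightarrow> x j"
proof -
  have "\<exists>\<nu>. \<forall>k. \<nu> k \<in> unit_probs \<and> X k = moment_vector n (\<nu> k)"
    using X by (intro choice) (auto simp: moment_space_def)
  then obtain \<nu> where \<nu>: "\<And>k. \<nu> k \<in> unit_probs" "\<And>k. X k = moment_vector n (\<nu> k)" by blast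
  have id_meas: "(\<lambda>x. x) \<in> borel_measurable (\<nu> k)" for k
    unfolding unit_probs_measurable[OF \<nu>(1)] by (intro measurable_restrict_space1) simp
  define D where "D k = distr (\<nu> k) borel (\<lambda>x. x)" for k
  define clip :: "real \<Rightarrow> real" where "clip x = max 0 (min 1 x)" for x
  have clip: "clip x \<in> {0..1}" for x by (auto simp: clip_def)
  have clip_cont: "isCont clip x" for x
    unfolding clip_def by (intro continuous_intros)
  have D: "real_distribution (D k)" for k
    unfolding D_def using \<nu>(1) id_meas by (intro prob_space.real_distribution_distr) (auto simp: unit_probs_iff)
  have "tight D"
    unfolding tight_def
  proof (intro conjI allI impI D)
    fix \<epsilon> :: real assume "0 < \<epsilon>"
    have "measure (D k) {-1<..1} = 1" for k
    proof -
      have "(\<lambda>x. x) -` {-1<..1} \<inter> space (\<nu> k) = space (\<nu> k)"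
        using \<nu>(1) by (auto simp: space_unit_probs)
      then show ?thesis
        using \<nu>(1)[of k] id_meas[of k] by (simp add: D_def measure_distr unit_probs_iff prob_space.prob_space)
    qed
    then show "\<exists>a b. a < b \<and> (\<forall>n. 1 - \<epsilon> < measure (D n) {a<..b})"
      using \<open>0 < \<epsilon>\<close> by (intro exI[of _ "-1"] exI[of _ 1]) auto
  qed
  then obtain r M where r: "strict_mono r" and M: "real_distribution M" "weak_conv_m (D \<circ> id \<circ> r) M"
    using tight_imp_convergent_subsubsequence[of D id] strict_mono_id by blast
  interpret M: real_distribution M by fact
  define N where "N = distr M (restrict_space borel {0..1}) clip"
  have clip_meas: "clip \<in> measurable M (restrict_space borel {0..1})"
    using clip by (intro measurable_restrict_space2) (auto simp: clip_def[abs_def])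
  have N: "N \<in> unit_probs"
    unfolding unit_probs_iff N_def using clip_meas by (auto intro!: M.prob_space_distr)
  have lim: "(\<lambda>i. moment (\<nu> (r i)) j) \<longlonglongrightarrow> moment N j" for j
  proof -
    have "(\<lambda>i. integral\<^sup>L ((D \<circ> id \<circ> r) i) (\<lambda>x. clip x ^ j)) \<longlonglongrightarrow> integral\<^sup>L M (\<lambda>x. clip x ^ j)"
    proof (rule weak_conv_imp_integral_bdd_continuous_conv)
      show "isCont (\<lambda>x. clip x ^ j) x" for x using clip_cont by (intro continuous_intros)
      show "norm (clip x ^ j) \<le> 1" for x using clip[of x] by (auto simp: power_le_one)
    qed (use D M in \<open>auto simp: o_def\<close>)
    moreover have "integral\<^sup>L (D k) (\<lambda>x. clip x ^ j) = moment (\<nu> k) j" for k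
    proof -
      have "integral\<^sup>L (D k) (\<lambda>x. clip x ^ j) = integral\<^sup>L (\<nu> k) (\<lambda>x. clip x ^ j)"
        unfolding D_def using id_meas[of k] by (subst integral_distr) (auto simp: clip_def)
      also have "\<dots> = moment (\<nu> k) j"
        unfolding moment_def using \<nu>(1)[of k]
        by (intro Bochner_Integration.integral_cong) (auto simp: space_unit_probs clip_def)
      finally show ?thesis .
    qed
    moreover have "integral\<^sup>L M (\<lambda>x. clip x ^ j) = moment N j"
      unfolding moment_def N_def using clip_meas
      by (subst integral_distr) (auto intro!: borel_measurable_continuous_on_restrict continuous_intros)
    ultimately show ?thesis by simp
  qed
  show ?thesis
  proof (rule that[OF r])
    show "moment_vector n N \<in> moments n" using N by (auto simp: moment_space_def)
    show "(\<lambda>i. X (r i) j) \<longlonglongrightarrow> moment_vector n N j" if "j \<in> {1..n}" for j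
      using lim[of j] that by (simp add: \<nu> moment_vector_def)
  qed
qed

lemma unit_moments_seq_closed:
  assumes X: "\<And>k. X k \<in> moments n" and x: "x \<in> extensional {1..n}"
    and lim: "\<And>j. j \<in> {1..n} \<Longrightarrow> (\<lambda>i. X i j) \<longlonglongrightarrow> x j"
  shows "x \<in> moments n"
proof -
  obtain r y where r: "strict_mono r" and y: "y \<in> moments n"
    "\<And>j. j \<in> {1..n} \<Longrightarrow> (\<lambda>i. X (r i) j) \<longlonglongrightarrow> y j"
    by (rule unit_moments_seq_compact[of X n, OF X]) blast
  have "x j = y j" for j
  proof (cases "j \<in> {1..n}")
    case True
    have "(\<lambda>i. X (r i) j) \<longlonglongrightarrow> x j"
      using LIMSEQ_subseq_LIMSEQ[OF lim[OF True] r] by (simp add: o_def)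
    with y(2)[OF True] show ?thesis using LIMSEQ_unique by blast
  next
    case False
    then show ?thesis using x unit_moments_extensional[OF y(1)] by (auto simp: extensional_def)
  qed
  then have "x = y" by (rule ext)
  then show ?thesis using y(1) by simp
qed

section \<open>The fibre interval: convexity, concavity and semicontinuity of its width\<close>

lemma next_moments_convex:
  assumes x: "x \<in> extensional {1..n}" "y \<in> extensional {1..n}"
    and s: "s1 \<in> next_moments n x" "s2 \<in> next_moments n y" and t: "0 \<le> t" "t \<le> 1"
  shows "(1 - t) * s1 + t * s2 \<in> next_moments n (mix n t x y)"
proof -
  obtain \<nu>1 \<nu>2 where \<nu>: "\<nu>1 \<in> unit_probs" "\<nu>2 \<in> unit_probs" "x = moment_vector n \<nu>1" "y = moment_vector n \<nu>2"
    "moment \<nu>1 (Suc n) = s1" "moment \<nu>2 (Suc n) = s2"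
    using s unfolding next_moments_iff[OF x(1)] next_moments_iff[OF x(2)] by blast
  obtain \<nu> where "\<nu> \<in> unit_probs" and m: "\<And>j. moment \<nu> j = (1 - t) * moment \<nu>1 j + t * moment \<nu>2 j"
    by (rule mixture_unit_probs[OF \<nu>(1,2) t]) blast
  moreover have "moment_vector n \<nu> = mix n t x y"
    unfolding mix_def \<nu>(3,4) moment_vector_def by (auto simp: m fun_eq_iff restrict_def)
  moreover have "moment \<nu> (Suc n) = (1 - t) * s1 + t * s2" unfolding m \<nu> by (rule refl)
  moreover have "mix n t x y \<in> extensional {1..n}" by (simp add: mix_def)
  ultimately show ?thesis using next_moments_iff by blast
qed

lemma mix_self: "x \<in> extensional {1..n} \<Longrightarrow> mix n t x x = x"
  by (auto simp: mix_def fun_eq_iff extensional_def algebra_simps)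

text \<open>The fibre is a nonempty compact convex set of reals: closed because the moment space one
  level higher is sequentially closed, convex by mixing measures with the same first
  \<open>n\<close> moments.\<close>

lemma next_moments_interval:
  assumes x: "x \<in> moments n"
  obtains t1 t2 where "t1 \<le> t2" "next_moments n x = {t1..t2}" "width n x = t2 - t1"
proof -
  let ?S = "next_moments n x"
  note ext = unit_moments_extensional[OF x]
  have bdd: "bdd_above ?S" "bdd_below ?S"
    using next_moments_unit by (meson bdd_above_Icc bdd_above_mono bdd_below_Icc bdd_below_mono)+
  have "closed ?S"
    unfolding closed_sequential_limits
  proof (intro allI impI, elim conjE)
    fix u l assume u: "\<forall>k. u k \<in> ?S" "u \<longlonglongrightarrow> l"
    have "x(Suc n := l) \<in> moments (Suc n)"
    proof (rule unit_moments_seq_closed[of "\<lambda>k. x(Suc n := u k)"])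
      show "x(Suc n := l) \<in> extensional {1..Suc n}" using ext by (auto simp: extensional_def)
      show "(\<lambda>i. (x(Suc n := u i)) j) \<longlonglongrightarrow> (x(Suc n := l)) j" for j
        using u(2) by (cases "j = Suc n") auto
    qed (use u in \<open>auto simp: next_moments_def\<close>)
    then show "l \<in> ?S" by (simp add: next_moments_def)
  qed
  moreover have "?S \<noteq> {}" using unit_moments_nonempty_next[OF x] .
  ultimately have SI: "Sup ?S \<in> ?S" "Inf ?S \<in> ?S"
    using bdd closed_contains_Sup[of ?S] closed_contains_Inf[of ?S] by auto
  have "convex ?S"
    unfolding convex_alt using next_moments_convex[OF ext ext] mix_self[OF ext] by simp
  then have "is_interval ?S" by (simp add: is_interval_convex_1)
  then have "{Inf ?S..Sup ?S} \<subseteq> ?S"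
    using SI unfolding is_interval_1 by (meson atLeastAtMost_iff subsetI)
  moreover have "?S \<subseteq> {Inf ?S..Sup ?S}" using bdd by (auto intro: cSup_upper cInf_lower)
  ultimately have eq: "?S = {Inf ?S..Sup ?S}" by blast
  have "Inf ?S \<le> Sup ?S" using SI eq by (metis atLeastAtMost_iff)
  with eq show ?thesis using that by (auto simp: width_def)
qed

lemma width_nonneg: "x \<in> moments n \<Longrightarrow> 0 \<le> width n x"
  by (erule next_moments_interval) simp

lemma width_le_1: assumes "x \<in> moments n" shows "width n x \<le> 1"
proof -
  obtain t1 t2 where t: "t1 \<le> t2" "next_moments n x = {t1..t2}" "width n x = t2 - t1"
    using next_moments_interval[OF assms] .
  then have "{t1..t2} \<subseteq> {0..1}" using next_moments_unit by metis
  then show ?thesis using t by auto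
qed

text \<open>Mixing the upper end points and mixing the lower end points gives two points of the
  fibre over the mixed vector; this is concavity.\<close>

lemma width_mix:
  assumes x: "x \<in> moments n" and y: "y \<in> moments n" and t: "0 \<le> t" "t \<le> 1"
  shows "(1 - t) * width n x + t * width n y \<le> width n (mix n t x y)"
proof -
  obtain a1 a2 where a: "a1 \<le> a2" "next_moments n x = {a1..a2}" "width n x = a2 - a1"
    using next_moments_interval[OF x] .
  obtain b1 b2 where b: "b1 \<le> b2" "next_moments n y = {b1..b2}" "width n y = b2 - b1"
    using next_moments_interval[OF y] .
  note c = next_moments_convex[OF unit_moments_extensional[OF x] unit_moments_extensional[OF y] _ _ t]
  have "((1 - t) * a2 + t * b2) - ((1 - t) * a1 + t * b1) \<le> width n (mix n t x y)"
    by (rule next_moments_diff_le_width) (auto intro!: c simp: a b)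
  then show ?thesis unfolding a(3) b(3) by (simp add: algebra_simps)
qed

text \<open>Both end points are vectors in the compact moment space of level \<open>Suc n\<close>.
  Along nested subsequences they converge, and the limits lie in the fibre over \<open>x\<close>, so
  the width cannot drop in the limit.\<close>

lemma width_usc:
  assumes X: "\<And>k. X k \<in> moments n" and x: "x \<in> extensional {1..n}"
    and lim: "\<And>j. j \<in> {1..n} \<Longrightarrow> (\<lambda>i. X i j) \<longlonglongrightarrow> x j"
    and w: "\<And>k. a \<le> width n (X k)"
  shows "x \<in> moments n \<and> a \<le> width n x"
proof
  show "x \<in> moments n" using unit_moments_seq_closed[OF X x lim] .
  have "\<exists>t1 t2. next_moments n (X k) = {t1..t2} \<and> t1 \<le> t2 \<and> width n (X k) = t2 - t1" for k
    using next_moments_interval[OF X[of k]] by metis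
  then obtain t1 t2 where t: "\<And>k. next_moments n (X k) = {t1 k..t2 k}" "\<And>k. t1 k \<le> t2 k"
    "\<And>k. width n (X k) = t2 k - t1 k" by metis
  have m: "(X k)(Suc n := t1 k) \<in> moments (Suc n)" "(X k)(Suc n := t2 k) \<in> moments (Suc n)" for k
  proof -
    have "t1 k \<in> next_moments n (X k)" "t2 k \<in> next_moments n (X k)" unfolding t(1) using t(2) by auto
    then show "(X k)(Suc n := t1 k) \<in> moments (Suc n)" "(X k)(Suc n := t2 k) \<in> moments (Suc n)"
      unfolding next_moments_def by (simp_all only: mem_Collect_eq)
  qed
  obtain r y where r: "strict_mono r" and y: "y \<in> moments (Suc n)"
    "\<And>j. j \<in> {1..Suc n} \<Longrightarrow> (\<lambda>i. ((X (r i))(Suc n := t1 (r i))) j) \<longlonglongrightarrow> y j"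
    using unit_moments_seq_compact[of "\<lambda>k. (X k)(Suc n := t1 k)", OF m(1)] by blast
  obtain r' y' where r': "strict_mono r'" and y': "y' \<in> moments (Suc n)"
    "\<And>j. j \<in> {1..Suc n} \<Longrightarrow> (\<lambda>i. ((X (r (r' i)))(Suc n := t2 (r (r' i)))) j) \<longlonglongrightarrow> y' j"
    using unit_moments_seq_compact[of "\<lambda>k. (X (r k))(Suc n := t2 (r k))", OF m(2)] by blast
  have rr': "strict_mono (\<lambda>i. r (r' i))" using strict_mono_o[OF r r'] by (simp add: o_def)
  have limr: "(\<lambda>i. X (r (r' i)) j) \<longlonglongrightarrow> x j" if "j \<in> {1..n}" for j
    using LIMSEQ_subseq_LIMSEQ[OF lim[OF that] rr'] by (simp add: o_def)
  have yr: "(\<lambda>i. ((X (r (r' i)))(Suc n := t1 (r (r' i)))) j) \<longlonglongrightarrow> y j" if "j \<in> {1..Suc n}" for j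
    using LIMSEQ_subseq_LIMSEQ[OF y(2)[OF that] r'] by (simp add: o_def)
  have "y = x(Suc n := y (Suc n))" "y' = x(Suc n := y' (Suc n))"
  proof -
    have "y j = x j \<and> y' j = x j" if "j \<noteq> Suc n" for j
    proof (cases "j \<in> {1..n}")
      case True
      then have "(\<lambda>i. X (r (r' i)) j) \<longlonglongrightarrow> y j" "(\<lambda>i. X (r (r' i)) j) \<longlonglongrightarrow> y' j"
        using yr[of j] y'(2)[of j] that by simp_all
      then show ?thesis using limr[OF True] LIMSEQ_unique by blast
    next
      case False
      then show ?thesis
        using x unit_moments_extensional[OF y(1)] unit_moments_extensional[OF y'(1)] that by (auto simp: extensional_def)
    qed
    then show "y = x(Suc n := y (Suc n))" "y' = x(Suc n := y' (Suc n))" by auto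
  qed
  note eq = this
  have "x(Suc n := y (Suc n)) \<in> moments (Suc n)" using y(1) by (subst eq(1)[symmetric])
  moreover have "x(Suc n := y' (Suc n)) \<in> moments (Suc n)" using y'(1) by (subst eq(2)[symmetric])
  ultimately have "y (Suc n) \<in> next_moments n x" "y' (Suc n) \<in> next_moments n x"
    by (simp_all add: next_moments_def)
  then have "y' (Suc n) - y (Suc n) \<le> width n x" by (intro next_moments_diff_le_width)
  moreover have "a \<le> y' (Suc n) - y (Suc n)"
  proof (rule LIMSEQ_le_const)
    show "(\<lambda>i. t2 (r (r' i)) - t1 (r (r' i))) \<longlonglongrightarrow> y' (Suc n) - y (Suc n)"
      using yr[of "Suc n"] y'(2)[of "Suc n"] by (intro tendsto_diff) auto
    show "\<exists>N. \<forall>i\<ge>N. a \<le> t2 (r (r' i)) - t1 (r (r' i))" using w t(3) by metis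
  qed
  ultimately show "a \<le> width n x" by linarith
qed

text \<open>The measures \<open>x d\<nu>\<^sub>1 + (1 - x) d\<nu>\<^sub>2\<close> and \<open>(1 - x) d\<nu>\<^sub>1 + x d\<nu>\<^sub>2\<close> turn a gap between the moments of order
  \<open>m + 2\<close> into one between those of order \<open>m + 1\<close>.\<close>

lemma width_restrict_pos:
  assumes x: "x \<in> moments (Suc m)" and w: "0 < width (Suc m) x"
  shows "0 < width m (restrict x {1..m})"
proof -
  have *: "\<exists>\<nu>\<in>unit_probs. moment_vector m \<nu> = restrict x {1..m} \<and>
      moment \<nu> (Suc m) = x (Suc m) + moment \<nu>1 (Suc (Suc m)) - moment \<nu>2 (Suc (Suc m))"
    if \<nu>: "\<nu>1 \<in> unit_probs" "\<nu>2 \<in> unit_probs" "moment_vector (Suc m) \<nu>1 = x" "moment_vector (Suc m) \<nu>2 = x" for \<nu>1 \<nu>2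
  proof -
    have eq: "moment \<nu>1 j = x j" "moment \<nu>2 j = x j" if "j \<in> {1..Suc m}" for j
      using that fun_cong[OF \<nu>(3), of j] fun_cong[OF \<nu>(4), of j] by (auto simp: moment_vector_def)
    have int: "integrable \<nu>1 (\<lambda>x. x ^ j)" "integrable \<nu>2 (\<lambda>x. x ^ j)" for j
      using \<nu> by (auto intro!: continuous_intros)
    have int': "integrable \<nu>2 (\<lambda>x. x)" "integrable \<nu>2 (\<lambda>x. 1 :: real)" using int(2)[of 1] int(2)[of 0] by simp_all
    \<comment> \<open>The total mass is 1 because the two measures share their first moment; this is
      where the level \<open>Suc m\<close>, which is at least 1, matters.\<close>
    have one: "(\<integral>x. x \<partial>\<nu>1) + (\<integral>x. 1 - x \<partial>\<nu>2) = 1"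
      using eq[of 1] moment_0[OF \<nu>(2)] int' by (simp add: moment_def)
    obtain \<nu> where \<nu>': "\<nu> \<in> unit_probs" "\<And>f :: real \<Rightarrow> real. continuous_on {0..1} f \<Longrightarrow>
       (\<integral>x. f x \<partial>\<nu>) = (\<integral>x. x * f x \<partial>\<nu>1) + (\<integral>x. (1 - x) * f x \<partial>\<nu>2)"
      by (rule combine_unit_probs[OF \<nu>(1,2) _ _ _ _ one])
        (auto intro!: continuous_intros)
    have mom: "moment \<nu> j = moment \<nu>1 (Suc j) + moment \<nu>2 j - moment \<nu>2 (Suc j)" for j
      using \<nu>'(2)[of "\<lambda>x. x ^ j"] int(2)[of j] int(2)[of "Suc j"]
      by (simp add: moment_def continuous_on_power left_diff_distrib)
    have "moment_vector m \<nu> = restrict x {1..m}"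
      using mom eq by (auto simp: moment_vector_def fun_eq_iff restrict_def)
    with mom[of "Suc m"] eq[of "Suc m"] \<nu>'(1) show ?thesis by auto
  qed
  obtain t1 t2 where t: "t1 \<le> t2" "next_moments (Suc m) x = {t1..t2}" "width (Suc m) x = t2 - t1"
    using next_moments_interval[OF x] .
  note ni = next_moments_iff[OF unit_moments_extensional[OF x]]
  obtain \<nu>1 \<nu>2 where \<nu>: "\<nu>1 \<in> unit_probs" "\<nu>2 \<in> unit_probs" "moment_vector (Suc m) \<nu>1 = x"
    "moment_vector (Suc m) \<nu>2 = x" "moment \<nu>1 (Suc (Suc m)) = t1" "moment \<nu>2 (Suc (Suc m)) = t2"
  proof -
    have "t1 \<in> next_moments (Suc m) x" "t2 \<in> next_moments (Suc m) x" using t by auto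
    then show ?thesis unfolding ni using that by blast
  qed
  have "x (Suc m) + t1 - t2 \<in> next_moments m (restrict x {1..m})"
    "x (Suc m) + t2 - t1 \<in> next_moments m (restrict x {1..m})"
    unfolding next_moments_iff[OF restrict_extensional]
    using *[OF \<nu>(1,2,3,4)] *[OF \<nu>(2,1,4,3)] unfolding \<nu>(5,6) by blast+
  from next_moments_diff_le_width[OF this] t w show ?thesis by simp
qed

section \<open>The arcsine distribution\<close>

lemma sets_arcsine: "sets arcsine = sets (restrict_space borel {0..1})"
  unfolding arcsine_def sets_density by (rule sets_restrict_space_cong) simp

lemma space_arcsine [simp]: "space arcsine = {0..1}"
  using sets_eq_imp_space_eq[OF sets_arcsine] by (simp add: space_restrict_space)

lemma half_one_plus_cos: "(1 + cos t) / 2 \<in> {0..1::real}"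
proof -
  have "0 \<le> 1 + cos t" "1 + cos t \<le> 2" using cos_ge_minus_one[of t] cos_le_one[of t] by linarith+
  then show ?thesis by simp
qed

text \<open>Substitution \<open>x = (1 + cos t) / 2\<close>; on \<open>[\<pi>, 2\<pi>]\<close> this is increasing, and \<open>[0, \<pi>]\<close> is its mirror image.\<close>

lemma arcsine_nn_integral:
  fixes f :: "real \<Rightarrow> real"
  assumes f: "continuous_on {0..1} f" and nonneg: "\<And>x. x \<in> {0..1} \<Longrightarrow> 0 \<le> f x"
  shows "(\<integral>\<^sup>+x. ennreal (f x) \<partial>arcsine) = ennreal (integral {0..2*pi} (\<lambda>t. f ((1 + cos t) / 2)) / (2 * pi))"
proof -
  define g :: "real \<Rightarrow> real" where "g t = (1 + cos t) / 2" for t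
  have g01: "g t \<in> {0..1}" for t
    unfolding g_def by (rule half_one_plus_cos)
  define F where "F x = ennreal (indicator {0..1} x * f x / (pi * sqrt (x * (1 - x))))" for x
  define H where "H t = ennreal (f (g t) / pi)" for t
  have f_meas: "(\<lambda>x. indicator {0..1} x * f x) \<in> borel_measurable borel"
    using borel_measurable_continuous_on_indicator[OF _ f] by simp
  have F_meas [measurable]: "F \<in> borel_measurable borel"
    unfolding F_def using f_meas by measurable
  have g_cont: "continuous_on A g" for A unfolding g_def by (intro continuous_intros) auto
  have fg_cont: "continuous_on A (\<lambda>t. f (g t))" for A
    using g01 by (intro continuous_on_compose2[OF f g_cont]) auto
  have H_meas [measurable]: "H \<in> borel_measurable borel"
    unfolding H_def by (intro measurable_compose[OF borel_measurable_continuous_onI measurable_ennreal] continuous_intros fg_cont) auto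
  have "(\<integral>\<^sup>+x. ennreal (f x) \<partial>arcsine) =
    (\<integral>\<^sup>+x. ennreal (1 / (pi * sqrt (x * (1 - x)))) * ennreal (f x) \<partial>restrict_space lborel {0..1})"
    unfolding arcsine_def
  proof (rule nn_integral_density)
    show "(\<lambda>x. ennreal (f x)) \<in> borel_measurable (restrict_space lborel {0..1})"
      using borel_measurable_continuous_on_restrict[OF f]
        measurable_cong_sets[OF sets_restrict_space_cong[OF sets_lborel] refl] by auto
  qed (auto intro!: measurable_restrict_space1)
  also have "\<dots> = (\<integral>\<^sup>+x. ennreal (1 / (pi * sqrt (x * (1 - x)))) * ennreal (f x) * indicator {0..1} x \<partial>lborel)"
    by (rule nn_integral_restrict_space) simp
  also have "\<dots> = (\<integral>\<^sup>+x. F x * indicator {g pi..g (2*pi)} x \<partial>lborel)"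
    using nonneg by (intro nn_integral_cong)
      (auto simp: F_def g_def indicator_def ennreal_mult[symmetric] mult.commute)
  also have "\<dots> = (\<integral>\<^sup>+t. F (g t) * ennreal (- sin t / 2) * indicator {pi..2*pi} t \<partial>lborel)"
  proof (rule nn_integral_substitution_aux)
    show "(g has_real_derivative - sin t / 2) (at t)" for t
      unfolding g_def by (auto intro!: derivative_eq_intros)
    show "continuous_on {pi..2*pi} (\<lambda>t. - sin t / 2)" by (intro continuous_intros) auto
    show "0 \<le> - sin t / 2" if "t \<in> {pi..2*pi}" for t
      using sin_le_zero[of t] that by (cases "t = 2 * pi") auto
  qed (auto)
  \<comment> \<open>At the two end points the arcsine density is read as \<open>1 / 0 = 0\<close>,
    so the integrands agree only off a null set.\<close>
  also have "\<dots> = (\<integral>\<^sup>+t. H t * indicator {pi..2*pi} t \<partial>lborel)"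
  proof (rule nn_integral_cong_AE, rule AE_I[where N = "{pi, 2*pi}"])
    have "F (g t) * ennreal (- sin t / 2) = H t" if "t \<in> {pi<..<2*pi}" for t
    proof -
      have s: "sin t < 0" using sin_lt_zero that by auto
      have "g t * (1 - g t) = (- sin t / 2)\<^sup>2"
        unfolding g_def power_divide power2_minus sin_squared_eq by (simp add: power2_eq_square field_simps)
      then have sq: "sqrt (g t * (1 - g t)) = - sin t / 2"
        using s by (simp only: real_sqrt_abs)
      have "F (g t) * ennreal (- sin t / 2) = ennreal (f (g t) / (pi * (- sin t / 2)) * (- sin t / 2))"
        unfolding F_def sq using g01[of t] nonneg[OF g01, of t] s
        by (subst ennreal_mult''[symmetric]) auto
      also have "f (g t) / (pi * (- sin t / 2)) * (- sin t / 2) = f (g t) / pi"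
        using s by simp
      finally show ?thesis by (simp add: H_def)
    qed
    then show "{t \<in> space lborel. F (g t) * ennreal (- sin t / 2) * indicator {pi..2*pi} t \<noteq> H t * indicator {pi..2*pi} t} \<subseteq> {pi, 2*pi}"
      by (auto simp: indicator_def) force
  qed (auto intro!: emeasure_lborel_countable)
  finally have half: "(\<integral>\<^sup>+x. ennreal (f x) \<partial>arcsine) = (\<integral>\<^sup>+t. H t * indicator {pi..2*pi} t \<partial>lborel)" .
  have "(\<integral>\<^sup>+t. H t * indicator {pi..2*pi} t \<partial>lborel) =
      (\<integral>\<^sup>+t. H (2 * pi - t) * indicator {pi..2*pi} (2 * pi - t) \<partial>lborel)"
    using nn_integral_real_affine[of "\<lambda>t. H t * indicator {pi..2*pi} t" "-1" "2*pi"] by simp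
  also have "\<dots> = (\<integral>\<^sup>+t. H t * indicator {0..pi} t \<partial>lborel)"
    by (intro nn_integral_cong) (auto simp: H_def g_def indicator_def cos_diff)
  finally have mirror: "(\<integral>\<^sup>+t. H t * indicator {pi..2*pi} t \<partial>lborel) = (\<integral>\<^sup>+t. H t * indicator {0..pi} t \<partial>lborel)" .
  have Hint: "((\<lambda>t. f (g t) / pi) has_integral integral {0..2*pi} (\<lambda>t. f (g t) / pi)) {0..2*pi}"
    by (intro integrable_integral integrable_continuous_interval continuous_intros fg_cont) auto
  have "(\<integral>\<^sup>+t. H t * indicator {0..pi} t \<partial>lborel) + (\<integral>\<^sup>+t. H t * indicator {pi..2*pi} t \<partial>lborel) =
      (\<integral>\<^sup>+t. H t * indicator {0..pi} t + H t * indicator {pi..2*pi} t \<partial>lborel)"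
    by (rule nn_integral_add[symmetric]) auto
  also have "\<dots> = (\<integral>\<^sup>+t. ennreal (indicator {0..2*pi} t * (f (g t) / pi)) \<partial>lborel)"
    by (intro nn_integral_cong_AE AE_I[where N = "{pi}"]) (auto simp: H_def indicator_def)
  also have "\<dots> = ennreal (integral {0..2*pi} (\<lambda>t. f (g t) / pi))"
    by (rule nn_integral_has_integral_lebesgue[OF _ Hint]) (simp add: nonneg[OF g01])
  finally have two: "2 * (\<integral>\<^sup>+x. ennreal (f x) \<partial>arcsine) = ennreal (integral {0..2*pi} (\<lambda>t. f (g t) / pi))"
    unfolding mirror[symmetric] half[symmetric] by (simp only: mult_2)
  have nn: "0 \<le> integral {0..2*pi} (\<lambda>t. f (g t))"
    using nonneg[OF g01] by (intro integral_nonneg integrable_continuous_interval fg_cont) auto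
  have "ennreal (1 / 2) * ennreal 2 = 1" by (subst ennreal_mult[symmetric]) auto
  then have "(\<integral>\<^sup>+x. ennreal (f x) \<partial>arcsine) = ennreal (1 / 2) * (2 * (\<integral>\<^sup>+x. ennreal (f x) \<partial>arcsine))"
    by (simp flip: mult.assoc)
  also have "\<dots> = ennreal (integral {0..2*pi} (\<lambda>t. f (g t)) / (2 * pi))"
    unfolding two using nn by (subst ennreal_mult[symmetric]) (auto simp: mult.commute)
  finally show ?thesis by (simp add: g_def)
qed

lemma arcsine_unit_probs: "arcsine \<in> unit_probs"
proof -
  have "emeasure arcsine (space arcsine) = (\<integral>\<^sup>+x. ennreal 1 \<partial>arcsine)" by simp
  also have "\<dots> = 1" by (subst arcsine_nn_integral) auto
  finally have "prob_space arcsine" by (rule prob_spaceI)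
  then show ?thesis by (simp add: unit_probs_iff sets_arcsine)
qed

text \<open>Adding a bound \<open>B\<close> makes the integrand nonnegative, and both sides change
  by \<open>B\<close> under this shift.\<close>

lemma arcsine_integral:
  fixes f :: "real \<Rightarrow> real"
  assumes f: "continuous_on {0..1} f"
  shows "(\<integral>x. f x \<partial>arcsine) = integral {0..2*pi} (\<lambda>t. f ((1 + cos t) / 2)) / (2 * pi)"
proof -
  have "bounded (f ` {0..1})"
    by (intro compact_imp_bounded compact_continuous_image f compact_Icc)
  then obtain B where B: "\<And>x. x \<in> {0..1} \<Longrightarrow> \<bar>f x\<bar> \<le> B"
    unfolding bounded_iff real_norm_def by blast
  define F where "F x = f x + B" for x
  have F: "continuous_on {0..1} F" "\<And>x. x \<in> {0..1} \<Longrightarrow> 0 \<le> F x"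
  proof -
    show "continuous_on {0..1} F" unfolding F_def using f by (intro continuous_intros)
    show "0 \<le> F x" if "x \<in> {0..1}" for x using B[OF that] by (simp add: F_def abs_le_iff)
  qed
  have fg_cont: "continuous_on {0..2*pi} (\<lambda>t. f ((1 + cos t) / 2))"
  proof (intro continuous_on_compose2[OF f])
    show "(\<lambda>t. (1 + cos t) / 2) ` {0..2 * pi} \<subseteq> {0..1}" using half_one_plus_cos by blast
  qed (auto intro!: continuous_intros)
  have i: "integrable arcsine F" "integrable arcsine f"
    using arcsine_unit_probs F f by auto
  have "ennreal (\<integral>x. F x \<partial>arcsine) = (\<integral>\<^sup>+x. ennreal (F x) \<partial>arcsine)"
    using i F by (intro nn_integral_eq_integral[symmetric]) auto
  also have "\<dots> = ennreal (integral {0..2*pi} (\<lambda>t. F ((1 + cos t) / 2)) / (2 * pi))"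
    by (rule arcsine_nn_integral[OF F])
  also have "integral {0..2*pi} (\<lambda>t. F ((1 + cos t) / 2)) = integral {0..2*pi} (\<lambda>t. f ((1 + cos t) / 2)) + 2 * pi * B"
    unfolding F_def using fg_cont
    by (subst Henstock_Kurzweil_Integration.integral_add) (auto intro: integrable_continuous_interval)
  finally have eq: "ennreal (\<integral>x. F x \<partial>arcsine) = ennreal ((integral {0..2*pi} (\<lambda>t. f ((1 + cos t) / 2)) + 2 * pi * B) / (2 * pi))" .
  have "0 \<le> (\<integral>x. F x \<partial>arcsine)" using unit_probs_nonneg[OF arcsine_unit_probs F(2)] by simp
  moreover have "0 \<le> integral {0..2*pi} (\<lambda>t. f ((1 + cos t) / 2)) + 2 * pi * B"
  proof -
    have "integral {0..2*pi} (\<lambda>t. - B) \<le> integral {0..2*pi} (\<lambda>t. f ((1 + cos t) / 2))"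
      using fg_cont
    proof (intro integral_le integrable_continuous_interval)
      show "- B \<le> f ((1 + cos t) / 2)" for t
        using B[OF half_one_plus_cos, of t] by linarith
    qed auto
    then show ?thesis by simp
  qed
  ultimately have "(\<integral>x. F x \<partial>arcsine) = (integral {0..2*pi} (\<lambda>t. f ((1 + cos t) / 2)) + 2 * pi * B) / (2 * pi)"
    using eq by (subst (asm) ennreal_inj) auto
  moreover have "(\<integral>x. F x \<partial>arcsine) = (\<integral>x. f x \<partial>arcsine) + B"
    unfolding F_def using i arcsine_unit_probs unit_probs_one[OF arcsine_unit_probs]
    by (subst Bochner_Integration.integral_add) (auto simp: unit_probs_iff prob_space.prob_space prob_space.finite_measure finite_measure.integrable_const)
  ultimately show ?thesis by (simp add: field_simps)
qed

section \<open>Mean values of holomorphic functions on the unit circle\<close>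

text \<open>Cauchy's formula at the centre: on the unit circle \<open>du / u\<close> is
  \<open>i dt\<close>.\<close>

lemma circle_mean_holomorphic:
  fixes f :: "complex \<Rightarrow> complex"
  assumes "f holomorphic_on S" "open S" "cball 0 1 \<subseteq> S"
  shows "((\<lambda>t. f (cis t)) has_integral 2 * pi * f 0) {0..2*pi}"
proof -
  have "((\<lambda>u. f u / (u - 0)) has_contour_integral 2 * of_real pi * \<i> * f 0) (circlepath 0 1)"
  proof (rule Cauchy_integral_circlepath)
    show "continuous_on (cball 0 1) f"
      using assms by (meson holomorphic_on_imp_continuous_on holomorphic_on_subset)
    show "f holomorphic_on ball 0 1"
      using assms by (meson ball_subset_cball holomorphic_on_subset order_trans)
  qed auto
  then have "((\<lambda>t. f (cis t) / cis t * \<i> * cis t) has_integral 2 * of_real pi * \<i> * f 0) {0..2*pi}"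
    unfolding circlepath_def by (subst (asm) has_contour_integral_part_circlepath_iff) auto
  then have "((\<lambda>t. \<i> * f (cis t)) has_integral \<i> * (2 * of_real pi * f 0)) {0..2*pi}"
    by (simp add: algebra_simps)
  from has_integral_mult_right[OF this, of "- \<i>"] show ?thesis
    by (simp add: mult.assoc[symmetric])
qed

lemma circle_mean_Re:
  fixes f :: "complex \<Rightarrow> complex"
  assumes "f holomorphic_on S" "open S" "cball 0 1 \<subseteq> S"
  shows "integral {0..2*pi} (\<lambda>t. Re (f (cis t))) / (2 * pi) = Re (f 0)"
proof -
  have "((\<lambda>t. Re (f (cis t))) has_integral Re (2 * pi * f 0)) {0..2*pi}"
    using has_integral_linear[OF circle_mean_holomorphic[OF assms] bounded_linear_Re] by (simp add: o_def)
  then show ?thesis by (simp add: integral_unique)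
qed

section \<open>Bernstein-Szego measures\<close>

text \<open>\<open>szego l N h k q T U\<close>: \<open>h\<close> is the unnormalised reversed Szego polynomial of degree \<open>l\<close> with reflection
  coefficients \<open>s\<close>, \<open>k\<close> is its reversal, and for \<open>x = (1 + cos t) / 2\<close>, \<open>z = cis t\<close> the polynomials in \<open>x\<close> satisfy
  \<open>q = |h|\<^sup>2\<close> and \<open>T + i sin t U = z k cnj h\<close>; the factor \<open>N\<close> gives \<open>N / q\<close> mean 1.  The polynomials \<open>[:-1, 2:]\<close> and \<open>[:0, 4, -4:]\<close> are \<open>cos t\<close> and \<open>sin\<^sup>2 t\<close>.\<close>

inductive szego :: "nat \<Rightarrow> real \<Rightarrow> (complex \<Rightarrow> complex) \<Rightarrow> (complex \<Rightarrow> complex) \<Rightarrow>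
    real poly \<Rightarrow> real poly \<Rightarrow> real poly \<Rightarrow> bool" where
  zero: "szego 0 1 (\<lambda>_. 1) (\<lambda>_. 1) 1 [:-1, 2:] 1"
| step: "szego l N h k q T U \<Longrightarrow> \<bar>s\<bar> < 1 \<Longrightarrow>
    szego (Suc l) (N * (1 - s\<^sup>2)) (\<lambda>z. h z - of_real s * z * k z) (\<lambda>z. z * k z - of_real s * h z)
      (smult (1 + s\<^sup>2) q - smult (2 * s) T)
      ([:-1, 2:] * T - [:0, 4, -4:] * U - smult (2 * s) ([:-1, 2:] * q) + smult (s\<^sup>2) ([:-1, 2:] * T + [:0, 4, -4:] * U))
      (T + [:-1, 2:] * U - smult (2 * s) q + smult (s\<^sup>2) (T - [:-1, 2:] * U))"

definition szego_measure :: "real \<Rightarrow> real poly \<Rightarrow> real measure" where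
  "szego_measure N q = density arcsine (\<lambda>x. ennreal (N / poly q x))"

lemma sq_less_1: "\<bar>s\<bar> < 1 \<Longrightarrow> s\<^sup>2 < (1::real)"
  by (simp add: abs_square_less_1)

lemma szego_pos: "szego l N h k q T U \<Longrightarrow> 0 < N"
  by (induction rule: szego.induct) (auto simp: sq_less_1)

lemma szego_holomorphic: "szego l N h k q T U \<Longrightarrow> h holomorphic_on A \<and> k holomorphic_on A"
  by (induction rule: szego.induct) (auto intro!: holomorphic_intros)

lemma szego_at_0: "szego l N h k q T U \<Longrightarrow> h 0 = 1"
  by (induction rule: szego.induct) auto

text \<open>The bound on \<open>k\<close> is carried along because it gives |s z k| < |h|, hence no
  zero at the next step. It reproduces itself through the identity |h - s w|^2 - |w - s h|^2 = (1 -
  s^2) (|h|^2 - |w|^2) with w = z k. Absence of zeros makes quotients by \<open>h\<close> and a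
  logarithm of \<open>h\<close> holomorphic near the closed disc.\<close>

lemma szego_disc: "szego l N h k q T U \<Longrightarrow> norm z \<le> 1 \<Longrightarrow> h z \<noteq> 0 \<and> norm (k z) \<le> norm (h z)"
proof (induction rule: szego.induct)
  case (step l N h k q T U s)
  define w where "w = z * k z"
  have hk: "h z \<noteq> 0" "norm (k z) \<le> norm (h z)" using step by auto
  have w: "norm w \<le> norm (h z)"
    unfolding w_def norm_mult using hk step(4) by (meson mult_left_le_one_le norm_ge_zero order_trans)
  have "norm (of_real s * w) < norm (h z)"
  proof -
    have "norm (of_real s * w) \<le> \<bar>s\<bar> * norm (h z)" using w by (simp add: norm_mult mult_left_mono)
    also have "\<dots> < 1 * norm (h z)" using step(2) hk by (intro mult_strict_right_mono) auto
    finally show ?thesis by simp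
  qed
  then have "h z \<noteq> of_real s * w" by auto
  moreover have "(norm (w - of_real s * h z))\<^sup>2 \<le> (norm (h z - of_real s * w))\<^sup>2"
  proof -
    have "(norm (h z - of_real s * w))\<^sup>2 - (norm (w - of_real s * h z))\<^sup>2 = (1 - s\<^sup>2) * ((norm (h z))\<^sup>2 - (norm w)\<^sup>2)"
      unfolding cmod_power2 by (simp add: power2_eq_square algebra_simps)
    moreover have "0 \<le> (1 - s\<^sup>2) * ((norm (h z))\<^sup>2 - (norm w)\<^sup>2)"
      using w sq_less_1[OF step(2)] by (intro mult_nonneg_nonneg) (auto intro: power_mono)
    ultimately show ?thesis by linarith
  qed
  ultimately show ?case
    by (auto simp: w_def mult.assoc dest: power2_le_imp_le)
qed auto

text \<open>Write A = T + i sin t U. Then z A has real part cos t T - sin^2 t U and imaginary part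
  sin t (T + cos t U), while z times the conjugate of A has real part cos t T + sin^2 t U and
  imaginary part sin t (T - cos t U). These are the combinations in the recursion for
  \<open>T\<close> and \<open>U\<close>.\<close>

lemma szego_circle:
  fixes t :: real
  defines "z \<equiv> cis t" and "x \<equiv> (1 + cos t) / 2"
  assumes "szego l N h k q T U"
  shows "h z * cnj (h z) = of_real (poly q x) \<and> k z * cnj (k z) = of_real (poly q x) \<and>
    z * k z * cnj (h z) = Complex (poly T x) (sin t * poly U x) \<and> k z = z ^ l * cnj (h z)"
  using assms(3)
proof (induction rule: szego.induct)
  case zero
  show ?case by (auto simp: z_def x_def complex_eq_iff add_divide_distrib cis_cnj cis_mult)
next
  case (step l N h k q T U s)
  have zz: "z * cnj z = 1" by (simp add: z_def cis_cnj cis_mult)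
  define H K A Q where "H = h z" and "K = k z" and "A = Complex (poly T x) (sin t * poly U x)"
    and "Q = complex_of_real (poly q x)"
  have HH: "H * cnj H = Q" and KK: "K * cnj K = Q" and A: "z * K * cnj H = A" and K: "K = z ^ l * cnj H"
    using step.IH by (auto simp: H_def K_def A_def Q_def)
  have A': "cnj z * cnj K * H = cnj A" using A[symmetric] by simp
  \<comment> \<open>The expansions \<open>1\<close> to \<open>3\<close> are grouped into exactly the
    products evaluated by \<open>HH\<close>, \<open>KK\<close>, \<open>A\<close>, \<open>A'\<close>
    and \<open>zz\<close>.\<close>
  have 1: "(H - of_real s * z * K) * cnj (H - of_real s * z * K) =
      H * cnj H - s * (z * K * cnj H) - s * (cnj z * cnj K * H) + s\<^sup>2 * ((z * cnj z) * (K * cnj K))"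
    by (simp add: algebra_simps power2_eq_square)
  have 2: "(z * K - of_real s * H) * cnj (z * K - of_real s * H) =
      (z * cnj z) * (K * cnj K) - s * (z * K * cnj H) - s * (cnj z * cnj K * H) + s\<^sup>2 * (H * cnj H)"
    by (simp add: algebra_simps power2_eq_square)
  have 3: "z * (z * K - of_real s * H) * cnj (H - of_real s * z * K) =
      z * (z * K * cnj H) - s * z * ((z * cnj z) * (K * cnj K)) - s * z * (H * cnj H) + s\<^sup>2 * z * (cnj z * cnj K * H)"
    by (simp add: algebra_simps power2_eq_square)
  have zl: "z ^ l * cnj z ^ l = 1" using zz by (simp flip: power_mult_distrib)
  have "z ^ Suc l * cnj (H - of_real s * z * K) = z * (z ^ l * cnj H) - s * ((z * cnj z) * (z ^ l * cnj z ^ l) * H)"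
    by (simp add: K algebra_simps)
  then have 4: "z * K - of_real s * H = z ^ Suc l * cnj (H - of_real s * z * K)"
    unfolding zz zl K[symmetric] by simp
  have "2 * x = 1 + cos t" by (simp add: x_def)
  then have ct: "cos t = 2 * x - 1" by linarith
  have Y: "poly [:-1, 2:] x = cos t" and W: "poly [:0, 4, -4:] x = (sin t)\<^sup>2"
    unfolding sin_squared_eq ct by (simp_all add: power2_eq_square algebra_simps)
  have z: "z = Complex (cos t) (sin t)" by (simp add: z_def complex_eq_iff)
  have q': "poly (smult (1 + s\<^sup>2) q - smult (2 * s) T) x = (1 + s\<^sup>2) * poly q x - 2 * s * poly T x"
    by (simp only: poly_diff poly_smult)
  have T': "poly ([:-1, 2:] * T - [:0, 4, -4:] * U - smult (2 * s) ([:-1, 2:] * q) + smult (s\<^sup>2) ([:-1, 2:] * T + [:0, 4, -4:] * U)) x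
    = cos t * poly T x - (sin t)\<^sup>2 * poly U x - 2 * s * (cos t * poly q x) + s\<^sup>2 * (cos t * poly T x + (sin t)\<^sup>2 * poly U x)"
    by (simp only: poly_diff poly_add poly_mult poly_smult Y W)
  have U': "poly (T + [:-1, 2:] * U - smult (2 * s) q + smult (s\<^sup>2) (T - [:-1, 2:] * U)) x
    = poly T x + cos t * poly U x - 2 * s * poly q x + s\<^sup>2 * (poly T x - cos t * poly U x)"
    by (simp only: poly_diff poly_add poly_mult poly_smult Y W)
  show ?case
    unfolding H_def[symmetric] K_def[symmetric] q' T' U'
  proof (intro conjI)
    show "(H - of_real s * z * K) * cnj (H - of_real s * z * K) = of_real ((1 + s\<^sup>2) * poly q x - 2 * s * poly T x)"
      unfolding 1 HH KK A A' zz by (simp add: complex_eq_iff A_def Q_def algebra_simps)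
    show "(z * K - of_real s * H) * cnj (z * K - of_real s * H) = of_real ((1 + s\<^sup>2) * poly q x - 2 * s * poly T x)"
      unfolding 2 HH KK A A' zz by (simp add: complex_eq_iff A_def Q_def algebra_simps)
    show "z * (z * K - of_real s * H) * cnj (H - of_real s * z * K) =
      Complex (cos t * poly T x - (sin t)\<^sup>2 * poly U x - 2 * s * (cos t * poly q x) + s\<^sup>2 * (cos t * poly T x + (sin t)\<^sup>2 * poly U x))
       (sin t * (poly T x + cos t * poly U x - 2 * s * poly q x + s\<^sup>2 * (poly T x - cos t * poly U x)))"
      unfolding 3 HH KK A A' zz unfolding z A_def Q_def
      by (simp add: complex_eq_iff algebra_simps power2_eq_square)
  qed (rule 4)
qed

text \<open>The induction needs the leading coefficient of \<open>U\<close> as well: in the terms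
  with \<open>s^2\<close> the top coefficients \<open>2 * (2 * 4 ^ l)\<close> and
  \<open>4 * 4 ^ l\<close> cancel in \<open>T\<close>, and \<open>2 * 4 ^ l\<close> cancels in
  \<open>U\<close>. Hence the leading coefficients do not depend on the reflection
  coefficients.\<close>

lemma szego_degree:
  assumes "szego l N h k q T U"
  shows "degree q \<le> l \<and> degree T \<le> Suc l \<and> coeff T (Suc l) = 2 * 4 ^ l"
proof -
  have "(\<forall>i>l. coeff q i = 0) \<and> (\<forall>i>Suc l. coeff T i = 0) \<and> (\<forall>i>l. coeff U i = 0) \<and>
      coeff T (Suc l) = 2 * 4 ^ l \<and> coeff U l = 4 ^ l"
    using assms
  proof (induction rule: szego.induct)
    case zero
    then show ?case by (auto simp: coeff_pCons split: nat.splits)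
  next
    case (step l N h k q T U s)
    then show ?case by (auto simp: coeff_pCons algebra_simps split: nat.splits)
  qed
  then show ?thesis by (auto intro: degree_le)
qed

lemma half_one_plus_cos_surj:
  assumes "x \<in> {0..1::real}" obtains t where "x = (1 + cos t) / 2"
proof
  show "x = (1 + cos (arccos (2 * x - 1))) / 2" using assms by (simp add: cos_arccos)
qed

lemma szego_norm:
  assumes "szego l N h k q T U"
  shows "poly q ((1 + cos t) / 2) = (norm (h (cis t)))\<^sup>2" "poly q ((1 + cos t) / 2) = (norm (k (cis t)))\<^sup>2"
proof -
  note c = szego_circle[OF assms, of t]
  have "complex_of_real (poly q ((1 + cos t) / 2)) = of_real ((norm (h (cis t)))\<^sup>2)"
    "complex_of_real (poly q ((1 + cos t) / 2)) = of_real ((norm (k (cis t)))\<^sup>2)"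
    unfolding complex_norm_square
    by (simp_all only: conjunct1[OF c] conjunct1[OF conjunct2[OF c]])
  then show "poly q ((1 + cos t) / 2) = (norm (h (cis t)))\<^sup>2" "poly q ((1 + cos t) / 2) = (norm (k (cis t)))\<^sup>2"
    unfolding of_real_eq_iff .
qed

lemma szego_poly_pos:
  assumes "szego l N h k q T U" "x \<in> {0..1}"
  shows "0 < poly q x"
proof -
  obtain t where t: "x = (1 + cos t) / 2" using half_one_plus_cos_surj[OF assms(2)] .
  have "poly q x = (norm (h (cis t)))\<^sup>2" unfolding t by (rule szego_norm[OF assms(1)])
  moreover have "h (cis t) \<noteq> 0" using szego_disc[OF assms(1)] by simp
  ultimately show ?thesis by simp
qed

lemma szego_abs_T_le:
  assumes "szego l N h k q T U" "x \<in> {0..1}"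
  shows "\<bar>poly T x\<bar> \<le> poly q x"
proof -
  obtain t where t: "x = (1 + cos t) / 2" using half_one_plus_cos_surj[OF assms(2)] .
  note c = szego_circle[OF assms(1), of t, folded t]
  have n: "poly q x = norm (h (cis t)) ^ 2" "poly q x = norm (k (cis t)) ^ 2"
    unfolding t by (rule szego_norm[OF assms(1)])+
  then have "norm (k (cis t)) = norm (h (cis t))" by (metis norm_ge_zero power2_eq_imp_eq)
  then have "norm (cis t * k (cis t) * cnj (h (cis t))) = poly q x"
    by (simp add: norm_mult n(1) power2_eq_square)
  then have "norm (Complex (poly T x) (sin t * poly U x)) = poly q x" using c by metis
  then show ?thesis using abs_Re_le_cmod[of "Complex (poly T x) (sin t * poly U x)"] by simp
qed

lemma szego_density_continuous:
  assumes "szego l N h k q T U"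
  shows "continuous_on {0..1} (\<lambda>x. N / poly q x)"
  using szego_poly_pos[OF assms] by (intro continuous_intros) force

section \<open>Moments and logarithmic mean of the Bernstein-Szego measures\<close>

text \<open>On the circle the difference of the two densities, times x^j, is the real part of a
  function \<open>G\<close> holomorphic near the closed disc, so its mean is Re G(0). As (z + 1)^2 =
  4 z x there, x^j becomes a polynomial in z at the cost of a factor z^j. The remaining factor z^(l
  + 1 - j) makes G(0) vanish unless j = l + 1.\<close>

lemma szego_shift:
  assumes B: "szego l N h k q T U" and s: "\<bar>s\<bar> < 1" and j: "j \<le> Suc l"
    and q': "q' = smult (1 + s\<^sup>2) q - smult (2 * s) T"
  shows "(\<integral>x. x ^ j * (N * (1 - s\<^sup>2) / poly q' x) \<partial>arcsine) =
    (\<integral>x. x ^ j * (N / poly q x) \<partial>arcsine) + (if j = Suc l then 2 * s * N / 4 ^ Suc l else 0)"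
proof -
  note B' = szego.step[OF B s, folded q']
  define g where "g z = h z - of_real s * z * k z" for z
  define S where "S = {z. h z * g z \<noteq> 0}"
  define G where "G z = of_real (2 * s * N / 4 ^ j) * ((z + 1) ^ (2 * j) * z ^ (Suc l - j) / (h z * g z))" for z
  define f where "f x = x ^ j * (N * (1 - s\<^sup>2) / poly q' x) - x ^ j * (N / poly q x)" for x
  have hol: "h holomorphic_on A" "g holomorphic_on A" for A
    using szego_holomorphic[OF B] szego_holomorphic[OF B'] by (auto simp: g_def[abs_def])
  have "open S"
    unfolding S_def using hol[of UNIV]
    by (intro open_Collect_neq holomorphic_on_imp_continuous_on holomorphic_intros)
  moreover have sub: "cball 0 1 \<subseteq> S"
    using szego_disc[OF B] szego_disc[OF B'] by (auto simp: S_def g_def)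
  moreover have "G holomorphic_on S"
    unfolding G_def by (intro holomorphic_intros hol) (auto simp: S_def)
  ultimately have mean: "integral {0..2*pi} (\<lambda>t. Re (G (cis t))) / (2 * pi) = Re (G 0)"
    using circle_mean_Re by blast
  have fG: "f ((1 + cos t) / 2) = Re (G (cis t))" for t
  proof -
    define z x where "z = cis t" and "x = (1 + cos t) / 2"
    have x01: "x \<in> {0..1}" unfolding x_def by (rule half_one_plus_cos)
    note c = szego_circle[OF B, of t, folded z_def x_def] szego_circle[OF B', of t, folded z_def x_def, folded g_def]
    have pos: "0 < poly q x" "0 < poly q' x" using szego_poly_pos[OF B x01] szego_poly_pos[OF B' x01] .
    have zz: "z * cnj z = 1" by (simp_all add: z_def cis_cnj cis_mult)
    have nz: "h z \<noteq> 0" "g z \<noteq> 0" using subsetD[OF sub, of z] by (auto simp: S_def z_def)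
    have zx: "(z + 1)\<^sup>2 = 4 * z * of_real x"
    proof -
      have "cnj z + z = of_real (2 * cos t)" by (simp add: z_def complex_eq_iff)
      then have "4 * z * of_real x = z * (2 + (cnj z + z))" by (simp add: x_def algebra_simps)
      also have "\<dots> = 2 * z + z * cnj z + z\<^sup>2" by (simp add: algebra_simps power2_eq_square)
      finally show ?thesis unfolding zz by (simp add: algebra_simps power2_eq_square)
    qed
    have hq: "h z * cnj (h z) = of_real (poly q x)" and kq: "k z * cnj (k z) = of_real (poly q x)"
      and A: "z * k z * cnj (h z) = Complex (poly T x) (sin t * poly U x)" and kz: "k z = z ^ l * cnj (h z)"
      and gq: "g z * cnj (g z) = of_real (poly q' x)"
      using c by blast+
    \<comment> \<open>Expanding by the conjugates makes the denominator \<open>q q'\<close>; the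
      relation \<open>kz\<close> turns the numerator into z k times the conjugate of g.\<close>
    have "z ^ Suc l / (h z * g z) = z ^ Suc l * cnj (h z) * cnj (g z) / ((h z * cnj (h z)) * (g z * cnj (g z)))"
      using nz by simp
    also have "z ^ Suc l * cnj (h z) * cnj (g z) = z * k z * cnj (g z)" by (simp add: kz)
    also have "\<dots> = z * k z * cnj (h z) - of_real s * ((z * cnj z) * (k z * cnj (k z)))"
      by (simp add: g_def algebra_simps)
    finally have "z ^ Suc l / (h z * g z) =
        (Complex (poly T x) (sin t * poly U x) - of_real (s * poly q x)) / of_real (poly q x * poly q' x)"
      unfolding A kq hq gq zz by simp
    then have "Re (z ^ Suc l / (h z * g z)) = (poly T x - s * poly q x) / (poly q x * poly q' x)"
      by (simp add: Re_divide_of_real del: of_real_mult)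
    moreover have "G z = of_real (2 * s * N * x ^ j) * (z ^ Suc l / (h z * g z))"
    proof -
      have "(z + 1) ^ (2 * j) * z ^ (Suc l - j) = 4 ^ j * of_real (x ^ j) * (z ^ j * z ^ (Suc l - j))"
        unfolding power_mult zx by (simp add: power_mult_distrib)
      also have "z ^ j * z ^ (Suc l - j) = z ^ Suc l" using j by (simp flip: power_add)
      finally show ?thesis unfolding G_def by (simp add: field_simps)
    qed
    ultimately have "Re (G z) = 2 * s * N * x ^ j * ((poly T x - s * poly q x) / (poly q x * poly q' x))"
      by (simp only: times_complex.sel complex_of_real_def complex.sel mult_zero_left diff_0_right)
    \<comment> \<open>By definition of \<open>q'\<close> one has (1 - s^2) q - q' = 2 s (T - s q),
      which is the numerator of the difference of densities.\<close>
    also have "\<dots> = f x"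
      using pos unfolding f_def by (simp add: q' field_simps power2_eq_square)
    finally show ?thesis by (simp add: x_def z_def)
  qed
  have cont: "continuous_on {0..1} (\<lambda>x. x ^ j * (N * (1 - s\<^sup>2) / poly q' x))" "continuous_on {0..1} (\<lambda>x. x ^ j * (N / poly q x))"
    by (intro continuous_on_mult continuous_on_power continuous_on_id szego_density_continuous[OF B] szego_density_continuous[OF B'])+
  have "(\<integral>x. f x \<partial>arcsine) = integral {0..2*pi} (\<lambda>t. f ((1 + cos t) / 2)) / (2 * pi)"
    unfolding f_def by (intro arcsine_integral continuous_on_diff cont)
  also have "\<dots> = Re (G 0)" unfolding fG by (rule mean)
  also have "\<dots> = (if j = Suc l then 2 * s * N / 4 ^ Suc l else 0)"
    using j szego_at_0[OF B] by (simp add: G_def g_def power_0_left)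
  finally show ?thesis
    unfolding f_def
    by (subst (asm) Bochner_Integration.integral_diff[OF unit_probs_integrable[OF arcsine_unit_probs cont(1)]
      unit_probs_integrable[OF arcsine_unit_probs cont(2)]]) linarith
qed

lemma szego_mass: "szego l N h k q T U \<Longrightarrow> (\<integral>x. N / poly q x \<partial>arcsine) = 1"
proof (induction rule: szego.induct)
  case zero
  then show ?case using unit_probs_one[OF arcsine_unit_probs] by simp
next
  case (step l N h k q T U s)
  then show ?case using szego_shift[OF step(1,2) _ refl, of 0] by simp
qed

lemma szego_measure_integral:
  fixes f :: "real \<Rightarrow> real"
  assumes B: "szego l N h k q T U" and f: "continuous_on {0..1} f"
  shows "(\<integral>x. f x \<partial>szego_measure N q) = (\<integral>x. f x * (N / poly q x) \<partial>arcsine)"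
proof -
  have m: "f \<in> borel_measurable arcsine" "(\<lambda>x. N / poly q x) \<in> borel_measurable arcsine"
    using f szego_density_continuous[OF B] arcsine_unit_probs
    by (auto intro: borel_measurable_continuous_on_restrict simp: unit_probs_measurable)
  have "0 \<le> N / poly q x" if "x \<in> {0..1}" for x
    using szego_pos[OF B] szego_poly_pos[OF B that] by simp
  then show ?thesis
    unfolding szego_measure_def using m by (subst integral_density) (auto simp: mult.commute)
qed

lemma szego_measure_unit_probs:
  assumes B: "szego l N h k q T U"
  shows "szego_measure N q \<in> unit_probs"
proof -
  have m: "(\<lambda>x. N / poly q x) \<in> borel_measurable arcsine"
    using szego_density_continuous[OF B] arcsine_unit_probs
    by (auto intro: borel_measurable_continuous_on_restrict simp: unit_probs_measurable)
  have nn: "0 \<le> N / poly q x" if "x \<in> {0..1}" for x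
    using szego_pos[OF B] szego_poly_pos[OF B that] by simp
  have "emeasure (szego_measure N q) (space (szego_measure N q)) =
      (\<integral>\<^sup>+x. ennreal (N / poly q x) * indicator (space arcsine) x \<partial>arcsine)"
    unfolding szego_measure_def space_density using m sets.top[of arcsine] by (intro emeasure_density) auto
  also have "\<dots> = (\<integral>\<^sup>+x. ennreal (N / poly q x) \<partial>arcsine)"
    by (intro nn_integral_cong) auto
  also have "\<dots> = ennreal (\<integral>x. N / poly q x \<partial>arcsine)"
    using nn szego_density_continuous[OF B] arcsine_unit_probs by (intro nn_integral_eq_integral) auto
  finally have "prob_space (szego_measure N q)" unfolding szego_mass[OF B] by (intro prob_spaceI) simp
  then show ?thesis by (simp add: unit_probs_iff szego_measure_def sets_arcsine)
qed

lemma szego_step_moment: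
  assumes B: "szego l N h k q T U" and s: "\<bar>s\<bar> < 1" and j: "j \<le> Suc l"
    and q': "q' = smult (1 + s\<^sup>2) q - smult (2 * s) T"
  shows "moment (szego_measure (N * (1 - s\<^sup>2)) q') j =
    moment (szego_measure N q) j + (if j = Suc l then 2 * s * N / 4 ^ Suc l else 0)"
  unfolding moment_def
  using szego_shift[OF assms] szego_measure_integral[OF B, of "\<lambda>x. x ^ j"]
    szego_measure_integral[OF szego.step[OF B s, folded q'], of "\<lambda>x. x ^ j"]
  by (simp add: continuous_on_power)

lemma szego_mean_self:
  assumes B: "szego l N h k q T U"
  shows "poly_mean (szego_measure N q) q = N"
proof -
  have "poly_mean (szego_measure N q) q = (\<integral>x. poly q x * (N / poly q x) \<partial>arcsine)"
    by (intro szego_measure_integral[OF B] continuous_intros)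
  also have "\<dots> = (\<integral>x. N \<partial>arcsine)"
    using szego_poly_pos[OF B] by (intro Bochner_Integration.integral_cong) (auto simp: less_le)
  also have "\<dots> = N" using arcsine_unit_probs unit_probs_one[OF arcsine_unit_probs] by simp
  finally show ?thesis .
qed

text \<open>By compactness \<open>h\<close> has no zero on a ball slightly larger than the unit
  disc. This ball is contractible, so \<open>h = exp g\<close> there; 2 Re g equals ln q on the
  circle and vanishes at 0 because h(0) = 1.\<close>

lemma szego_mean_log:
  assumes B: "szego l N h k q T U"
  shows "(\<integral>x. ln (poly q x) \<partial>arcsine) = 0"
proof -
  have "open {z. h z \<noteq> 0}"
    using szego_holomorphic[OF B, of UNIV] by (intro open_Collect_neq holomorphic_on_imp_continuous_on) auto
  moreover have "cball 0 1 \<subseteq> {z. h z \<noteq> 0}" using szego_disc[OF B] by auto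
  ultimately obtain e where e: "0 < e" "(\<Union>z\<in>cball 0 1. cball z e) \<subseteq> {z. h z \<noteq> 0}"
    using compact_subset_open_imp_cball_epsilon_subset[OF compact_cball] by blast
  have "ball 0 (1 + e) \<subseteq> {z. h z \<noteq> 0}"
  proof
    fix z :: complex assume z: "z \<in> ball 0 (1 + e)"
    show "z \<in> {z. h z \<noteq> 0}"
    proof (cases "norm z \<le> 1")
      case True
      then show ?thesis using szego_disc[OF B] by auto
    next
      case False
      then have "z \<noteq> 0" by auto
      then have "z = of_real (norm z) * sgn z" by (simp add: sgn_div_norm scaleR_conv_of_real)
      \<comment> \<open>A point outside the unit disc is compared with its radial projection
        \<open>sgn z\<close>, at distance |z| - 1 < e.\<close>
      have "dist (sgn z) z = norm ((1 - of_real (norm z)) * sgn z)"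
        unfolding dist_norm by (subst (2) \<open>z = of_real (norm z) * sgn z\<close>) (simp add: left_diff_distrib)
      also have "\<dots> = norm z - 1"
        using \<open>z \<noteq> 0\<close> False norm_of_real[of "1 - norm z", where 'a = complex] by (simp add: norm_mult norm_sgn)
      finally have "z \<in> cball (sgn z) e" using z by simp
      moreover have "sgn z \<in> cball 0 1" by (simp add: norm_sgn)
      ultimately show ?thesis using e(2) by blast
    qed
  qed
  then have nz: "h z \<noteq> 0" if "z \<in> ball 0 (1 + e)" for z using that by blast
  obtain g where g: "g holomorphic_on ball 0 (1 + e)" "\<And>z. z \<in> ball 0 (1 + e) \<Longrightarrow> h z = exp (g z)"
    using contractible_imp_holomorphic_log[OF conjunct1[OF szego_holomorphic[OF B]] convex_imp_contractible[OF convex_ball] nz]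
    by blast
  have sub: "cball 0 1 \<subseteq> ball 0 (1 + e)" using e(1) by auto
  have lnh: "ln (poly q ((1 + cos t) / 2)) = Re (2 * g (cis t))" for t
  proof -
    have "poly q ((1 + cos t) / 2) = (norm (exp (g (cis t))))\<^sup>2"
      using g(2)[of "cis t"] e(1) szego_norm(1)[OF B, of t] by simp
    then show ?thesis by (simp add: ln_realpow)
  qed
  have "continuous_on {0..1} (\<lambda>x. ln (poly q x))"
    using szego_poly_pos[OF B] by (intro continuous_intros) force
  then have "(\<integral>x. ln (poly q x) \<partial>arcsine) = integral {0..2*pi} (\<lambda>t. Re (2 * g (cis t))) / (2 * pi)"
    unfolding lnh[symmetric] by (rule arcsine_integral)
  also have "\<dots> = Re (2 * g 0)"
    by (rule circle_mean_Re[OF _ open_ball sub]) (intro holomorphic_intros g(1))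
  also have "\<dots> = 0"
  proof -
    have "norm (exp (g 0)) = 1" using g(2)[of 0] szego_at_0[OF B] e by simp
    then show ?thesis by simp
  qed
  finally show ?thesis .
qed

section \<open>Width of the fibres\<close>

lemma integral_poly_Suc:
  assumes \<nu>: "\<nu> \<in> unit_probs" "\<mu> \<in> unit_probs" "moment_vector l \<nu> = moment_vector l \<mu>"
    and T: "degree T \<le> Suc l"
  shows "poly_mean \<nu> T - poly_mean \<mu> T = coeff T (Suc l) * (moment \<nu> (Suc l) - moment \<mu> (Suc l))"
proof -
  have eq: "moment \<nu> i = moment \<mu> i" if "i \<le> l" for i
    using \<nu> that by (cases "i = 0") (auto simp: moment_vector_eq_iff moment_0)
  have "poly_mean \<rho> T = (\<Sum>i\<le>Suc l. coeff T i * moment \<rho> i)" if "\<rho> \<in> unit_probs" for \<rho>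
    unfolding integral_poly_moments[OF that] using T
    by (intro sum.mono_neutral_left) (auto simp: coeff_eq_0)
  then show ?thesis using \<nu> by (simp add: eq algebra_simps)
qed

lemma szego_abs_mean_T_le:
  assumes B: "szego l N h k q T U" and \<nu>: "\<nu> \<in> unit_probs"
  shows "\<bar>poly_mean \<nu> T\<bar> \<le> poly_mean \<nu> q"
proof -
  have T: "- poly q x \<le> poly T x" "poly T x \<le> poly q x" if "x \<in> {0..1}" for x
    using szego_abs_T_le[OF B that] by linarith+
  have "(\<integral>x. - poly q x \<partial>\<nu>) \<le> poly_mean \<nu> T" "poly_mean \<nu> T \<le> poly_mean \<nu> q"
    using T by (intro unit_probs_le \<nu> continuous_intros; auto)+
  then show ?thesis by simp
qed

text \<open>The polynomials need not belong to the common moments of the two measures. This freedom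
  lets a single \<open>q\<close> bound the widths over many vectors, including boundary
  ones.\<close>

lemma szego_upper:
  assumes B: "szego l N h k q T U" and \<nu>: "\<nu>1 \<in> unit_probs" "\<nu>2 \<in> unit_probs"
    "moment_vector l \<nu>1 = moment_vector l \<nu>2"
  shows "moment \<nu>2 (Suc l) - moment \<nu>1 (Suc l) \<le> poly_mean \<nu>1 q / 4 ^ l"
proof -
  note d = szego_degree[OF B]
  have "poly_mean \<nu>2 q = poly_mean \<nu>1 q"
    using d \<nu> by (intro integral_poly_cong[of _ _ l]) auto
  then have "poly_mean \<nu>2 T - poly_mean \<nu>1 T \<le> 2 * poly_mean \<nu>1 q"
    using szego_abs_mean_T_le[OF B \<nu>(1)] szego_abs_mean_T_le[OF B \<nu>(2)] by linarith
  then have "2 * 4 ^ l * (moment \<nu>2 (Suc l) - moment \<nu>1 (Suc l)) \<le> 2 * poly_mean \<nu>1 q"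
    using integral_poly_Suc[OF \<nu>(2,1) \<nu>(3)[symmetric], of T] d by simp
  then show ?thesis by (simp add: field_simps)
qed

lemma width_le_szego:
  assumes B: "szego l N h k q T U" and \<nu>: "\<nu> \<in> unit_probs"
  shows "width l (moment_vector l \<nu>) \<le> poly_mean \<nu> q / 4 ^ l"
proof -
  have m: "moment_vector l \<nu> \<in> moments l" using \<nu> by (auto simp: moment_space_def)
  obtain t1 t2 where t: "t1 \<le> t2" "next_moments l (moment_vector l \<nu>) = {t1..t2}" "width l (moment_vector l \<nu>) = t2 - t1"
    using next_moments_interval[OF m] .
  then have "t1 \<in> next_moments l (moment_vector l \<nu>)" "t2 \<in> next_moments l (moment_vector l \<nu>)" by auto
  then obtain \<nu>1 \<nu>2 where \<nu>': "\<nu>1 \<in> unit_probs" "\<nu>2 \<in> unit_probs" "moment_vector l \<nu>1 = moment_vector l \<nu>"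
    "moment_vector l \<nu>2 = moment_vector l \<nu>" "moment \<nu>1 (Suc l) = t1" "moment \<nu>2 (Suc l) = t2"
    unfolding next_moments_iff[OF unit_moments_extensional[OF m]] by blast
  have "t2 - t1 \<le> poly_mean \<nu>1 q / 4 ^ l"
    using szego_upper[OF B \<nu>'(1,2)] \<nu>'(3-6) by simp
  also have "poly_mean \<nu>1 q = poly_mean \<nu> q"
    using szego_degree[OF B] \<nu> \<nu>' by (intro integral_poly_cong[of _ _ l]) auto
  finally show ?thesis using t by simp
qed

lemma szego_step_vector:
  assumes B: "szego l N h k q T U" and s: "\<bar>s\<bar> < 1"
    and q': "q' = smult (1 + s\<^sup>2) q - smult (2 * s) T"
  shows "moment_vector (Suc l) (szego_measure (N * (1 - s\<^sup>2)) q') =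
    (moment_vector l (szego_measure N q))(Suc l := moment (szego_measure N q) (Suc l) + s * (N / 4 ^ l / 2))"
proof -
  have "2 * s * N / 4 ^ Suc l = s * (N / 4 ^ l / 2)" by (simp add: mult_ac)
  then show ?thesis
    using szego_step_moment[OF B s _ q'] unfolding moment_vector_Suc
    by (auto simp: moment_vector_def fun_eq_iff restrict_def)
qed

text \<open>The duality bound with the measure's own \<open>q\<close> gives width at most
  \<open>c\<close>. Conversely the steps with |s| < 1 realise every point of an open interval of
  length \<open>c\<close> centred at \<open>a\<close>, and the fibre is closed.\<close>

lemma szego_next_moments:
  assumes B: "szego l N h k q T U"
  defines "x \<equiv> moment_vector l (szego_measure N q)" and "a \<equiv> moment (szego_measure N q) (Suc l)" and "c \<equiv> N / 4 ^ l"
  shows "x \<in> moments l" "next_moments l x = {a - c / 2..a + c / 2}" "width l x = c"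
proof -
  have \<mu>: "szego_measure N q \<in> unit_probs" by (rule szego_measure_unit_probs[OF B])
  then show x: "x \<in> moments l" by (auto simp: moment_space_def x_def)
  have c: "0 < c" using szego_pos[OF B] by (simp add: c_def)
  obtain t1 t2 where t: "t1 \<le> t2" "next_moments l x = {t1..t2}" "width l x = t2 - t1"
    using next_moments_interval[OF x] .
  have "width l x \<le> c"
    using width_le_szego[OF B \<mu>] szego_mean_self[OF B] by (simp add: x_def c_def)
  moreover have "{a - c / 2<..<a + c / 2} \<subseteq> {t1..t2}"
  proof
    fix t assume "t \<in> {a - c / 2<..<a + c / 2}"
    define s where "s = (t - a) / (c / 2)"
    have s: "\<bar>s\<bar> < 1" using \<open>t \<in> _\<close> c by (auto simp: s_def abs_if field_simps)
    define q' where "q' = smult (1 + s\<^sup>2) q - smult (2 * s) T"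
    have "t = a + s * (c / 2)" using c by (simp add: s_def field_simps)
    then have "x(Suc l := t) = moment_vector (Suc l) (szego_measure (N * (1 - s\<^sup>2)) q')"
      using szego_step_vector[OF B s q'_def] by (simp add: x_def a_def c_def)
    then have "t \<in> next_moments l x"
      using szego_measure_unit_probs[OF szego.step[OF B s, folded q'_def]]
      by (auto simp: next_moments_def moment_space_def)
    then show "t \<in> {t1..t2}" using t by simp
  qed
  ultimately have "t1 = a - c / 2" "t2 = a + c / 2"
    using c t unfolding greaterThanLessThan_subseteq_atLeastAtMost_iff by linarith+
  then show "next_moments l x = {a - c / 2..a + c / 2}" "width l x = c" using t by auto
qed

text \<open>The affine function \<open>t \<mapsto> \<integral> T\<close> is bounded by \<open>N\<close> on the interval of admissible \<open>t\<close> and grows by \<open>2N\<close>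
  across it, so it is determined.\<close>

lemma szego_integral_T:
  assumes B: "szego l N h k q T U" and \<nu>: "\<nu> \<in> unit_probs" "moment_vector l \<nu> = moment_vector l (szego_measure N q)"
  defines "\<sigma> \<equiv> (moment \<nu> (Suc l) - moment (szego_measure N q) (Suc l)) / (N / 4 ^ l / 2)"
  shows "poly_mean \<nu> T = N * \<sigma>" "\<bar>\<sigma>\<bar> \<le> 1"
proof -
  define \<mu> a c where "\<mu> = szego_measure N q" and "a = moment \<mu> (Suc l)" and "c = N / 4 ^ l"
  note nx = szego_next_moments[OF B, folded \<mu>_def, folded a_def c_def]
  have \<mu>: "\<mu> \<in> unit_probs" using szego_measure_unit_probs[OF B] by (simp add: \<mu>_def)
  have N: "0 < N" "0 < c" using szego_pos[OF B] by (auto simp: c_def)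
  have q: "poly_mean \<rho> q = N" if "\<rho> \<in> unit_probs" "moment_vector l \<rho> = moment_vector l \<mu>" for \<rho>
    using integral_poly_cong[OF that(1) \<mu> that(2), of q] szego_degree[OF B] szego_mean_self[OF B] by (simp add: \<mu>_def)
  have T: "poly_mean \<rho> T = poly_mean \<mu> T + N * ((moment \<rho> (Suc l) - a) / (c / 2))" and Tb: "\<bar>\<integral>x. poly T x \<partial>\<rho>\<bar> \<le> N"
    if \<rho>: "\<rho> \<in> unit_probs" "moment_vector l \<rho> = moment_vector l \<mu>" for \<rho>
  proof -
    show "poly_mean \<rho> T = poly_mean \<mu> T + N * ((moment \<rho> (Suc l) - a) / (c / 2))"
    proof -
      have "N * (y / (c / 2)) = 2 * 4 ^ l * y" for y using N by (simp add: c_def field_simps)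
      then show ?thesis
        using integral_poly_Suc[OF \<rho>(1) \<mu> \<rho>(2), of T] szego_degree[OF B] unfolding a_def by (metis (no_types) add.commute diff_add_cancel)
    qed
    show "\<bar>poly_mean \<rho> T\<bar> \<le> N" using szego_abs_mean_T_le[OF B \<rho>(1)] q[OF \<rho>] by simp
  qed
  have "a - c / 2 \<in> next_moments l (moment_vector l \<mu>)" "a + c / 2 \<in> next_moments l (moment_vector l \<mu>)"
    using nx N by auto
  then obtain \<rho>1 \<rho>2 where \<rho>: "\<rho>1 \<in> unit_probs" "moment_vector l \<rho>1 = moment_vector l \<mu>" "moment \<rho>1 (Suc l) = a - c / 2"
    "\<rho>2 \<in> unit_probs" "moment_vector l \<rho>2 = moment_vector l \<mu>" "moment \<rho>2 (Suc l) = a + c / 2"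
    unfolding next_moments_iff[OF unit_moments_extensional[OF nx(1)]] by blast
  have "poly_mean \<mu> T = 0"
    using T[OF \<rho>(1,2)] T[OF \<rho>(4,5)] Tb[OF \<rho>(1,2)] Tb[OF \<rho>(4,5)] N \<rho>(3,6) by (simp add: abs_le_iff)
  then show T\<sigma>: "poly_mean \<nu> T = N * \<sigma>" using T[OF \<nu>(1) \<nu>(2)[folded \<mu>_def]] by (simp add: \<sigma>_def a_def c_def \<mu>_def)
  have "\<bar>N * \<sigma>\<bar> \<le> N" using Tb[OF \<nu>(1) \<nu>(2)[folded \<mu>_def]] T\<sigma> by simp
  then show "\<bar>\<sigma>\<bar> \<le> 1" using N by (simp add: abs_mult)
qed

text \<open>Here \<sigma> is the next moment rescaled so that the fibre becomes [-1, 1]. The value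
  is least at s = \<sigma>, where it is the new normalisation N (1 - \<sigma>^2); for |\<sigma>| = 1
  it tends to 0 as s approaches \<sigma>.\<close>

lemma szego_integral_step:
  assumes B: "szego l N h k q T U" and \<nu>: "\<nu> \<in> unit_probs" "moment_vector l \<nu> = moment_vector l (szego_measure N q)"
    and q': "q' = smult (1 + s\<^sup>2) q - smult (2 * s) T"
  defines "\<sigma> \<equiv> (moment \<nu> (Suc l) - moment (szego_measure N q) (Suc l)) / (N / 4 ^ l / 2)"
  shows "poly_mean \<nu> q' = N * (1 + s\<^sup>2 - 2 * s * \<sigma>)"
proof -
  have "poly_mean \<nu> q = N"
    using integral_poly_cong[OF \<nu>(1) szego_measure_unit_probs[OF B] \<nu>(2), of q] szego_degree[OF B] szego_mean_self[OF B] by simp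
  then show ?thesis
    using szego_integral_T[OF B \<nu>, folded \<sigma>_def] unit_probs_poly_integrable[OF \<nu>(1)]
    by (simp add: q' algebra_simps)
qed

text \<open>If the moment of order \<open>l + 1\<close> is an end point of the admissible interval, then the polynomials \<open>q\<close> of the steps
  \<open>s \<rightarrow> \<plusminus>1\<close> have arbitrarily small integral.\<close>

lemma szego_extend:
  assumes B: "szego l N h k q T U" and \<nu>: "\<nu> \<in> unit_probs" "moment_vector l \<nu> = moment_vector l (szego_measure N q)"
  shows "(\<exists>N' h' k' q' T' U'. szego (Suc l) N' h' k' q' T' U' \<and> moment_vector (Suc l) \<nu> = moment_vector (Suc l) (szego_measure N' q'))
    \<or> (\<forall>\<epsilon>>0. \<exists>N' h' k' q' T' U'. szego (Suc l) N' h' k' q' T' U' \<and> poly_mean \<nu> q' \<le> \<epsilon>)"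
proof -
  define \<sigma> where "\<sigma> = (moment \<nu> (Suc l) - moment (szego_measure N q) (Suc l)) / (N / 4 ^ l / 2)"
  note \<sigma> = szego_integral_T(2)[OF B \<nu>, folded \<sigma>_def] and N = szego_pos[OF B]
  show ?thesis
  proof (cases "\<bar>\<sigma>\<bar> < 1")
    case True
    have "moment \<nu> (Suc l) = moment (szego_measure N q) (Suc l) + \<sigma> * (N / 4 ^ l / 2)"
      using N by (simp add: \<sigma>_def)
    then have "moment_vector (Suc l) \<nu> = moment_vector (Suc l) (szego_measure (N * (1 - \<sigma>\<^sup>2)) (smult (1 + \<sigma>\<^sup>2) q - smult (2 * \<sigma>) T))"
      unfolding szego_step_vector[OF B True refl] by (simp add: moment_vector_Suc \<nu>)
    then show ?thesis using szego.step[OF B True] by blast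
  next
    case False
    then have \<sigma>1: "\<bar>\<sigma>\<bar> = 1" using \<sigma> by simp
    have "\<exists>N' h' k' q' T' U'. szego (Suc l) N' h' k' q' T' U' \<and> poly_mean \<nu> q' \<le> \<epsilon>" if \<epsilon>: "0 < \<epsilon>" for \<epsilon>
    proof -
      \<comment> \<open>With s = \<sigma> (1 - r) and \<sigma>^2 = 1 the integral is N r^2, which is
        at most N r and hence at most \<epsilon>.\<close>
      define r where "r = min (1/2) (\<epsilon> / N)"
      have r: "0 < r" "r \<le> 1/2" "r \<le> \<epsilon> / N"
        using \<epsilon> N min.cobounded1[of "1/2" "\<epsilon> / N"] by (auto simp: r_def)
      define s where "s = \<sigma> * (1 - r)"
      have "\<bar>s\<bar> = 1 - r" using r by (simp add: s_def abs_mult \<sigma>1)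
      then have s: "\<bar>s\<bar> < 1" using r by simp
      have "\<sigma>\<^sup>2 = 1" using \<sigma>1 by (metis power2_abs one_power2)
      moreover have "1 + s\<^sup>2 - 2 * s * \<sigma> = 1 + \<sigma>\<^sup>2 * (1 - r)\<^sup>2 - 2 * \<sigma>\<^sup>2 * (1 - r)"
        by (simp add: s_def power2_eq_square mult_ac)
      ultimately have "1 + s\<^sup>2 - 2 * s * \<sigma> = r\<^sup>2" by (simp add: power2_eq_square algebra_simps)
      then have "(\<integral>x. poly (smult (1 + s\<^sup>2) q - smult (2 * s) T) x \<partial>\<nu>) = N * r\<^sup>2"
        using szego_integral_step[OF B \<nu> refl, folded \<sigma>_def, of s] by simp
      also have "\<dots> \<le> N * r" using r N by (intro mult_left_mono) (auto simp: power2_eq_square mult_le_one mult_left_le)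
      also have "\<dots> \<le> \<epsilon>" using r N by (simp add: field_simps)
      finally show ?thesis using szego.step[OF B s] by blast
    qed
    then show ?thesis by blast
  qed
qed

section \<open>Realisation of positive width and the recursion for the widths\<close>

text \<open>Positivity of the width descends to lower levels, so the induction hypothesis applies.
  The next moment is then not an end point, for otherwise the duality bound with a small integral of
  \<open>q\<close> would contradict the positive width at level \<open>Suc l\<close>.\<close>

lemma szego_exists:
  assumes x: "x \<in> moments l" and w: "0 < width l x"
  shows "\<exists>N h k q T U. szego l N h k q T U \<and> x = moment_vector l (szego_measure N q)"
  using assms
proof (induction l arbitrary: x)
  case 0
  then have "x = moment_vector 0 (szego_measure 1 1)"
    by (auto simp: moment_space_def moment_vector_def)
  then show ?case using szego.zero by blast
next
  case (Suc l)
  obtain \<nu> where \<nu>: "\<nu> \<in> unit_probs" "x = moment_vector (Suc l) \<nu>"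
    using Suc.prems(1) by (auto simp: moment_space_def)
  have r: "restrict x {1..l} = moment_vector l \<nu>"
    unfolding \<nu>(2) by (rule moment_vector_restrict) simp
  have "restrict x {1..l} \<in> moments l" using unit_moments_restrict[OF Suc.prems(1)] by simp
  then obtain N h k q T U where B: "szego l N h k q T U" "moment_vector l \<nu> = moment_vector l (szego_measure N q)"
    using Suc.IH[OF _ width_restrict_pos[OF Suc.prems]] r by metis
  from szego_extend[OF B(1) \<nu>(1) B(2)] show ?case
  proof
    assume "\<forall>\<epsilon>>0. \<exists>N' h' k' q' T' U'. szego (Suc l) N' h' k' q' T' U' \<and> poly_mean \<nu> q' \<le> \<epsilon>"
    then obtain N' h' k' q' T' U' where B': "szego (Suc l) N' h' k' q' T' U'"
      "poly_mean \<nu> q' \<le> width (Suc l) x * 4 ^ Suc l / 2"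
      using Suc.prems(2) by (metis divide_pos_pos mult_pos_pos zero_less_numeral zero_less_power)
    then have "width (Suc l) x \<le> (width (Suc l) x * 4 ^ Suc l / 2) / 4 ^ Suc l"
      using width_le_szego[OF B'(1) \<nu>(1)] \<nu>(2) by (smt (verit) divide_right_mono zero_le_power)
    then show ?case using Suc.prems(2) by simp
  qed (use \<nu> in blast)
qed

text \<open>In terms of the canonical moment p = (t - t1) / (t2 - t1) the width is multiplied by p
  (1 - p). With p = (1 + s) / 2 this is the factor (1 - s^2) / 4 by which \<open>N / 4 ^ n\<close>
  changes in one step.\<close>

lemma width_next:
  assumes x: "x \<in> moments n" and t: "t1 < t" "t < t2" and nx: "next_moments n x = {t1..t2}"
  shows "width (Suc n) (x(Suc n := t)) = (t - t1) * (t2 - t) / width n x"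
proof -
  obtain u1 u2 where u: "u1 \<le> u2" "next_moments n x = {u1..u2}" "width n x = u2 - u1"
    using next_moments_interval[OF x] .
  then have "width n x = t2 - t1" using nx t by simp
  then obtain N h k q T U where B: "szego n N h k q T U" and xB: "x = moment_vector n (szego_measure N q)"
    using szego_exists[OF x] t by auto
  define a c where "a = moment (szego_measure N q) (Suc n)" and "c = N / 4 ^ n"
  note nB = szego_next_moments[OF B, folded a_def c_def xB]
  have t12: "t1 = a - c / 2" "t2 = a + c / 2" using nB(2) nx t by auto
  have c: "0 < c" using szego_pos[OF B] by (simp add: c_def)
  define s where "s = (t - a) / (c / 2)"
  have ts: "t = a + s * (c / 2)" using c by (simp add: s_def field_simps)
  have s: "\<bar>s\<bar> < 1" using t c unfolding t12 by (auto simp: s_def abs_if field_simps)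
  have "x(Suc n := t) = moment_vector (Suc n) (szego_measure (N * (1 - s\<^sup>2)) (smult (1 + s\<^sup>2) q - smult (2 * s) T))"
    unfolding szego_step_vector[OF B s refl] by (simp add: xB ts a_def c_def)
  then have "width (Suc n) (x(Suc n := t)) = N * (1 - s\<^sup>2) / 4 ^ Suc n"
    using szego_next_moments(3)[OF szego.step[OF B s]] by simp
  also have "\<dots> = (t - t1) * (t2 - t) / width n x"
    unfolding nB(3) t12 ts using c by (simp add: c_def[symmetric] field_simps power2_eq_square) (simp add: c_def)
  finally show ?thesis .
qed

section \<open>Relative entropy\<close>

lemma absolutely_continuous_density_real:
  assumes \<nu>: "\<nu> \<in> unit_probs" and ac: "absolutely_continuous \<nu> arcsine"
  defines "G \<equiv> \<lambda>x. enn2real (RN_deriv \<nu> arcsine x)"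
  shows "G \<in> borel_measurable \<nu>" "arcsine = density \<nu> (\<lambda>x. ennreal (G x))" "AE x in arcsine. 0 < G x"
proof -
  interpret \<nu>: prob_space \<nu> using \<nu> by (simp add: unit_probs_iff)
  interpret arc: prob_space arcsine using arcsine_unit_probs by (simp add: unit_probs_iff)
  have s: "sets arcsine = sets \<nu>" using \<nu> by (simp add: unit_probs_iff sets_arcsine)
  show G: "G \<in> borel_measurable \<nu>" unfolding G_def by measurable
  have fin: "AE x in \<nu>. RN_deriv \<nu> arcsine x \<noteq> \<infinity>"
    by (rule \<nu>.RN_deriv_finite[OF arc.sigma_finite_measure_axioms ac s])
  have "arcsine = density \<nu> (RN_deriv \<nu> arcsine)"
    by (rule \<nu>.density_RN_deriv[OF ac s, symmetric])
  also have "\<dots> = density \<nu> (\<lambda>x. ennreal (G x))"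
  proof (rule density_cong)
    show "AE x in \<nu>. RN_deriv \<nu> arcsine x = ennreal (G x)"
      using fin by eventually_elim (simp add: G_def less_top)
  qed (use G in auto)
  finally show eq: "arcsine = density \<nu> (\<lambda>x. ennreal (G x))" .
  have "AE x in density \<nu> (\<lambda>x. ennreal (G x)). 0 < G x"
    using G by (subst AE_density) auto
  then show "AE x in arcsine. 0 < G x" unfolding eq[symmetric] .
qed

lemma unit_probs_borel_measurable:
  fixes f :: "real \<Rightarrow> real"
  shows "\<nu> \<in> unit_probs \<Longrightarrow> continuous_on {0..1} f \<Longrightarrow> f \<in> borel_measurable \<nu>"
  by (auto intro: borel_measurable_continuous_on_restrict simp: unit_probs_measurable)

text \<open>With \<open>G = d\<mu>\<^sup>0/d\<nu>\<close>, integrate \<open>ln G \<ge> ln Q + 1 - Q / G\<close> and use \<open>\<integral> Q / G d\<mu>\<^sup>0 \<le> \<integral> Q d\<nu>\<close>.\<close>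

lemma rel_entropy_lower_bound:
  fixes Q :: "real \<Rightarrow> real"
  assumes \<nu>: "\<nu> \<in> unit_probs" and Q: "continuous_on {0..1} Q" "\<And>x. x \<in> {0..1} \<Longrightarrow> 0 < Q x"
    and D: "rel_entropy arcsine \<nu> = ereal D"
  shows "(\<integral>x. ln (Q x) \<partial>arcsine) + 1 - (\<integral>x. Q x \<partial>\<nu>) \<le> D"
    and "D \<le> (\<integral>x. ln (Q x) \<partial>arcsine) + 1 - (\<integral>x. Q x \<partial>\<nu>) \<Longrightarrow> \<nu> = density arcsine (\<lambda>x. ennreal (1 / Q x))"
proof -
  define G where "G x = enn2real (RN_deriv \<nu> arcsine x)" for x
  have ac: "absolutely_continuous \<nu> arcsine" and int: "integrable arcsine (entropy_density (exp 1) \<nu> arcsine)"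
    and DK: "D = KL_divergence (exp 1) \<nu> arcsine"
    using D unfolding rel_entropy_def by (auto split: if_splits)
  note G = absolutely_continuous_density_real[OF \<nu> ac, folded G_def]
  have G_nonneg: "0 \<le> G x" for x by (simp add: G_def)
  have ed: "entropy_density (exp 1) \<nu> arcsine = (\<lambda>x. ln (G x))"
    by (auto simp: entropy_density_def G_def log_def fun_eq_iff)
  have lnG: "integrable arcsine (\<lambda>x. ln (G x))" "D = (\<integral>x. ln (G x) \<partial>arcsine)"
    using int DK unfolding KL_divergence_def ed by auto
  have Qnz: "Q x \<noteq> 0" if "x \<in> {0..1}" for x using Q(2)[OF that] by simp
  have lnQ: "integrable arcsine (\<lambda>x. ln (Q x))"
    using Q Qnz by (intro unit_probs_integrable arcsine_unit_probs continuous_on_ln) auto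
  note Qi = unit_probs_integrable[OF \<nu> Q(1)]
  note meas = unit_probs_borel_measurable[OF \<nu> Q(1)] G(1)
  \<comment> \<open>The measure \<nu> may have mass where \<open>G = 0\<close>, that is, a part
    singular to the arcsine law. There \<open>Q / G\<close> is read as 0, so the change of measure
    recovers only the integral of \<open>R\<close>.\<close>
  define R where "R x = Q x * indicator {x. G x \<noteq> 0} x" for x
  have Rm: "R \<in> borel_measurable \<nu>" unfolding R_def using meas by measurable
  have Q_nonneg: "x \<in> space \<nu> \<Longrightarrow> 0 \<le> Q x" for x using Q(2)[of x] by (simp add: space_unit_probs[OF \<nu>])
  have Ri: "integrable \<nu> R"
    by (rule Bochner_Integration.integrable_bound[OF Qi Rm]) (auto simp: R_def indicator_def)
  have GR: "G x * (Q x / G x) = R x" for x by (simp add: R_def indicator_def)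
  have Qm: "(\<lambda>x. Q x / G x) \<in> borel_measurable \<nu>" using meas by measurable
  have QG: "integrable arcsine (\<lambda>x. Q x / G x)" "(\<integral>x. Q x / G x \<partial>arcsine) = (\<integral>x. R x \<partial>\<nu>)"
  proof -
    have "integrable (density \<nu> (\<lambda>x. ennreal (G x))) (\<lambda>x. Q x / G x) \<longleftrightarrow> integrable \<nu> (\<lambda>x. G x *\<^sub>R (Q x / G x))"
      by (rule integrable_density) (use Qm G(1) G_nonneg in auto)
    moreover have "(\<integral>x. Q x / G x \<partial>density \<nu> (\<lambda>x. ennreal (G x))) = (\<integral>x. G x *\<^sub>R (Q x / G x) \<partial>\<nu>)"
      by (rule integral_density) (use Qm G(1) G_nonneg in auto)
    ultimately show "integrable arcsine (\<lambda>x. Q x / G x)" "(\<integral>x. Q x / G x \<partial>arcsine) = (\<integral>x. R x \<partial>\<nu>)"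
      using Ri unfolding G(2)[symmetric] real_scaleR_def GR by auto
  qed
  define \<psi> where "\<psi> x = ln (G x) - ln (Q x) - 1 + Q x / G x" for x
  have \<psi>i: "integrable arcsine \<psi>" unfolding \<psi>_def using lnG(1) lnQ QG(1) unit_probs_integrable[OF arcsine_unit_probs continuous_on_const] by auto
  have \<psi>int: "(\<integral>x. \<psi> x \<partial>arcsine) = D - (\<integral>x. ln (Q x) \<partial>arcsine) - 1 + (\<integral>x. R x \<partial>\<nu>)"
  proof -
    have "(\<integral>x. \<psi> x \<partial>arcsine) = (\<integral>x. ln (G x) \<partial>arcsine) - (\<integral>x. ln (Q x) \<partial>arcsine) - (\<integral>x. 1 \<partial>arcsine) + (\<integral>x. Q x / G x \<partial>arcsine)"
      unfolding \<psi>_def using lnG(1) lnQ QG(1) unit_probs_integrable[OF arcsine_unit_probs continuous_on_const] by simp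
    then show ?thesis unfolding unit_probs_one[OF arcsine_unit_probs] QG(2) lnG(2) .
  qed
  have ae01: "AE x in arcsine. x \<in> {0..1}" by (rule AE_I2) simp
  have \<psi>eq: "\<psi> x = (Q x / G x - 1) - ln (Q x / G x)" if "x \<in> {0..1}" "0 < G x" for x
    using Q(2)[OF that(1)] that(2) by (simp add: \<psi>_def ln_div)
  have \<psi>nn: "AE x in arcsine. 0 \<le> \<psi> x"
    using G(3) ae01
  proof eventually_elim
    case (elim x)
    then show ?case using \<psi>eq[of x] Q(2)[of x] ln_le_minus_one[of "Q x / G x"] by simp
  qed
  have RQ: "(\<integral>x. R x \<partial>\<nu>) \<le> (\<integral>x. Q x \<partial>\<nu>)"
    using Q_nonneg by (intro integral_mono Ri Qi) (auto simp: R_def indicator_def)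
  have nn: "0 \<le> (\<integral>x. \<psi> x \<partial>arcsine)" by (rule integral_nonneg_AE[OF \<psi>nn])
  then show "(\<integral>x. ln (Q x) \<partial>arcsine) + 1 - (\<integral>x. Q x \<partial>\<nu>) \<le> D"
    using RQ unfolding \<psi>int by linarith
  assume "D \<le> (\<integral>x. ln (Q x) \<partial>arcsine) + 1 - (\<integral>x. Q x \<partial>\<nu>)"
  \<comment> \<open>Equality makes both estimates tight: the first gives G = Q almost everywhere for
    the arcsine law, the second excludes \<nu>-mass on the set where G = 0.\<close>
  then have z: "(\<integral>x. \<psi> x \<partial>arcsine) = 0" "(\<integral>x. R x \<partial>\<nu>) = (\<integral>x. Q x \<partial>\<nu>)"
    using nn RQ unfolding \<psi>int by linarith+
  have "AE x in arcsine. \<psi> x = 0"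
    using z(1) integral_nonneg_eq_0_iff_AE[OF \<psi>i \<psi>nn] by simp
  then have "AE x in arcsine. G x = Q x"
    using G(3) ae01
  proof eventually_elim
    case (elim x)
    then have "ln (Q x / G x) = Q x / G x - 1" using \<psi>eq[of x] by simp
    then have "Q x / G x = 1" using elim Q(2)[of x] by (intro ln_eq_minus_one) auto
    then show ?case using elim by simp
  qed
  then have "AE x in density \<nu> (\<lambda>x. ennreal (G x)). G x = Q x" unfolding G(2)[symmetric] .
  then have GQ: "AE x in \<nu>. 0 < G x \<longrightarrow> G x = Q x"
    using G(1) by (subst (asm) AE_density) auto
  have "(\<integral>x. Q x - R x \<partial>\<nu>) = 0" using z(2) Ri Qi by simp
  moreover have "AE x in \<nu>. 0 \<le> Q x - R x" using Q_nonneg by (intro AE_I2) (auto simp: R_def indicator_def)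
  ultimately have "AE x in \<nu>. Q x - R x = 0"
    using integral_nonneg_eq_0_iff_AE[of \<nu> "\<lambda>x. Q x - R x"] Ri Qi by simp
  then have one: "AE x in \<nu>. ennreal (G x) * ennreal (1 / Q x) = 1"
    using GQ AE_space
  proof eventually_elim
    case (elim x)
    then have "x \<in> {0..1}" by (simp add: space_unit_probs[OF \<nu>])
    then have "0 < Q x" by (rule Q(2))
    moreover have "G x \<noteq> 0"
    proof
      assume "G x = 0"
      then have "R x = 0" by (simp add: R_def)
      then show False using elim(1) \<open>0 < Q x\<close> by linarith
    qed
    ultimately have "G x = Q x" using elim G_nonneg[of x] by simp
    then show ?case using \<open>0 < Q x\<close> by (simp flip: ennreal_mult)
  qed
  have m1: "(\<lambda>x. ennreal (1 / Q x)) \<in> borel_measurable \<nu>" using meas by measurable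
  have "density arcsine (\<lambda>x. ennreal (1 / Q x)) = density \<nu> (\<lambda>x. ennreal (G x) * ennreal (1 / Q x))"
    unfolding G(2) using G(1) m1 by (intro density_density_eq) auto
  also have "\<dots> = density \<nu> (\<lambda>x. 1)"
    using one G(1) m1 by (intro density_cong) auto
  finally show "\<nu> = density arcsine (\<lambda>x. ennreal (1 / Q x))" by (simp add: density_1)
qed

lemma rel_entropy_density:
  fixes Q :: "real \<Rightarrow> real"
  assumes Q: "continuous_on {0..1} Q" "\<And>x. x \<in> {0..1} \<Longrightarrow> 0 < Q x"
    and \<mu>: "\<mu> = density arcsine (\<lambda>x. ennreal (1 / Q x))" "\<mu> \<in> unit_probs"
  shows "rel_entropy arcsine \<mu> = ereal (\<integral>x. ln (Q x) \<partial>arcsine)"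
proof -
  interpret \<mu>: prob_space \<mu> using \<mu> by (simp add: unit_probs_iff)
  note m = unit_probs_borel_measurable[OF _ Q(1)]
  have s: "sets arcsine = sets \<mu>" using \<mu> by (simp add: unit_probs_iff sets_arcsine)
  have Qe: "(\<lambda>x. ennreal (Q x)) \<in> borel_measurable \<mu>" using m[OF \<mu>(2)] by measurable
  have "density \<mu> (\<lambda>x. ennreal (Q x)) = density arcsine (\<lambda>x. ennreal (1 / Q x) * ennreal (Q x))"
    unfolding \<mu>(1) using m[OF arcsine_unit_probs] by (intro density_density_eq) auto
  also have "\<dots> = density arcsine (\<lambda>x. 1)"
  proof (rule density_cong)
    show "AE x in arcsine. ennreal (1 / Q x) * ennreal (Q x) = 1"
    proof (rule AE_I2)
      fix x assume "x \<in> space arcsine"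
      then have "0 < Q x" using Q(2) by simp
      then show "ennreal (1 / Q x) * ennreal (Q x) = 1" by (simp flip: ennreal_mult)
    qed
  qed (use m[OF arcsine_unit_probs] in auto)
  finally have eq: "density \<mu> (\<lambda>x. ennreal (Q x)) = arcsine" by (simp add: density_1)
  have ac: "absolutely_continuous \<mu> arcsine"
    unfolding eq[symmetric] by (rule absolutely_continuousI_density[OF Qe])
  have "AE x in \<mu>. ennreal (Q x) = RN_deriv \<mu> arcsine x"
    by (rule \<mu>.RN_deriv_unique[OF Qe eq])
  then have "AE x in arcsine. ennreal (Q x) = RN_deriv \<mu> arcsine x"
    by (rule absolutely_continuous_AE[OF s ac])
  moreover have "AE x in arcsine. x \<in> {0..1}" by (rule AE_I2) simp
  ultimately have ed: "AE x in arcsine. entropy_density (exp 1) \<mu> arcsine x = ln (Q x)"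
  proof eventually_elim
    case (elim x)
    then show ?case using Q(2)[of x] by (simp add: entropy_density_def log_def flip: elim(1))
  qed
  have m1: "entropy_density (exp 1) \<mu> arcsine \<in> borel_measurable arcsine"
  proof -
    have [measurable]: "RN_deriv \<mu> arcsine \<in> borel_measurable arcsine"
      using borel_measurable_RN_deriv[of \<mu> arcsine] by (simp add: measurable_cong_sets[OF s refl])
    show ?thesis unfolding entropy_density_def o_def by measurable
  qed
  have lnQc: "continuous_on {0..1} (\<lambda>x. ln (Q x))"
    using Q(2) by (intro continuous_on_ln Q(1)) force
  have m2: "(\<lambda>x. ln (Q x)) \<in> borel_measurable arcsine"
    by (rule unit_probs_borel_measurable[OF arcsine_unit_probs lnQc])
  have "integrable arcsine (entropy_density (exp 1) \<mu> arcsine)"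
    using integrable_cong_AE[OF m1 m2 ed] unit_probs_integrable[OF arcsine_unit_probs lnQc] by simp
  moreover have "KL_divergence (exp 1) \<mu> arcsine = (\<integral>x. ln (Q x) \<partial>arcsine)"
    unfolding KL_divergence_def by (rule integral_cong_AE[OF m1 m2 ed])
  ultimately show ?thesis using ac by (simp add: rel_entropy_def)
qed

lemma szego_mean_log_scaled:
  assumes B: "szego l N h k q T U" and r: "0 < r"
  shows "(\<integral>x. ln (poly q x / r) \<partial>arcsine) = - ln r"
proof -
  have lnc: "continuous_on {0..1} (\<lambda>x. ln (poly q x))"
    using szego_poly_pos[OF B] by (intro continuous_on_ln continuous_intros) force
  have "ln (poly q x / r) = ln (poly q x) - ln r" if "x \<in> {0..1}" for x
    using szego_poly_pos[OF B that] r by (simp add: ln_div)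
  then have "(\<integral>x. ln (poly q x / r) \<partial>arcsine) = (\<integral>x. ln (poly q x) - ln r \<partial>arcsine)"
    by (intro Bochner_Integration.integral_cong) auto
  also have "\<dots> = (\<integral>x. ln (poly q x) \<partial>arcsine) - (\<integral>x. ln r \<partial>arcsine)"
    using unit_probs_integrable[OF arcsine_unit_probs lnc] unit_probs_integrable[OF arcsine_unit_probs continuous_on_const]
    by (intro Bochner_Integration.integral_diff) auto
  also have "\<dots> = - ln r"
    using unit_probs_one[OF arcsine_unit_probs] szego_mean_log[OF B] by simp
  finally show ?thesis .
qed

text \<open>The comparison density \<open>r / q\<close> need not have mass 1, so \<open>r\<close> is
  free: \<open>r = N\<close> gives the sharp bound when \<open>q\<close> has integral N, and a small
  \<open>r\<close> exploits a small integral of \<open>q\<close>.\<close>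

lemma szego_entropy_bound:
  assumes B: "szego l N h k q T U" and \<nu>: "\<nu> \<in> unit_probs" and D: "rel_entropy arcsine \<nu> = ereal D" and r: "0 < r"
  shows "- ln r + 1 - poly_mean \<nu> q / r \<le> D"
    and "D \<le> - ln r + 1 - poly_mean \<nu> q / r \<Longrightarrow> \<nu> = szego_measure r q"
proof -
  have Q: "continuous_on {0..1} (\<lambda>x. poly q x / r)" "\<And>x. x \<in> {0..1} \<Longrightarrow> 0 < poly q x / r"
    using r szego_poly_pos[OF B] by (auto intro!: continuous_intros)
  note ln = szego_mean_log_scaled[OF B r]
  have q: "(\<integral>x. poly q x / r \<partial>\<nu>) = poly_mean \<nu> q / r" by simp
  show "- ln r + 1 - poly_mean \<nu> q / r \<le> D"
    using rel_entropy_lower_bound(1)[OF \<nu> Q D] unfolding ln q by simp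
  show "\<nu> = szego_measure r q" if "D \<le> - ln r + 1 - poly_mean \<nu> q / r"
    using rel_entropy_lower_bound(2)[OF \<nu> Q D] that unfolding ln q szego_measure_def by (simp only: divide_divide_eq_right mult_1)
qed

lemma szego_entropy:
  assumes B: "szego l N h k q T U"
  shows "rel_entropy arcsine (szego_measure N q) = ereal (- ln N)"
proof -
  have N: "0 < N" by (rule szego_pos[OF B])
  have Q: "continuous_on {0..1} (\<lambda>x. poly q x / N)" "\<And>x. x \<in> {0..1} \<Longrightarrow> 0 < poly q x / N"
    using N szego_poly_pos[OF B] by (auto intro!: continuous_intros)
  have eq: "szego_measure N q = density arcsine (\<lambda>x. ennreal (1 / (poly q x / N)))"
    unfolding szego_measure_def by (simp only: divide_divide_eq_right mult_1)
  have "rel_entropy arcsine (szego_measure N q) = ereal (\<integral>x. ln (poly q x / N) \<partial>arcsine)"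
    by (rule rel_entropy_density[OF Q eq szego_measure_unit_probs[OF B]])
  then show ?thesis by (simp add: szego_mean_log_scaled[OF B N])
qed

text \<open>Finite entropy keeps the moments off the boundary at every order. If the integral of
  \<open>q\<close> were at most r = exp(- D - 1), the lower bound would give D + 2 - 1 \<le>
  D.\<close>

lemma finite_entropy_szego:
  assumes \<nu>: "\<nu> \<in> unit_probs" and D: "rel_entropy arcsine \<nu> = ereal D"
  shows "\<exists>N h k q T U. szego l N h k q T U \<and> moment_vector l \<nu> = moment_vector l (szego_measure N q)"
proof (induction l)
  case 0
  have "moment_vector 0 \<nu> = moment_vector 0 (szego_measure 1 1)" by (simp add: moment_vector_def restrict_def)
  then show ?case using szego.zero by blast
next
  case (Suc l)
  then obtain N h k q T U where B: "szego l N h k q T U" "moment_vector l \<nu> = moment_vector l (szego_measure N q)" by blast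
  from szego_extend[OF B(1) \<nu> B(2)] show ?case
  proof
    assume "\<forall>\<epsilon>>0. \<exists>N' h' k' q' T' U'. szego (Suc l) N' h' k' q' T' U' \<and> poly_mean \<nu> q' \<le> \<epsilon>"
    then obtain N' h' k' q' T' U' where B': "szego (Suc l) N' h' k' q' T' U'" "poly_mean \<nu> q' \<le> exp (- D - 1)"
      by (metis exp_gt_zero)
    have "poly_mean \<nu> q' / exp (- D - 1) \<le> 1" using B'(2) by simp
    moreover have "D + 2 - poly_mean \<nu> q' / exp (- D - 1) \<le> D"
      using szego_entropy_bound(1)[OF B'(1) \<nu> D, of "exp (- D - 1)"] unfolding ln_exp by (simp only: exp_gt_zero) argo
    ultimately have False by linarith
    then show ?case ..
  qed
qed

section \<open>Constraints, maximal width and the entropy minimiser\<close>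

lemma dom_subset_top_index:
  assumes "is_constraint C" "top_index C \<le> l" shows "dom C \<subseteq> {1..l}"
proof
  fix i assume i: "i \<in> dom C"
  then have "i \<le> top_index C" using assms by (auto simp: top_index_def is_constraint_def)
  moreover have "i \<noteq> 0" using i assms by (auto simp: is_constraint_def)
  ultimately show "i \<in> {1..l}" using assms by auto
qed

lemma constr_moment_vector_iff:
  assumes "is_constraint C" "top_index C \<le> l" and \<nu>: "\<nu> \<in> unit_probs"
  shows "\<nu> \<in> constr_prob_moments C {0..1} \<longleftrightarrow> (\<forall>i\<in>dom C. C i = Some (moment_vector l \<nu> i))"
proof -
  have "moment_vector l \<nu> i = moment \<nu> i" if "i \<in> dom C" for i
    using dom_subset_top_index[OF assms(1,2)] that by (auto simp: moment_vector_def)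
  then show ?thesis using \<nu> by (simp add: constr_prob_moments_def)
qed

lemma constr_moment_space_iff:
  assumes "is_constraint C" "top_index C \<le> l"
  shows "x \<in> constr_moments C l \<longleftrightarrow> x \<in> moments l \<and> (\<forall>i\<in>dom C. C i = Some (x i))"
proof -
  have "constr_prob_moments C {0..1} \<subseteq> unit_probs" by (auto simp: constr_prob_moments_def)
  then show ?thesis
    using constr_moment_vector_iff[OF assms] unfolding constr_moment_space_def moment_space_def by blast
qed

lemma constr_moment_space_seq_closed:
  assumes C: "is_constraint C" "top_index C \<le> l" and X: "\<And>k. X k \<in> constr_moments C l"
    and x: "x \<in> moments l" and lim: "\<And>j. j \<in> {1..l} \<Longrightarrow> (\<lambda>i. X i j) \<longlonglongrightarrow> x j"
  shows "x \<in> constr_moments C l"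
  unfolding constr_moment_space_iff[OF C]
proof (intro conjI ballI x)
  fix i assume i: "i \<in> dom C"
  then obtain c where c: "C i = Some c" by blast
  have "X k i = c" for k using X[of k] i c unfolding constr_moment_space_iff[OF C] by force
  then have "x i = c" using lim[of i] dom_subset_top_index[OF C] i by (simp add: subset_iff LIMSEQ_const_iff)
  then show "C i = Some (x i)" using c by simp
qed

lemma constr_moment_space_mix:
  assumes C: "is_constraint C" "top_index C \<le> l"
    and x: "x \<in> constr_moments C l" "y \<in> constr_moments C l" and t: "0 \<le> t" "t \<le> 1"
  shows "mix l t x y \<in> constr_moments C l"
proof -
  have "C i = Some (mix l t x y i)" if i: "i \<in> dom C" for i
  proof -
    have "C i = Some (x i)" "C i = Some (y i)" using x i by (auto simp: constr_moment_space_iff[OF C])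
    then have "y i = x i" by simp
    moreover have "i \<in> {1..l}" using dom_subset_top_index[OF C] i by blast
    ultimately show ?thesis using \<open>C i = Some (x i)\<close> by (simp add: mix_def algebra_simps)
  qed
  then show ?thesis using x t by (auto simp: constr_moment_space_iff[OF C] intro: unit_moments_mix)
qed

lemma width_attains_max:
  assumes C: "is_constraint C" "top_index C \<le> l" and ne: "constr_moments C l \<noteq> {}"
  obtains x where "x \<in> constr_moments C l"
    "\<And>y. y \<in> constr_moments C l \<Longrightarrow> width l y \<le> width l x"
proof -
  let ?K = "constr_moments C l"
  define S where "S = Sup (width l ` ?K)"
  have K: "y \<in> moments l" if "y \<in> ?K" for y using that by (simp add: constr_moment_space_iff[OF C])
  have bdd: "bdd_above (width l ` ?K)" using width_le_1[OF K] by (intro bdd_aboveI[of _ 1]) auto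
  have "\<exists>y\<in>?K. S - 1 / real (Suc k) < width l y" for k
    using less_cSup_iff[of "width l ` ?K" "S - 1 / real (Suc k)"] ne bdd by (auto simp: S_def)
  then obtain X where X: "\<And>k. X k \<in> ?K" "\<And>k. S - 1 / real (Suc k) < width l (X k)" by metis
  obtain r x where r: "strict_mono r" and x: "x \<in> moments l" "\<And>j. j \<in> {1..l} \<Longrightarrow> (\<lambda>i. X (r i) j) \<longlonglongrightarrow> x j"
    by (rule unit_moments_seq_compact[of X l, OF K[OF X(1)]]) blast
  have xK: "x \<in> ?K" by (rule constr_moment_space_seq_closed[OF C X(1) x])
  \<comment> \<open>Since \<open>r (k + m)\<close> is at least \<open>m\<close>, the whole tail
    satisfies the bound, which then passes to the limit by upper semicontinuity.\<close>
  have "S - 1 / real (Suc m) \<le> width l x" for m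
  proof (rule conjunct2[OF width_usc[of "\<lambda>i. X (r (i + m))" l x]])
    show "X (r (k + m)) \<in> moments l" for k by (rule K[OF X(1)])
    show "x \<in> extensional {1..l}" by (rule unit_moments_extensional[OF x(1)])
    show "(\<lambda>i. X (r (i + m)) j) \<longlonglongrightarrow> x j" if "j \<in> {1..l}" for j
      using LIMSEQ_ignore_initial_segment[OF x(2)[OF that]] .
    show "S - 1 / real (Suc m) \<le> width l (X (r (k + m)))" for k
    proof -
      have "m \<le> r (k + m)" using seq_suble[OF r, of "k + m"] by linarith
      then have "1 / real (Suc (r (k + m))) \<le> 1 / real (Suc m)" by (simp add: field_simps)
      then show ?thesis using X(2)[of "r (k + m)"] by linarith
    qed
  qed
  then have "S \<le> width l x"
    using LIMSEQ_le_const2[of "\<lambda>m. S - 1 / real (Suc m)" S]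
      tendsto_diff[OF tendsto_const LIMSEQ_Suc[OF lim_1_over_n], of S] by simp
  then show ?thesis
    using that[OF xK] cSup_upper[OF _ bdd] unfolding S_def by (meson imageI order_trans)
qed

text \<open>A measure of finite entropy has the first \<open>l\<close> moments of some
  Bernstein-Szego measure with normalisation \<open>N1\<close>, hence entropy at least
  \<open>- ln N1\<close>; the largest width gives the largest \<open>N\<close> and so the minimum.
  The argument also proves uniqueness of the minimiser, which the definite description requires,
  without presupposing that the maximiser of the width is unique.\<close>

lemma entropy_minimizer_moments:
  assumes C: "is_constraint C" "top_index C \<le> l"
    and x: "x \<in> constr_moments C l" "0 < width l x"
    and max: "\<And>y. y \<in> constr_moments C l \<Longrightarrow> width l y \<le> width l x"
  shows "moment_vector l (entropy_minimizer C) = x"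
proof -
  let ?K = "constr_moments C l" and ?P = "constr_prob_moments C {0..1}"
  have K: "y \<in> moments l" if "y \<in> ?K" for y using that by (simp add: constr_moment_space_iff[OF C])
  have P: "\<nu> \<in> unit_probs" "moment_vector l \<nu> \<in> ?K" if "\<nu> \<in> ?P" for \<nu>
    using that by (auto simp: constr_prob_moments_def constr_moment_space_def)
  obtain N h k q T U where B: "szego l N h k q T U" and xB: "x = moment_vector l (szego_measure N q)"
    using szego_exists[OF K[OF x(1)] x(2)] by blast
  define \<mu> where "\<mu> = szego_measure N q"
  have wx: "width l x = N / 4 ^ l" using szego_next_moments(3)[OF B] by (simp add: xB)
  have N: "0 < N" by (rule szego_pos[OF B])
  have \<mu>: "\<mu> \<in> unit_probs" "rel_entropy arcsine \<mu> = ereal (- ln N)"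
    using szego_measure_unit_probs[OF B] szego_entropy[OF B] by (auto simp: \<mu>_def)
  have \<mu>P: "\<mu> \<in> ?P"
    using x(1) \<mu>(1) by (simp add: constr_moment_vector_iff[OF C] constr_moment_space_iff[OF C] xB \<mu>_def)
  have ge: "- ln N \<le> D" and eq: "D \<le> - ln N \<Longrightarrow> \<nu> = \<mu>" if \<nu>: "\<nu> \<in> ?P" and D: "rel_entropy arcsine \<nu> = ereal D" for \<nu> D
  proof -
    obtain N1 h1 k1 q1 T1 U1 where B1: "szego l N1 h1 k1 q1 T1 U1" "moment_vector l \<nu> = moment_vector l (szego_measure N1 q1)"
      using finite_entropy_szego[OF P(1)[OF \<nu>] D] by blast
    have w1: "width l (moment_vector l \<nu>) = N1 / 4 ^ l" using szego_next_moments(3)[OF B1(1)] by (simp add: B1(2))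
    then have N1: "N1 \<le> N" using max[OF P(2)[OF \<nu>]] wx by (simp add: divide_le_cancel)
    have m1: "poly_mean \<nu> q1 = N1"
      using integral_poly_cong[OF P(1)[OF \<nu>] szego_measure_unit_probs[OF B1(1)] B1(2), of q1] szego_degree[OF B1(1)]
        szego_mean_self[OF B1(1)] by simp
    have D1: "- ln N1 \<le> D"
      using szego_entropy_bound(1)[OF B1(1) P(1)[OF \<nu>] D szego_pos[OF B1(1)]] szego_pos[OF B1(1)] by (simp add: m1)
    then show "- ln N \<le> D" using N1 szego_pos[OF B1(1)] ln_le_cancel_iff[of N1 N] N by linarith
    assume DN: "D \<le> - ln N"
    then have "ln N \<le> ln N1" using D1 by simp
    then have NN: "N1 = N" using N1 N szego_pos[OF B1(1)] by simp
    \<comment> \<open>By concavity the midpoint is again a maximiser, and its polynomial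
      \<open>q2\<close> tests both measures: the two integrals sum to 2 N and each is at least N by
      duality. Both therefore attain equality in the entropy bound, whose equality case gives the
      same measure.\<close>
    define z where "z = mix l (1/2) x (moment_vector l \<nu>)"
    have zK: "z \<in> ?K" unfolding z_def by (rule constr_moment_space_mix[OF C x(1) P(2)[OF \<nu>]]) auto
    have "width l x \<le> width l z"
      using width_mix[OF K[OF x(1)] K[OF P(2)[OF \<nu>]], of "1/2"] w1 wx unfolding z_def NN by simp
    then have wz: "width l z = width l x" using max[OF zK] by simp
    obtain N2 h2 k2 q2 T2 U2 where B2: "szego l N2 h2 k2 q2 T2 U2" "z = moment_vector l (szego_measure N2 q2)"
      using szego_exists[OF K[OF zK]] wz x(2) by auto
    have N2: "N2 = N" using szego_next_moments(3)[OF B2(1)] wz wx by (simp add: B2(2))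
    obtain \<rho> where \<rho>: "\<rho> \<in> unit_probs" "\<And>j. moment \<rho> j = (1 - 1/2) * moment \<mu> j + 1/2 * moment \<nu> j"
      "\<And>f :: real \<Rightarrow> real. continuous_on {0..1} f \<Longrightarrow> (\<integral>x. f x \<partial>\<rho>) = (1 - 1/2) * (\<integral>x. f x \<partial>\<mu>) + 1/2 * (\<integral>x. f x \<partial>\<nu>)"
      by (rule mixture_unit_probs[OF \<mu>(1) P(1)[OF \<nu>], of "1/2"]) auto
    have "moment_vector l \<rho> = z"
      by (auto simp: z_def mix_def xB \<mu>_def[symmetric] \<rho>(2) moment_vector_def fun_eq_iff restrict_def)
    then have "poly_mean \<rho> q2 = N"
      using integral_poly_cong[OF \<rho>(1) szego_measure_unit_probs[OF B2(1)], of l q2] szego_degree[OF B2(1)]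
        szego_mean_self[OF B2(1)] B2(2) N2 by simp
    then have avg: "poly_mean \<mu> q2 + poly_mean \<nu> q2 = 2 * N"
      using \<rho>(3)[of "poly q2"] by (simp add: continuous_intros field_simps)
    have "N \<le> poly_mean \<mu> q2" "N \<le> poly_mean \<nu> q2"
      using width_le_szego[OF B2(1) \<mu>(1)] width_le_szego[OF B2(1) P(1)[OF \<nu>]] wx w1 NN
      by (simp_all add: xB \<mu>_def divide_le_cancel)
    then have "poly_mean \<mu> q2 = N" "poly_mean \<nu> q2 = N" using avg by linarith+
    then have "\<nu> = szego_measure N q2" "\<mu> = szego_measure N q2"
      using szego_entropy_bound(2)[OF B2(1) P(1)[OF \<nu>] D N] szego_entropy_bound(2)[OF B2(1) \<mu> N] DN N by auto
    then show "\<nu> = \<mu>" by simp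
  qed
  have "entropy_minimizer C = \<mu>"
    unfolding entropy_minimizer_def
  proof (rule the_equality)
    have "\<not> rel_entropy arcsine \<nu> < rel_entropy arcsine \<mu>" if "\<nu> \<in> ?P" for \<nu>
    proof (cases "rel_entropy arcsine \<nu>")
      case (real D)
      then show ?thesis using ge[OF that real] by (simp add: \<mu>(2))
    qed (auto simp: rel_entropy_def split: if_splits)
    then show "is_arg_min (rel_entropy arcsine) (\<lambda>\<mu>. \<mu> \<in> ?P) \<mu>"
      using \<mu>P by (auto simp: is_arg_min_def)
    fix \<nu> assume am: "is_arg_min (rel_entropy arcsine) (\<lambda>\<mu>. \<mu> \<in> ?P) \<nu>"
    then have \<nu>: "\<nu> \<in> ?P" "rel_entropy arcsine \<nu> \<le> ereal (- ln N)"
      using \<mu>P \<mu>(2) by (auto simp: is_arg_min_def not_less)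
    show "\<nu> = \<mu>"
    proof (cases "rel_entropy arcsine \<nu>")
      case (real D)
      then show ?thesis using eq[OF \<nu>(1) real] \<nu>(2) by simp
    qed (use \<nu>(2) in \<open>auto simp: rel_entropy_def split: if_splits\<close>)
  qed
  then show ?thesis by (simp add: xB \<mu>_def)
qed

section \<open>Interior points and the topology of the moment spaces\<close>

lemma discrete_unit_prob:
  assumes S: "finite S" and w: "\<And>a. a \<in> S \<Longrightarrow> 0 \<le> w a" "sum w S = 1" and \<tau>: "\<And>a. a \<in> S \<Longrightarrow> \<tau> a \<in> {0..1::real}"
  obtains \<mu> where "\<mu> \<in> unit_probs" "\<And>j. moment \<mu> j = (\<Sum>a\<in>S. w a * \<tau> a ^ j)"
proof -
  define P where "P = point_measure S (\<lambda>a. ennreal (w a))"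
  define \<mu> where "\<mu> = distr P (restrict_space borel {0..1}) \<tau>"
  have "emeasure P (space P) = 1"
    unfolding P_def using S w by (simp add: space_point_measure emeasure_point_measure_finite sum_ennreal)
  then interpret P: prob_space P by (rule prob_spaceI)
  have \<tau>m: "\<tau> \<in> measurable P (restrict_space borel {0..1})"
    unfolding P_def using \<tau> by (auto simp: space_restrict_space)
  have "\<mu> \<in> unit_probs"
    unfolding unit_probs_iff \<mu>_def using \<tau>m by (auto intro!: P.prob_space_distr)
  moreover have "moment \<mu> j = (\<Sum>a\<in>S. w a * \<tau> a ^ j)" for j
  proof -
    have "moment \<mu> j = (\<integral>a. \<tau> a ^ j \<partial>P)"
      unfolding moment_def \<mu>_def using \<tau>m
      by (subst integral_distr) (auto intro!: borel_measurable_continuous_on_restrict continuous_intros)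
    then show ?thesis unfolding P_def using S w by (simp add: lebesgue_integral_point_measure_finite)
  qed
  ultimately show ?thesis using that by blast
qed

text \<open>The coefficients of the Lagrange polynomials invert the Vandermonde matrix:
  interpolating the monomial of degree j at the nodes gives back that monomial.\<close>

lemma power_dual_basis:
  fixes \<tau> :: "'a \<Rightarrow> real"
  assumes S: "finite S" "card S = Suc n" and inj: "inj_on \<tau> S"
  obtains c where "\<And>i j. i \<le> n \<Longrightarrow> j \<le> n \<Longrightarrow> (\<Sum>a\<in>S. c i a * \<tau> a ^ j) = (if i = j then 1 else 0)"
proof -
  define L where "L a = (\<Prod>b\<in>S - {a}. smult (1 / (\<tau> a - \<tau> b)) [:- \<tau> b, 1:])" for a
  have Ld: "degree (L a) \<le> n" if "a \<in> S" for a
  proof -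
    have "degree (L a) \<le> (\<Sum>b\<in>S - {a}. degree (smult (1 / (\<tau> a - \<tau> b)) [:- \<tau> b, 1:]))"
      unfolding L_def using S(1) by (intro degree_prod_sum_le[unfolded o_def]) auto
    also have "\<dots> \<le> (\<Sum>b\<in>S - {a}. 1)" by (intro sum_mono) (auto intro: order_trans[OF degree_smult_le])
    also have "\<dots> = n" using S that by simp
    finally show ?thesis .
  qed
  have Lv: "poly (L a) (\<tau> b) = (if a = b then 1 else 0)" if "a \<in> S" "b \<in> S" for a b
  proof (cases "a = b")
    case True
    have "poly (L a) (\<tau> a) = (\<Prod>b\<in>S - {a}. 1 / (\<tau> a - \<tau> b) * (\<tau> a - \<tau> b))"
      unfolding L_def poly_prod
    proof (rule prod.cong[OF refl])
      show "poly (smult (1 / (\<tau> a - \<tau> b)) [:- \<tau> b, 1:]) (\<tau> a) = 1 / (\<tau> a - \<tau> b) * (\<tau> a - \<tau> b)" for b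
        by (subst poly_smult) simp
    qed
    also have "\<dots> = (\<Prod>b\<in>S - {a}. 1)"
      using inj that by (intro prod.cong) (auto dest: inj_onD)
    finally show ?thesis using True by simp
  next
    case False
    have "poly (smult (1 / (\<tau> a - \<tau> b)) [:- \<tau> b, 1:]) (\<tau> b) = 0" by simp
    then have "poly (L a) (\<tau> b) = 0"
      unfolding L_def poly_prod using S(1) that False by (intro prod_zero) auto
    then show ?thesis using False by simp
  qed
  have eq: "(\<Sum>a\<in>S. smult (\<tau> a ^ j) (L a)) = monom 1 j" if j: "j \<le> n" for j
  proof (rule poly_eqI_degree[of "\<tau> ` S"])
    have card: "card (\<tau> ` S) = Suc n" using inj S by (simp add: card_image)
    show "degree (monom (1::real) j) < card (\<tau> ` S)" using j by (simp add: card degree_monom_eq)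
    have "degree (\<Sum>a\<in>S. smult (\<tau> a ^ j) (L a)) \<le> n"
      using S(1) Ld by (intro degree_sum_le) (auto intro: order_trans[OF degree_smult_le])
    then show "degree (\<Sum>a\<in>S. smult (\<tau> a ^ j) (L a)) < card (\<tau> ` S)" by (simp add: card)
    fix x assume "x \<in> \<tau> ` S"
    then obtain b where b: "b \<in> S" "x = \<tau> b" by blast
    have "poly (\<Sum>a\<in>S. smult (\<tau> a ^ j) (L a)) x = (\<Sum>a\<in>S. if a = b then \<tau> a ^ j else 0)"
      unfolding poly_sum poly_smult using b by (intro sum.cong) (auto simp: Lv)
    then show "poly (\<Sum>a\<in>S. smult (\<tau> a ^ j) (L a)) x = poly (monom 1 j) x"
      using S(1) b by (simp add: poly_monom)
  qed
  show ?thesis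
  proof (rule that[of "\<lambda>i a. coeff (L a) i"])
    fix i j assume ij: "i \<le> n" "j \<le> n"
    have "(\<Sum>a\<in>S. coeff (L a) i * \<tau> a ^ j) = coeff (\<Sum>a\<in>S. smult (\<tau> a ^ j) (L a)) i"
      by (simp add: coeff_sum mult.commute)
    then show "(\<Sum>a\<in>S. coeff (L a) i * \<tau> a ^ j) = (if i = j then 1 else 0)"
      unfolding eq[OF ij(2)] by auto
  qed
qed

text \<open>Start from uniform weights on \<open>n + 1\<close> nodes and alter them by the dual
  basis. Its vector of index 0 is left out, so the total mass stays 1; small changes keep the
  weights nonnegative.\<close>

lemma moment_perturbation:
  obtains \<mu> \<eta> where "\<mu> \<in> unit_probs" "0 < \<eta>"
    "\<And>d. (\<And>j. j \<in> {1..n} \<Longrightarrow> \<bar>d j\<bar> \<le> \<eta>) \<Longrightarrow> \<exists>\<mu>'\<in>unit_probs. \<forall>j\<in>{1..n}. moment \<mu>' j = moment \<mu> j + d j"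
proof -
  define S where "S = {..n}"
  define \<tau> where "\<tau> a = real a / real (Suc n)" for a
  have S: "finite S" "card S = Suc n" by (auto simp: S_def)
  have inj: "inj_on \<tau> S" by (auto simp: inj_on_def \<tau>_def)
  have \<tau>01: "\<tau> a \<in> {0..1}" if "a \<in> S" for a using that by (auto simp: S_def \<tau>_def)
  obtain c where c: "\<And>i j. i \<le> n \<Longrightarrow> j \<le> n \<Longrightarrow> (\<Sum>a\<in>S. c i a * \<tau> a ^ j) = (if i = j then 1 else 0)"
    using power_dual_basis[OF S inj] by blast
  \<comment> \<open>\<open>Z\<close> dominates every sum of |c i a| over i, and the summand 1 keeps
    it positive; \<open>\<eta> * Z\<close> is then exactly the uniform weight.\<close>
  define Z where "Z = 1 + (\<Sum>a\<in>S. \<Sum>i\<in>{1..n}. \<bar>c i a\<bar>)"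
  have Z: "1 \<le> Z" by (simp add: Z_def sum_nonneg)
  define \<eta> where "\<eta> = 1 / (real (Suc n) * Z)"
  have \<eta>: "0 < \<eta>" using Z by (simp add: \<eta>_def)
  have unif: "(\<Sum>a\<in>S. 1 / real (Suc n)) = 1" using S by simp
  obtain \<mu> where \<mu>: "\<mu> \<in> unit_probs" "\<And>j. moment \<mu> j = (\<Sum>a\<in>S. 1 / real (Suc n) * \<tau> a ^ j)"
    by (rule discrete_unit_prob[of S "\<lambda>_. 1 / real (Suc n)" \<tau>, OF S(1) _ unif \<tau>01]) auto
  have "\<exists>\<mu>'\<in>unit_probs. \<forall>j\<in>{1..n}. moment \<mu>' j = moment \<mu> j + d j"
    if d: "\<And>j. j \<in> {1..n} \<Longrightarrow> \<bar>d j\<bar> \<le> \<eta>" for d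
  proof -
    define w where "w a = 1 / real (Suc n) + (\<Sum>i\<in>{1..n}. d i * c i a)" for a
    have wsum: "(\<Sum>a\<in>S. w a * \<tau> a ^ j) = (\<Sum>a\<in>S. 1 / real (Suc n) * \<tau> a ^ j) + (if j \<in> {1..n} then d j else 0)" if "j \<le> n" for j
    proof -
      have "(\<Sum>a\<in>S. w a * \<tau> a ^ j) = (\<Sum>a\<in>S. 1 / real (Suc n) * \<tau> a ^ j) + (\<Sum>a\<in>S. \<Sum>i\<in>{1..n}. d i * (c i a * \<tau> a ^ j))"
        unfolding w_def by (simp add: distrib_right sum.distrib sum_distrib_right mult.assoc)
      also have "(\<Sum>a\<in>S. \<Sum>i\<in>{1..n}. d i * (c i a * \<tau> a ^ j)) = (\<Sum>i\<in>{1..n}. d i * (\<Sum>a\<in>S. c i a * \<tau> a ^ j))"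
        by (subst sum.swap) (simp add: sum_distrib_left)
      also have "\<dots> = (\<Sum>i\<in>{1..n}. if i = j then d i else 0)"
        using that by (intro sum.cong) (auto simp: c)
      finally show ?thesis by simp
    qed
    have w0: "0 \<le> w a" if a: "a \<in> S" for a
    proof -
      have "\<bar>\<Sum>i\<in>{1..n}. d i * c i a\<bar> \<le> (\<Sum>i\<in>{1..n}. \<eta> * \<bar>c i a\<bar>)"
        using d by (intro order_trans[OF sum_abs] sum_mono) (auto simp: abs_mult intro!: mult_right_mono)
      also have "\<dots> = \<eta> * (\<Sum>i\<in>{1..n}. \<bar>c i a\<bar>)" by (simp add: sum_distrib_left)
      also have "\<dots> \<le> \<eta> * Z"
      proof -
        have "(\<Sum>i\<in>{1..n}. \<bar>c i a\<bar>) \<le> (\<Sum>a\<in>S. \<Sum>i\<in>{1..n}. \<bar>c i a\<bar>)"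
          using a S by (intro member_le_sum) (auto intro: sum_nonneg)
        then show ?thesis using \<eta> by (intro mult_left_mono) (auto simp: Z_def)
      qed
      also have "\<dots> = 1 / real (Suc n)" using Z by (simp add: \<eta>_def)
      finally show ?thesis by (simp add: w_def)
    qed
    have "sum w S = 1" using wsum[of 0] unif by simp
    then obtain \<mu>' where "\<mu>' \<in> unit_probs" "\<And>j. moment \<mu>' j = (\<Sum>a\<in>S. w a * \<tau> a ^ j)"
      using discrete_unit_prob[of S w \<tau>, OF S(1) w0 _ \<tau>01] by blast
    moreover from this have "moment \<mu>' j = moment \<mu> j + d j" if "j \<in> {1..n}" for j
      unfolding \<mu>(2) using wsum[of j] that by simp
    ultimately show ?thesis by blast
  qed
  then show ?thesis using that[OF \<mu>(1) \<eta>] by blast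
qed

lemma real_space_interior_box:
  assumes x: "x \<in> real_space n interior_of A"
  obtains \<delta> where "0 < \<delta>"
    "\<And>y. y \<in> extensional {1..n} \<Longrightarrow> (\<And>j. j \<in> {1..n} \<Longrightarrow> \<bar>y j - x j\<bar> < \<delta>) \<Longrightarrow> y \<in> A"
proof -
  obtain T where T: "openin (real_space n) T" "x \<in> T" "T \<subseteq> A"
    using x by (auto simp: interior_of_def)
  then obtain U where U: "\<forall>i\<in>{1..n}. open (U i)" "x \<in> Pi\<^sub>E {1..n} U" "Pi\<^sub>E {1..n} U \<subseteq> T"
    unfolding real_space_def openin_product_topology_alt open_openin[symmetric] by (metis open_openin)
  have "\<exists>e>0. ball (x i) e \<subseteq> U i" if "i \<in> {1..n}" for i
    using U that by (auto simp: PiE_iff open_contains_ball)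
  then obtain e where e: "\<And>i. i \<in> {1..n} \<Longrightarrow> 0 < e i \<and> ball (x i) (e i) \<subseteq> U i" by metis
  \<comment> \<open>The element 1 covers \<open>n = 0\<close>, where there is no coordinate.\<close>
  define \<delta> where "\<delta> = Min (insert 1 (e ` {1..n}))"
  have \<delta>: "0 < \<delta>" using e by (simp add: \<delta>_def)
  have le: "\<delta> \<le> e i" if "i \<in> {1..n}" for i unfolding \<delta>_def using that by (intro Min_le) auto
  show ?thesis
  proof (rule that[OF \<delta>])
    fix y assume y: "y \<in> extensional {1..n}" "\<And>j. j \<in> {1..n} \<Longrightarrow> \<bar>y j - x j\<bar> < \<delta>"
    have "y i \<in> U i" if i: "i \<in> {1..n}" for i
    proof -
      have "y i \<in> ball (x i) (e i)" using y(2)[OF i] le[OF i] by (simp add: dist_real_def abs_minus_commute)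
      then show ?thesis using e[OF i] by blast
    qed
    then have "y \<in> Pi\<^sub>E {1..n} U" using y(1) by (simp add: PiE_iff)
    then show "y \<in> A" using U(3) T(3) by blast
  qed
qed

text \<open>An interior point of the moment space is the moment vector of a measure that dominates a multiple of any given
  measure; perturbing that part gives a box at every level \<open>n\<close>.\<close>

lemma admissible_box:
  assumes C: "is_constraint C" and adm: "admissible C {0..1}" and n: "top_index C \<le> n"
  obtains z \<eta> where "z \<in> constr_moments C n" "0 < \<eta>"
    "\<And>y. y \<in> extensional {1..n} \<Longrightarrow> (\<And>j. j \<in> {1..n} \<Longrightarrow> \<bar>y j - z j\<bar> \<le> \<eta>) \<Longrightarrow> y \<in> moments n"
proof -
  let ?t = "top_index C"
  obtain z0 where z0: "z0 \<in> constr_moments C ?t" "z0 \<in> real_space ?t interior_of moments ?t"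
    using adm by (auto simp: admissible_def)
  obtain \<delta> where \<delta>: "0 < \<delta>"
    "\<And>y. y \<in> extensional {1..?t} \<Longrightarrow> (\<And>j. j \<in> {1..?t} \<Longrightarrow> \<bar>y j - z0 j\<bar> < \<delta>) \<Longrightarrow> y \<in> moments ?t"
    using real_space_interior_box[OF z0(2)] by blast
  obtain \<mu> \<eta> where \<mu>: "\<mu> \<in> unit_probs" "0 < \<eta>"
    "\<And>d. (\<And>j. j \<in> {1..n} \<Longrightarrow> \<bar>d j\<bar> \<le> \<eta>) \<Longrightarrow> \<exists>\<mu>'\<in>unit_probs. \<forall>j\<in>{1..n}. moment \<mu>' j = moment \<mu> j + d j"
    by (rule moment_perturbation[of n]) blast
  \<comment> \<open>Extrapolate from the moments of \<mu> through \<open>z0\<close> by \<kappa>;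
    coordinates differ by at most 1, so the point \<open>w\<close> stays in the box of radius
    \<delta>. Then z0 = (w + \<kappa> m(\<mu>)) / (1 + \<kappa>), which is where the weight
    \<epsilon> comes from.\<close>
  define \<kappa> where "\<kappa> = \<delta> / 2"
  define \<epsilon> where "\<epsilon> = \<kappa> / (1 + \<kappa>)"
  have \<kappa>: "0 < \<kappa>" "\<kappa> < \<delta>" using \<delta>(1) by (auto simp: \<kappa>_def)
  have \<epsilon>: "0 < \<epsilon>" "\<epsilon> \<le> 1" using \<kappa> by (auto simp: \<epsilon>_def)
  have z0m: "z0 \<in> moments ?t" using z0(1) by (simp add: constr_moment_space_iff[OF C])
  define w where "w = (\<lambda>j\<in>{1..?t}. z0 j + \<kappa> * (z0 j - moment \<mu> j))"
  have "w \<in> moments ?t"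
  proof (rule \<delta>(2))
    show "w \<in> extensional {1..?t}" by (simp add: w_def)
    fix j assume j: "j \<in> {1..?t}"
    have z1: "\<bar>z0 j - moment \<mu> j\<bar> \<le> 1"
      using unit_moments_unit[OF z0m j] moment_unit[OF \<mu>(1), of j] by auto
    have "\<bar>w j - z0 j\<bar> = \<kappa> * \<bar>z0 j - moment \<mu> j\<bar>" using j \<kappa> by (simp add: w_def abs_mult)
    also have "\<dots> \<le> \<kappa> * 1" using z1 \<kappa> by (intro mult_left_mono) auto
    finally show "\<bar>w j - z0 j\<bar> < \<delta>" using \<kappa> by simp
  qed
  then obtain \<omega> where \<omega>: "\<omega> \<in> unit_probs" "w = moment_vector ?t \<omega>" by (auto simp: moment_space_def)
  obtain \<nu> where \<nu>: "\<nu> \<in> unit_probs" "\<And>j. moment \<nu> j = (1 - \<epsilon>) * moment \<omega> j + \<epsilon> * moment \<mu> j"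
    by (rule mixture_unit_probs[OF \<omega>(1) \<mu>(1), of \<epsilon>]) (use \<epsilon> in auto)
  have "moment \<nu> j = z0 j" if j: "j \<in> {1..?t}" for j
  proof -
    have "moment \<omega> j = z0 j + \<kappa> * (z0 j - moment \<mu> j)"
      using fun_cong[OF \<omega>(2), of j] j by (simp add: w_def moment_vector_def)
    then have "moment \<omega> j + \<kappa> * moment \<mu> j = (1 + \<kappa>) * z0 j" by (simp add: algebra_simps)
    moreover have "moment \<nu> j = (moment \<omega> j + \<kappa> * moment \<mu> j) / (1 + \<kappa>)"
    proof -
      have "1 - \<epsilon> = 1 / (1 + \<kappa>)" using \<kappa> by (simp add: \<epsilon>_def field_simps)
      then show ?thesis unfolding \<nu>(2) by (simp add: \<epsilon>_def add_divide_distrib)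
    qed
    ultimately show ?thesis using \<kappa> by simp
  qed
  then have "moment_vector ?t \<nu> = z0"
    using unit_moments_extensional[OF z0m] by (auto simp: moment_vector_def fun_eq_iff extensional_def)
  then have "\<nu> \<in> constr_prob_moments C {0..1}"
    using z0(1) by (simp add: constr_moment_vector_iff[OF C order_refl \<nu>(1)] constr_moment_space_iff[OF C])
  then have zC: "moment_vector n \<nu> \<in> constr_moments C n" by (auto simp: constr_moment_space_def)
  show ?thesis
  proof (rule that[OF zC, of "\<epsilon> * \<eta>"])
    show "0 < \<epsilon> * \<eta>" using \<epsilon> \<mu>(2) by simp
    fix y assume y: "y \<in> extensional {1..n}" "\<And>j. j \<in> {1..n} \<Longrightarrow> \<bar>y j - moment_vector n \<nu> j\<bar> \<le> \<epsilon> * \<eta>"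
    define d where "d j = (y j - moment \<nu> j) / \<epsilon>" for j
    have "\<bar>d j\<bar> \<le> \<eta>" if "j \<in> {1..n}" for j
      using y(2)[OF that] that \<epsilon> by (simp add: d_def moment_vector_def field_simps)
    then obtain \<mu>' where \<mu>': "\<mu>' \<in> unit_probs" "\<And>j. j \<in> {1..n} \<Longrightarrow> moment \<mu>' j = moment \<mu> j + d j"
      using \<mu>(3) by blast
    obtain \<rho> where \<rho>: "\<rho> \<in> unit_probs" "\<And>j. moment \<rho> j = (1 - \<epsilon>) * moment \<omega> j + \<epsilon> * moment \<mu>' j"
      by (rule mixture_unit_probs[OF \<omega>(1) \<mu>'(1), of \<epsilon>]) (use \<epsilon> in auto)
    have "moment \<rho> j = y j" if "j \<in> {1..n}" for j
      unfolding \<rho>(2) \<mu>'(2)[OF that] using \<epsilon> by (simp add: d_def \<nu>(2) field_simps)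
    then have "y = moment_vector n \<rho>"
      using y(1) by (auto simp: moment_vector_def fun_eq_iff extensional_def)
    then show "y \<in> moments n" using \<rho>(1) by (auto simp: moment_space_def)
  qed
qed

text \<open>A box one level higher allows the last coordinate to move by \<eta> over a fixed
  vector.\<close>

lemma exists_positive_width:
  assumes C: "is_constraint C" and adm: "admissible C {0..1}" and n: "top_index C \<le> n"
  shows "\<exists>x\<in>constr_moments C n. 0 < width n x"
proof -
  obtain z \<eta> where z: "z \<in> constr_moments C (Suc n)" "0 < \<eta>"
    "\<And>y. y \<in> extensional {1..Suc n} \<Longrightarrow> (\<And>j. j \<in> {1..Suc n} \<Longrightarrow> \<bar>y j - z j\<bar> \<le> \<eta>) \<Longrightarrow> y \<in> moments (Suc n)"
    using admissible_box[OF C adm, of "Suc n"] n by (metis le_SucI)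
  have zm: "z \<in> moments (Suc n)" using z(1) n by (simp add: constr_moment_space_iff[OF C])
  define x where "x = restrict z {1..n}"
  have xC: "x \<in> constr_moments C n"
    using z(1) n unit_moments_restrict[OF zm, of n] dom_subset_top_index[OF C n]
    by (auto simp: constr_moment_space_iff[OF C] x_def subset_iff)
  have t1: "z (Suc n) \<in> next_moments n x" unfolding x_def by (rule unit_moments_Suc_next[OF zm])
  have "x(Suc n := z (Suc n) + \<eta>) \<in> moments (Suc n)"
  proof (rule z(3))
    show "x(Suc n := z (Suc n) + \<eta>) \<in> extensional {1..Suc n}" by (auto simp: x_def extensional_def)
    show "\<bar>(x(Suc n := z (Suc n) + \<eta>)) j - z j\<bar> \<le> \<eta>" if "j \<in> {1..Suc n}" for j
      using that z(2) by (auto simp: x_def)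
  qed
  then have "z (Suc n) + \<eta> \<in> next_moments n x" by (simp add: next_moments_def)
  from next_moments_diff_le_width[OF t1 this] z(2) have "0 < width n x" by simp
  then show ?thesis using xC by blast
qed

section \<open>Topology and Borel sets of the vector spaces\<close>

lemma restrict_continuous_map: "continuous_map euclidean (real_space n) (\<lambda>x. restrict x {1..n})"
  unfolding real_space_def
proof (rule continuous_map_coordinatewise_then_product)
  fix i assume "i \<in> {1..n}"
  then have "(\<lambda>x. restrict x {1..n} i) = (\<lambda>x::nat \<Rightarrow> real. x i)" by auto
  moreover have "continuous_map euclidean euclideanreal (\<lambda>x::nat \<Rightarrow> real. x i)"
    by (auto intro!: continuous_intros)
  ultimately show "continuous_map euclidean euclideanreal (\<lambda>x::nat \<Rightarrow> real. restrict x {1..n} i)" by metis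
qed auto

text \<open>Extensional vectors are constant outside \<open>{1..n}\<close>, so convergence of the
  first \<open>n\<close> coordinates is convergence in the full function space, where sequential
  compactness is compactness by metrisability. Restriction carries compactness over.\<close>

lemma compactin_real_space_sequential:
  fixes S :: "(nat \<Rightarrow> real) set"
  assumes ext: "S \<subseteq> extensional {1..n}"
    and seq: "\<And>X. (\<And>k::nat. X k \<in> S) \<Longrightarrow> \<exists>r x. strict_mono r \<and> x \<in> S \<and> (\<forall>j\<in>{1..n}. (\<lambda>i. X (r i) j) \<longlonglongrightarrow> x j)"
  shows "compactin (real_space n) S"
proof -
  have "seq_compact S"
    unfolding seq_compact_def
  proof (intro allI impI)
    fix X :: "nat \<Rightarrow> nat \<Rightarrow> real" assume X: "\<forall>k. X k \<in> S"
    then obtain r x where r: "strict_mono r" "x \<in> S" "\<And>j. j \<in> {1..n} \<Longrightarrow> (\<lambda>i. X (r i) j) \<longlonglongrightarrow> x j"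
      using seq[of X] by blast
    have "(\<lambda>i. X (r i) j) \<longlonglongrightarrow> x j" for j
    proof (cases "j \<in> {1..n}")
      case False
      then have "X k j = undefined" "x j = undefined" for k using X r(2) ext by (auto simp: extensional_def)
      then show ?thesis by simp
    qed (rule r(3))
    then have "limitin (product_topology (\<lambda>_. euclideanreal) UNIV) (X \<circ> r) x sequentially"
      by (subst limitin_componentwise) auto
    then have "(X \<circ> r) \<longlonglongrightarrow> x" by (simp add: euclidean_product_topology)
    then show "\<exists>l\<in>S. \<exists>r. strict_mono r \<and> (X \<circ> r) \<longlonglongrightarrow> l" using r by blast
  qed
  then have "compactin euclidean S" by (simp add: compact_eq_seq_compact_metric)
  then have "compactin (real_space n) ((\<lambda>x. restrict x {1..n}) ` S)"
    by (rule image_compactin[OF _ restrict_continuous_map])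
  moreover have "(\<lambda>x. restrict x {1..n}) ` S = S"
    using ext extensional_restrict by (force simp: image_iff subset_iff)
  ultimately show ?thesis by simp
qed

lemma compactin_real_space_closedin: "compactin (real_space n) S \<Longrightarrow> closedin (real_space n) S"
  by (rule compactin_imp_closedin) (auto simp: real_space_def Hausdorff_space_product_topology)

lemma topspace_real_space: "topspace (real_space n) = extensional {1..n}"
  by (auto simp: real_space_def PiE_def)

lemma sets_borel_of: "sets (borel_of X) = sigma_sets (topspace X) {U. openin X U}"
  unfolding borel_of_def by (rule sets_measure_of) (auto dest: openin_subset)

lemma space_borel_of: "space (borel_of X) = topspace X"
  unfolding borel_of_def by (rule space_measure_of) (auto dest: openin_subset)

text \<open>For open sets the countable product over all naturals is used, whose product
  \<sigma>-algebra is Borel; the converse needs only the coordinate maps.\<close>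

lemma sets_borel_of_real_space:
  "sets (borel_of (real_space n)) = sets (real_borel n)"
proof
  have "U \<in> sets (real_borel n)" if U: "openin (real_space n) U" for U
  proof -
    have "openin euclidean {x \<in> topspace euclidean. restrict x {1..n} \<in> U}"
      using restrict_continuous_map U unfolding continuous_map_def by blast
    then have "{x. restrict x {1..n} \<in> U} \<in> sets (PiM UNIV (\<lambda>_::nat. borel :: real measure))"
      unfolding sets_PiM_equal_borel by simp
    moreover have "(\<lambda>x. x) \<in> measurable (real_borel n) (PiM UNIV (\<lambda>_::nat. borel :: real measure))"
    proof (rule measurable_PiM_single')
      fix i :: nat
      show "(\<lambda>x. x i) \<in> borel_measurable (real_borel n)"
      proof (cases "i \<in> {1..n}")
        case False
        then have "(\<lambda>x. x i) \<in> borel_measurable (real_borel n) \<longleftrightarrow>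
           (\<lambda>x. undefined :: real) \<in> borel_measurable (real_borel n)"
          by (intro measurable_cong) (auto simp: space_PiM PiE_def extensional_def)
        then show ?thesis by simp
      qed (rule measurable_component_singleton)
    qed auto
    ultimately have "(\<lambda>x. x) -` {x. restrict x {1..n} \<in> U} \<inter> space (real_borel n) \<in> sets (real_borel n)"
      by (rule measurable_sets[rotated])
    moreover have "(\<lambda>x. x) -` {x. restrict x {1..n} \<in> U} \<inter> space (real_borel n) = U"
      using openin_subset[OF U] unfolding topspace_real_space
      by (auto simp: space_PiM PiE_def extensional_restrict subset_iff)
    ultimately show ?thesis by simp
  qed
  moreover have "topspace (real_space n) = space (real_borel n)"
    by (simp add: topspace_real_space space_PiM PiE_def)
  ultimately show "sets (borel_of (real_space n)) \<subseteq> sets (real_borel n)"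
    unfolding sets_borel_of by (metis (no_types, lifting) mem_Collect_eq sets.sigma_sets_subset subsetI)
  have coord: "(\<lambda>x. x i) \<in> borel_measurable (borel_of (real_space n))" if i: "i \<in> {1..n}" for i
  proof (rule borel_measurableI)
    fix S :: "real set" assume S: "open S"
    have "continuous_map (real_space n) euclideanreal (\<lambda>x. x i)"
      unfolding real_space_def using i by (rule continuous_map_product_projection)
    then have "openin (real_space n) {x \<in> topspace (real_space n). x i \<in> S}"
      using S unfolding continuous_map_def by auto
    moreover have "{x \<in> topspace (real_space n). x i \<in> S} = (\<lambda>x. x i) -` S \<inter> space (borel_of (real_space n))"
      by (auto simp: space_borel_of)
    ultimately show "(\<lambda>x. x i) -` S \<inter> space (borel_of (real_space n)) \<in> sets (borel_of (real_space n))"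
      unfolding sets_borel_of by auto
  qed
  have "(\<lambda>x. x) \<in> measurable (borel_of (real_space n)) (real_borel n)"
    using coord by (intro measurable_PiM_single') (auto simp: space_borel_of topspace_real_space PiE_def)
  then have "A \<in> sets (borel_of (real_space n))" if "A \<in> sets (real_borel n)" for A
  proof -
    have "(\<lambda>x. x) -` A \<inter> space (borel_of (real_space n)) = A"
      using sets.sets_into_space[OF that] by (auto simp: space_borel_of topspace_real_space space_PiM PiE_def)
    then show ?thesis using measurable_sets[OF \<open>(\<lambda>x. x) \<in> _\<close> that] by simp
  qed
  then show "sets (real_borel n) \<subseteq> sets (borel_of (real_space n))" by blast
qed

lemma closedin_real_space_sets:
  assumes "closedin (real_space n) S" shows "S \<in> sets (real_borel n)"
proof -
  have "topspace (real_space n) - S \<in> sets (borel_of (real_space n))"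
    using assms unfolding sets_borel_of closedin_def by auto
  then have "space (borel_of (real_space n)) - (topspace (real_space n) - S) \<in> sets (borel_of (real_space n))"
    by (rule sets.compl_sets)
  moreover have "space (borel_of (real_space n)) - (topspace (real_space n) - S) = S"
    using closedin_subset[OF assms] by (auto simp: space_borel_of)
  ultimately show ?thesis unfolding sets_borel_of_real_space by simp
qed

text \<open>These sets are, up to rescaling the level, the sublevel sets of the rate function. Their
  compactness also yields measurability of the width and, for \<open>a = 0\<close>, of the
  constrained moment space.\<close>

lemma compactin_width_ge:
  assumes C: "is_constraint C" "top_index C \<le> n"
  shows "compactin (real_space n) {x \<in> constr_moments C n. a \<le> width n x}"
proof (rule compactin_real_space_sequential)
  have K: "y \<in> moments n" if "y \<in> constr_moments C n" for y using that by (simp add: constr_moment_space_iff[OF C])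
  then show "{x \<in> constr_moments C n. a \<le> width n x} \<subseteq> extensional {1..n}"
    using unit_moments_extensional by blast
  fix X :: "nat \<Rightarrow> nat \<Rightarrow> real" assume X: "\<And>k. X k \<in> {x \<in> constr_moments C n. a \<le> width n x}"
  then have X': "\<And>k. X k \<in> constr_moments C n" "\<And>k. a \<le> width n (X k)" by auto
  obtain r x where r: "strict_mono r" and x: "x \<in> moments n" "\<And>j. j \<in> {1..n} \<Longrightarrow> (\<lambda>i. X (r i) j) \<longlonglongrightarrow> x j"
    by (rule unit_moments_seq_compact[of X n, OF K[OF X'(1)]]) blast
  have "x \<in> constr_moments C n"
    by (rule constr_moment_space_seq_closed[OF C X'(1) x])
  moreover have "a \<le> width n x"
    using width_usc[of "\<lambda>i. X (r i)" n x a, OF K[OF X'(1)] unit_moments_extensional[OF x(1)] x(2) X'(2)] by blast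
  ultimately show "\<exists>r x. strict_mono r \<and> x \<in> {x \<in> constr_moments C n. a \<le> width n x} \<and> (\<forall>j\<in>{1..n}. (\<lambda>i. X (r i) j) \<longlonglongrightarrow> x j)"
    using r x(2) by blast
qed

lemma constr_moment_space_sets:
  assumes C: "is_constraint C" "top_index C \<le> n"
  shows "constr_moments C n \<in> sets (real_borel n)"
proof -
  have "{x \<in> constr_moments C n. 0 \<le> width n x} = constr_moments C n"
    using width_nonneg constr_moment_space_iff[OF C] by blast
  then show ?thesis
    using closedin_real_space_sets[OF compactin_real_space_closedin[OF compactin_width_ge[OF C, of 0]]] by simp
qed

text \<open>The guard matters: an extensional vector outside the moment space has an empty fibre, on
  which \<open>width\<close> carries no meaning.\<close>

lemma width_measurable:
  assumes C: "is_constraint C" "top_index C \<le> n"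
  shows "(\<lambda>x. if x \<in> constr_moments C n then width n x else 0) \<in> borel_measurable (real_borel n)"
proof (rule borel_measurable_iff_ge[THEN iffD2], rule allI)
  fix a
  let ?M = "real_borel n" and ?K = "constr_moments C n"
  show "{x \<in> space ?M. a \<le> (if x \<in> ?K then width n x else 0)} \<in> sets ?M"
  proof (cases "a \<le> 0")
    case True
    then have "{x \<in> space ?M. a \<le> (if x \<in> ?K then width n x else 0)} = space ?M"
      using width_nonneg by (force simp: constr_moment_space_iff[OF C])
    then show ?thesis by simp
  next
    case False
    then have "{x \<in> space ?M. a \<le> (if x \<in> ?K then width n x else 0)} = {x \<in> ?K. a \<le> width n x}"
      using sets.sets_into_space[OF constr_moment_space_sets[OF C]] by auto
    then show ?thesis
      using closedin_real_space_sets[OF compactin_real_space_closedin[OF compactin_width_ge[OF C]]] by simp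
  qed
qed

section \<open>Volume of the fibres\<close>

abbreviation free_measure :: "constr \<Rightarrow> nat \<Rightarrow> (nat \<Rightarrow> real) measure" where
  "free_measure C n \<equiv> PiM (free_indices C n) (\<lambda>_. lborel)"

lemma finite_free_indices [simp]: "finite (free_indices C n)"
  by (simp add: free_indices_def)

lemma space_free_measure: "space (free_measure C n) = extensional (free_indices C n)"
  by (simp add: space_PiM PiE_def)

lemma insert_constr_apply:
  "insert_constr C n y j = (if j \<in> {1..n} then case C j of None \<Rightarrow> y j | Some c \<Rightarrow> c else undefined)"
  by (simp add: insert_constr_def)

lemma insert_constr_extensional: "insert_constr C n y \<in> extensional {1..n}"
  by (simp add: insert_constr_def)

lemma insert_constr_free: "j \<in> free_indices C n \<Longrightarrow> insert_constr C n y j = y j"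
  by (auto simp: free_indices_def insert_constr_apply split: option.splits)

lemma insert_constr_restrict:
  assumes "x \<in> extensional {1..n}" "\<forall>i\<in>dom C. C i = Some (x i)"
  shows "insert_constr C n (restrict x (free_indices C n)) = x"
proof
  fix j
  show "insert_constr C n (restrict x (free_indices C n)) j = x j"
  proof (cases "C j")
    case None
    then show ?thesis using assms(1) by (auto simp: insert_constr_apply free_indices_def extensional_def)
  next
    case (Some c)
    then have "x j = c" using assms(2) by force
    then show ?thesis using assms(1) Some by (auto simp: insert_constr_apply extensional_def)
  qed
qed

text \<open>This presents the projection as a preimage under \<open>insert_constr\<close>, from
  which its measurability follows.\<close>

lemma free_projection_iff:
  assumes C: "is_constraint C" "top_index C \<le> n"
  shows "y \<in> free_projection C n \<longleftrightarrow>
    y \<in> extensional (free_indices C n) \<and> insert_constr C n y \<in> constr_moments C n"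
proof
  assume "y \<in> free_projection C n"
  then obtain x where x: "x \<in> constr_moments C n" "y = restrict x (free_indices C n)"
    by (auto simp: free_projection_def)
  then have "insert_constr C n y = x"
    unfolding x(2) using unit_moments_extensional by (intro insert_constr_restrict) (auto simp: constr_moment_space_iff[OF C])
  then show "y \<in> extensional (free_indices C n) \<and> insert_constr C n y \<in> constr_moments C n"
    using x by auto
next
  assume y: "y \<in> extensional (free_indices C n) \<and> insert_constr C n y \<in> constr_moments C n"
  have "y = restrict (insert_constr C n y) (free_indices C n)"
    using y insert_constr_free[of _ C n y] by (auto simp: fun_eq_iff restrict_def extensional_def)
  then show "y \<in> free_projection C n" using y unfolding free_projection_def by blast
qed

lemma insert_constr_measurable [measurable]:
  "insert_constr C n \<in> measurable (free_measure C n) (real_borel n)"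
proof (rule measurable_PiM_single')
  fix i assume i: "i \<in> {1..n}"
  show "(\<lambda>y. insert_constr C n y i) \<in> borel_measurable (free_measure C n)"
  proof (cases "C i")
    case None
    then have "i \<in> free_indices C n" using i by (auto simp: free_indices_def)
    then have "(\<lambda>y. y i) \<in> borel_measurable (free_measure C n)"
      using measurable_component_singleton[of i "free_indices C n" "\<lambda>_. lborel :: real measure"] by simp
    then show ?thesis using None i by (simp add: insert_constr_apply)
  qed (use i in \<open>simp add: insert_constr_apply\<close>)
qed (auto simp: insert_constr_def)

lemma free_projection_sets:
  assumes C: "is_constraint C" "top_index C \<le> n"
  shows "free_projection C n \<in> sets (free_measure C n)"
proof -
  have "free_projection C n = insert_constr C n -` constr_moments C n \<inter> space (free_measure C n)"
    by (auto simp: free_projection_iff[OF C] space_free_measure)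
  then show ?thesis
    using measurable_sets[OF insert_constr_measurable constr_moment_space_sets[OF C]] by simp
qed

lemma emeasure_free_box:
  assumes "\<And>j. j \<in> free_indices C n \<Longrightarrow> a j \<le> b j"
  shows "emeasure (free_measure C n) (\<Pi>\<^sub>E j\<in>free_indices C n. {a j..b j}) = ennreal (\<Prod>j\<in>free_indices C n. b j - a j)"
proof -
  interpret product_sigma_finite "\<lambda>_::nat. lborel :: real measure" by standard
  have "emeasure (free_measure C n) (\<Pi>\<^sub>E j\<in>free_indices C n. {a j..b j}) = (\<Prod>j\<in>free_indices C n. emeasure lborel {a j..b j})"
    by (rule emeasure_PiM) auto
  also have "\<dots> = (\<Prod>j\<in>free_indices C n. ennreal (b j - a j))"
    using assms by (intro prod.cong) auto
  also have "\<dots> = ennreal (\<Prod>j\<in>free_indices C n. b j - a j)"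
    using assms by (intro prod_ennreal) auto
  finally show ?thesis .
qed

lemma emeasure_free_projection_le:
  assumes C: "is_constraint C" "top_index C \<le> n"
  shows "emeasure (free_measure C n) (free_projection C n) \<le> 1"
proof -
  have "free_projection C n \<subseteq> (\<Pi>\<^sub>E j\<in>free_indices C n. {0..1})"
  proof
    fix y assume "y \<in> free_projection C n"
    then have y: "y \<in> extensional (free_indices C n)" "insert_constr C n y \<in> moments n"
      by (auto simp: free_projection_iff[OF C] constr_moment_space_iff[OF C])
    have "y j \<in> {0..1}" if "j \<in> free_indices C n" for j
      using unit_moments_unit[OF y(2), of j] insert_constr_free[OF that, of y] that by (auto simp: free_indices_def)
    then show "y \<in> (\<Pi>\<^sub>E j\<in>free_indices C n. {0..1})" using y(1) by (auto simp: PiE_iff)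
  qed
  then have "emeasure (free_measure C n) (free_projection C n) \<le> emeasure (free_measure C n) (\<Pi>\<^sub>E j\<in>free_indices C n. {0..1})"
    by (rule emeasure_mono) (auto intro!: sets_PiM_I_finite)
  also have "\<dots> = 1" using emeasure_free_box[of C n "\<lambda>_. 0" "\<lambda>_. 1"] by simp
  finally show ?thesis .
qed

text \<open>The box of \<open>admissible_box\<close> shrunk towards a given point \<open>x\<close>; concavity of the width costs only a factor \<open>1 - t\<close>.\<close>

lemma shrunk_box:
  assumes C: "is_constraint C" and adm: "admissible C {0..1}" and n: "top_index C \<le> n"
  obtains \<eta> where "0 < \<eta>"
    "\<And>x t. x \<in> constr_moments C n \<Longrightarrow> 0 < t \<Longrightarrow> t \<le> 1 \<Longrightarrow>
      \<exists>B\<in>sets (free_measure C n). ennreal ((2 * t * \<eta>) ^ card (free_indices C n)) = emeasure (free_measure C n) B \<and>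
        (\<forall>y\<in>B. y \<in> free_projection C n \<and> (1 - t) * width n x \<le> width n (insert_constr C n y) \<and>
          (\<forall>j\<in>{1..n}. \<bar>insert_constr C n y j - x j\<bar> \<le> t * (1 + \<eta>)))"
proof -
  obtain z \<eta> where z: "z \<in> constr_moments C n" and \<eta>: "0 < \<eta>" and box:
    "\<And>y. y \<in> extensional {1..n} \<Longrightarrow> (\<And>j. j \<in> {1..n} \<Longrightarrow> \<bar>y j - z j\<bar> \<le> \<eta>) \<Longrightarrow> y \<in> moments n"
    using admissible_box[OF C adm n] by blast
  note Cn = constr_moment_space_iff[OF C n]
  show ?thesis
  proof (rule that[OF \<eta>])
    fix x t assume x: "x \<in> constr_moments C n" and t: "0 < t" "t \<le> (1::real)"
    define a b where "a j = (1 - t) * x j + t * (z j - \<eta>)" and "b j = (1 - t) * x j + t * (z j + \<eta>)" for j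
    have ab: "b j - a j = 2 * t * \<eta>" for j by (simp add: a_def b_def algebra_simps)
    define B where "B = (\<Pi>\<^sub>E j\<in>free_indices C n. {a j..b j})"
    have "emeasure (free_measure C n) B = ennreal (\<Prod>j\<in>free_indices C n. b j - a j)"
      unfolding B_def
    proof (rule emeasure_free_box)
      show "a j \<le> b j" for j
      proof -
        have "0 \<le> 2 * t * \<eta>" using t \<eta> by simp
        then show ?thesis using ab[of j] by linarith
      qed
    qed
    then have eB: "emeasure (free_measure C n) B = ennreal ((2 * t * \<eta>) ^ card (free_indices C n))"
      by (simp only: ab prod_constant)
    have "y \<in> free_projection C n \<and> (1 - t) * width n x \<le> width n (insert_constr C n y) \<and>
          (\<forall>j\<in>{1..n}. \<bar>insert_constr C n y j - x j\<bar> \<le> t * (1 + \<eta>))" if y: "y \<in> B" for y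
    proof -
      \<comment> \<open>The point of the original box with y = (1 - t) x + t y'; on constrained
        coordinates \<open>x\<close> and \<open>y'\<close> both carry the prescribed value.\<close>
      define y' where "y' = insert_constr C n (\<lambda>j. (y j - (1 - t) * x j) / t)"
      have near: "\<bar>y' j - z j\<bar> \<le> \<eta>" if j: "j \<in> {1..n}" for j
      proof (cases "C j")
        case None
        then have "j \<in> free_indices C n" using j by (auto simp: free_indices_def)
        then have "a j \<le> y j" "y j \<le> b j" using y by (auto simp: B_def PiE_iff)
        then have "t * (z j - \<eta>) \<le> y j - (1 - t) * x j" "y j - (1 - t) * x j \<le> t * (z j + \<eta>)"
          by (simp_all add: a_def b_def)
        then have "z j - \<eta> \<le> (y j - (1 - t) * x j) / t" "(y j - (1 - t) * x j) / t \<le> z j + \<eta>"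
          using t by (simp_all add: field_simps)
        then show ?thesis using j None by (simp add: y'_def insert_constr_apply abs_le_iff)
      next
        case (Some c)
        then have "z j = c" using z j unfolding Cn by force
        then show ?thesis using j Some \<eta> by (simp add: y'_def insert_constr_apply)
      qed
      have y'm: "y' \<in> moments n" by (intro box near) (simp add: y'_def insert_constr_def)
      have y'C: "y' \<in> constr_moments C n"
        using y'm dom_subset_top_index[OF C n] by (auto simp: Cn y'_def insert_constr_apply split: option.splits)
      have xm: "x \<in> moments n" using x by (simp add: Cn)
      have eq: "insert_constr C n y = mix n t x y'"
      proof
        fix j
        show "insert_constr C n y j = mix n t x y' j"
        proof (cases "C j")
          case None
          then show ?thesis using t by (auto simp: insert_constr_apply mix_def y'_def)
        next
          case (Some c)
          then have "x j = c" using x unfolding Cn by force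
          then show ?thesis using Some by (auto simp: insert_constr_apply mix_def y'_def algebra_simps)
        qed
      qed
      have "insert_constr C n y \<in> constr_moments C n"
        unfolding eq using t by (intro constr_moment_space_mix[OF C n x y'C]) auto
      then have "y \<in> free_projection C n"
        using y by (auto simp: free_projection_iff[OF C n] B_def PiE_def)
      moreover have "(1 - t) * width n x \<le> width n (insert_constr C n y)"
        using width_mix[OF xm y'm, of t] width_nonneg[OF y'm] t mult_nonneg_nonneg[of t "width n y'"] unfolding eq by linarith
      moreover have "\<bar>insert_constr C n y j - x j\<bar> \<le> t * (1 + \<eta>)" if j: "j \<in> {1..n}" for j
      proof -
        have "insert_constr C n y j - x j = t * (y' j - x j)" unfolding eq using j by (simp add: mix_def algebra_simps)
        moreover have "\<bar>y' j - x j\<bar> \<le> 1 + \<eta>"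
          using unit_moments_unit[OF xm j] unit_moments_unit[OF y'm j] \<eta> by auto
        ultimately show ?thesis using t by (simp add: abs_mult mult_left_mono)
      qed
      ultimately show ?thesis by blast
    qed
    moreover have "B \<in> sets (free_measure C n)" unfolding B_def by (auto intro!: sets_PiM_I_finite)
    ultimately show "\<exists>B\<in>sets (free_measure C n). ennreal ((2 * t * \<eta>) ^ card (free_indices C n)) = emeasure (free_measure C n) B \<and>
        (\<forall>y\<in>B. y \<in> free_projection C n \<and> (1 - t) * width n x \<le> width n (insert_constr C n y) \<and>
          (\<forall>j\<in>{1..n}. \<bar>insert_constr C n y j - x j\<bar> \<le> t * (1 + \<eta>)))"
      using eB by metis
  qed
qed

lemma emeasure_free_projection_pos:
  assumes C: "is_constraint C" and adm: "admissible C {0..1}" and n: "top_index C \<le> n"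
  shows "0 < emeasure (free_measure C n) (free_projection C n)"
proof -
  obtain x where x: "x \<in> constr_moments C n" using exists_positive_width[OF C adm n] by blast
  obtain \<eta> B where \<eta>: "0 < \<eta>" and B: "B \<in> sets (free_measure C n)"
    "ennreal ((2 * 1 * \<eta>) ^ card (free_indices C n)) = emeasure (free_measure C n) B" "B \<subseteq> free_projection C n"
    using shrunk_box[OF C adm n] x by (metis (no_types, lifting) less_numeral_extra(1) order_refl subsetI)
  have "0 < emeasure (free_measure C n) B" unfolding B(2)[symmetric] using \<eta> by simp
  then show ?thesis using emeasure_mono[OF B(3) free_projection_sets[OF C n]] by (rule less_le_trans)
qed

section \<open>Integration along the fibres and the law of the first moments\<close>

text \<open>This is the Beta value B(k + 1, k + 1). It cancels in the normalised law, so only its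
  positivity and finiteness matter.\<close>

definition beta_factor :: "nat \<Rightarrow> ennreal" where
  "beta_factor k = (\<integral>\<^sup>+p. indicator {0<..<1} p * ennreal (p * (1 - p)) ^ k \<partial>lborel)"

lemma beta_factor_pos: "0 < beta_factor k" and beta_factor_finite: "beta_factor k < \<infinity>"
proof -
  \<comment> \<open>On [1/4, 3/4], an interval of length 1/2, p (1 - p) is at least 3/16.\<close>
  have "0 < ennreal ((3/16) ^ k * (1/2))" unfolding ennreal_less_zero_iff by simp
  then have "0 < ennreal (3/16) ^ k * ennreal (1/2)" by (subst (asm) ennreal_mult) (simp_all add: ennreal_power)
  also have "\<dots> = (\<integral>\<^sup>+p. ennreal (3/16) ^ k * indicator {1/4..3/4::real} p \<partial>lborel)"
    by (subst nn_integral_cmult_indicator) auto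
  also have "\<dots> \<le> beta_factor k"
    unfolding beta_factor_def
  proof (rule nn_integral_mono)
    fix p :: real
    show "ennreal (3/16) ^ k * indicator {1/4..3/4} p \<le> indicator {0<..<1} p * ennreal (p * (1 - p)) ^ k"
    proof (cases "p \<in> {1/4..3/4}")
      case True
      have "0 \<le> (p - 1/4) * (3/4 - p)" using True by (intro mult_nonneg_nonneg) auto
      moreover have "(p - 1/4) * (3/4 - p) = p * (1 - p) - 3/16" by (simp add: field_simps)
      ultimately have "3/16 \<le> p * (1 - p)" by linarith
      then show ?thesis using True by (auto simp: indicator_def intro!: power_mono ennreal_leI)
    qed simp
  qed
  finally show "0 < beta_factor k" .
  have "beta_factor k \<le> (\<integral>\<^sup>+p. indicator {0<..<1::real} p \<partial>lborel)"
    unfolding beta_factor_def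
  proof (rule nn_integral_mono)
    fix p :: real
    have "ennreal (p * (1 - p)) ^ k \<le> 1" if "p \<in> {0<..<1}"
      using that mult_le_one[of p "1 - p"] by (intro power_le_one) (auto simp: ennreal_le_1)
    then show "indicator {0<..<1} p * ennreal (p * (1 - p)) ^ k \<le> indicator {0<..<1} p"
      by (auto simp: indicator_def)
  qed
  also have "\<dots> = 1" by simp
  finally show "beta_factor k < \<infinity>" by (auto simp: less_top dest: neq_top_trans[rotated])
qed

text \<open>With t = t1 + W p the next width is W p (1 - p), and dt contributes one further factor
  W; hence the exponent rises by one. The end points of the fibre are a null set, and for W = 0 both
  sides vanish.\<close>

lemma nn_integral_next_width:
  assumes x: "x \<in> moments n"
  shows "(\<integral>\<^sup>+t. indicator (next_moments n x) t * ennreal (width (Suc n) (x(Suc n := t))) ^ k \<partial>lborel) =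
    beta_factor k * ennreal (width n x) ^ Suc k"
proof -
  obtain t1 t2 where t: "t1 \<le> t2" "next_moments n x = {t1..t2}" "width n x = t2 - t1"
    using next_moments_interval[OF x] .
  define W where "W = width n x"
  have "(\<integral>\<^sup>+t. indicator (next_moments n x) t * ennreal (width (Suc n) (x(Suc n := t))) ^ k \<partial>lborel) =
    (\<integral>\<^sup>+t. indicator {t1<..<t2} t * ennreal ((t - t1) * (t2 - t) / W) ^ k \<partial>lborel)"
  proof (rule nn_integral_cong_AE, rule AE_I[where N = "{t1, t2}"])
    show "{t \<in> space lborel. indicator (next_moments n x) t * ennreal (width (Suc n) (x(Suc n := t))) ^ k \<noteq>
        indicator {t1<..<t2} t * ennreal ((t - t1) * (t2 - t) / W) ^ k} \<subseteq> {t1, t2}"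
      using width_next[OF x _ _ t(2)] t by (auto simp: indicator_def W_def)
  qed (auto intro!: emeasure_lborel_countable)
  also have "\<dots> = beta_factor k * ennreal W ^ Suc k"
  proof (cases "W = 0")
    case True
    then have "{t1<..<t2} = {}" using t by (simp add: W_def)
    then show ?thesis using True by simp
  next
    case False
    then have W: "0 < W" using t by (simp add: W_def)
    have "(\<integral>\<^sup>+t. indicator {t1<..<t2} t * ennreal ((t - t1) * (t2 - t) / W) ^ k \<partial>lborel) =
      ennreal W * (\<integral>\<^sup>+p. indicator {t1<..<t2} (t1 + W * p) * ennreal ((t1 + W * p - t1) * (t2 - (t1 + W * p)) / W) ^ k \<partial>lborel)"
      using nn_integral_real_affine[of "\<lambda>t. indicator {t1<..<t2} t * ennreal ((t - t1) * (t2 - t) / W) ^ k" W t1] W by simp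
    also have "(\<integral>\<^sup>+p. indicator {t1<..<t2} (t1 + W * p) * ennreal ((t1 + W * p - t1) * (t2 - (t1 + W * p)) / W) ^ k \<partial>lborel) =
      (\<integral>\<^sup>+p. ennreal W ^ k * (indicator {0<..<1} p * ennreal (p * (1 - p)) ^ k) \<partial>lborel)"
    proof (rule nn_integral_cong)
      fix p :: real
      have t2: "t2 = t1 + W" using t by (simp add: W_def)
      have ind: "t1 + W * p \<in> {t1<..<t2} \<longleftrightarrow> p \<in> {0<..<1}" using W by (auto simp: t2 zero_less_mult_iff)
      have e: "ennreal ((t1 + W * p - t1) * (t2 - (t1 + W * p)) / W) = ennreal W * ennreal (p * (1 - p))"
      proof -
        have "(t1 + W * p - t1) * (t2 - (t1 + W * p)) / W = W * (p * (1 - p))"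
          using W by (simp add: t2 field_simps)
        then show ?thesis using W by (simp only: ennreal_mult' less_imp_le)
      qed
      have i: "indicator {t1<..<t2} (t1 + W * p) = (indicator {0<..<1} p :: ennreal)"
        using ind unfolding indicator_def by simp
      show "indicator {t1<..<t2} (t1 + W * p) * ennreal ((t1 + W * p - t1) * (t2 - (t1 + W * p)) / W) ^ k =
        ennreal W ^ k * (indicator {0<..<1} p * ennreal (p * (1 - p)) ^ k)"
        unfolding e i power_mult_distrib by (simp only: mult_ac)
    qed
    also have "\<dots> = ennreal W ^ k * beta_factor k"
      unfolding beta_factor_def by (rule nn_integral_cmult) auto
    finally show ?thesis by (simp add: mult_ac)
  qed
  finally show ?thesis by (simp add: W_def)
qed

abbreviation weight :: "constr \<Rightarrow> nat \<Rightarrow> nat \<Rightarrow> nat \<Rightarrow> (nat \<Rightarrow> real) set \<Rightarrow> (nat \<Rightarrow> real) \<Rightarrow> ennreal" where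
  "weight C l n k A y \<equiv> indicator (free_projection C n) y *
     indicator A (restrict (insert_constr C n y) {1..l}) * ennreal (width n (insert_constr C n y)) ^ k"

text \<open>Exponent 0 at level \<open>n\<close> is plain volume over \<open>A\<close>. Each fibre
  integration trades one coordinate for one power of the width, so level \<open>n\<close> with
  exponent 0 becomes level \<open>l\<close> with exponent \<open>n - l\<close>.\<close>

definition weight_integral :: "constr \<Rightarrow> nat \<Rightarrow> nat \<Rightarrow> nat \<Rightarrow> (nat \<Rightarrow> real) set \<Rightarrow> ennreal" where
  "weight_integral C l n k A = (\<integral>\<^sup>+y. weight C l n k A y \<partial>free_measure C n)"

lemma weight_measurable:
  assumes C: "is_constraint C" "top_index C \<le> n" and l: "l \<le> n" and A: "A \<in> sets (real_borel l)"
  shows "weight C l n k A \<in> borel_measurable (free_measure C n)"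
proof -
  let ?f = "\<lambda>x. if x \<in> constr_moments C n then width n x else 0"
  note [measurable] = free_projection_sets[OF C] A width_measurable[OF C]
  have [measurable]: "(\<lambda>x. restrict x {1..l}) \<in> measurable (real_borel n) (real_borel l)"
    using l by (intro measurable_restrict_subset) auto
  have "(\<lambda>y. indicator (free_projection C n) y * indicator A (restrict (insert_constr C n y) {1..l}) *
     ennreal (?f (insert_constr C n y)) ^ k) \<in> borel_measurable (free_measure C n)" (is "?g \<in> _")
    by measurable
  also have "?g = (\<lambda>y. weight C l n k A y)"
    using free_projection_iff[OF C] by (auto simp: fun_eq_iff indicator_def)
  finally show ?thesis .
qed

text \<open>Fubini in the last coordinate. It is free because all constraints have order at most
  \<open>l\<close>, and the condition given by \<open>A\<close> does not involve it.\<close>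

lemma weight_integral_Suc:
  assumes C: "is_constraint C" "top_index C \<le> l" and l: "l \<le> n" and A: "A \<in> sets (real_borel l)"
  shows "weight_integral C l (Suc n) k A = beta_factor k * weight_integral C l n (Suc k) A"
proof -
  interpret product_sigma_finite "\<lambda>_::nat. lborel :: real measure" by standard
  have tn: "top_index C \<le> n" "top_index C \<le> Suc n" "l \<le> Suc n" using C l by auto
  have Sn: "Suc n \<notin> dom C" using dom_subset_top_index[OF C(1) tn(1)] by auto
  have free: "free_indices C (Suc n) = insert (Suc n) (free_indices C n)" "Suc n \<notin> free_indices C n"
    using Sn by (auto simp: free_indices_def)
  let ?g = "\<lambda>y. indicator A (restrict (insert_constr C n y) {1..l}) :: ennreal"
  let ?f = "weight C l (Suc n) k A"
  have step: "?f (y(Suc n := t)) = (indicator (free_projection C n) y * ?g y) *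
      (indicator (next_moments n (insert_constr C n y)) t * ennreal (width (Suc n) ((insert_constr C n y)(Suc n := t))) ^ k)"
    if y: "y \<in> space (free_measure C n)" for y t
  proof -
    have ye: "y \<in> extensional (free_indices C n)" using y by (simp add: space_free_measure)
    have ins: "insert_constr C (Suc n) (y(Suc n := t)) = (insert_constr C n y)(Suc n := t)"
      using Sn by (auto simp: fun_eq_iff insert_constr_apply le_Suc_eq split: option.splits)
    have res: "restrict ((insert_constr C n y)(Suc n := t)) {1..l} = restrict (insert_constr C n y) {1..l}"
      using l by (auto simp: fun_eq_iff restrict_def)
    have "y(Suc n := t) \<in> extensional (free_indices C (Suc n))" using ye free by (auto simp: extensional_def)
    then have "y(Suc n := t) \<in> free_projection C (Suc n) \<longleftrightarrow> (insert_constr C n y)(Suc n := t) \<in> constr_moments C (Suc n)"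
      unfolding free_projection_iff[OF C(1) tn(2)] ins by simp
    also have "\<dots> \<longleftrightarrow> y \<in> free_projection C n \<and> t \<in> next_moments n (insert_constr C n y)"
    proof
      assume a: "(insert_constr C n y)(Suc n := t) \<in> constr_moments C (Suc n)"
      then have m: "(insert_constr C n y)(Suc n := t) \<in> moments (Suc n)" by (simp add: constr_moment_space_iff[OF C(1) tn(2)])
      have "restrict ((insert_constr C n y)(Suc n := t)) {1..n} = insert_constr C n y"
        using insert_constr_extensional[of C n y] by (auto simp: fun_eq_iff restrict_def extensional_def)
      then have "insert_constr C n y \<in> moments n" using unit_moments_restrict[OF m, of n] by simp
      moreover have "C i = Some (insert_constr C n y i)" if "i \<in> dom C" for i
      proof -
        have "i \<noteq> Suc n" using that Sn by auto
        then show ?thesis using a that unfolding constr_moment_space_iff[OF C(1) tn(2)] by auto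
      qed
      ultimately show "y \<in> free_projection C n \<and> t \<in> next_moments n (insert_constr C n y)"
        using m ye by (simp add: free_projection_iff[OF C(1) tn(1)] constr_moment_space_iff[OF C(1) tn(1)] next_moments_def)
    next
      assume a: "y \<in> free_projection C n \<and> t \<in> next_moments n (insert_constr C n y)"
      then have "(insert_constr C n y)(Suc n := t) \<in> moments (Suc n)" by (simp add: next_moments_def)
      moreover have "C i = Some (((insert_constr C n y)(Suc n := t)) i)" if "i \<in> dom C" for i
      proof -
        have "i \<noteq> Suc n" using that Sn by auto
        then show ?thesis using a that unfolding free_projection_iff[OF C(1) tn(1)] constr_moment_space_iff[OF C(1) tn(1)] by auto
      qed
      ultimately show "(insert_constr C n y)(Suc n := t) \<in> constr_moments C (Suc n)"
        by (simp add: constr_moment_space_iff[OF C(1) tn(2)])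
    qed
    finally show ?thesis unfolding ins res by (auto simp: indicator_def)
  qed
  have "weight_integral C l (Suc n) k A = (\<integral>\<^sup>+y. (\<integral>\<^sup>+t. ?f (y(Suc n := t)) \<partial>lborel) \<partial>free_measure C n)"
    unfolding weight_integral_def free(1)
    using weight_measurable[OF C(1) tn(2,3) A, of k] free
    by (intro product_nn_integral_insert) auto
  also have "\<dots> = (\<integral>\<^sup>+y. beta_factor k * weight C l n (Suc k) A y \<partial>free_measure C n)"
  proof (rule nn_integral_cong)
    fix y assume y: "y \<in> space (free_measure C n)"
    show "(\<integral>\<^sup>+t. ?f (y(Suc n := t)) \<partial>lborel) = beta_factor k * weight C l n (Suc k) A y"
    proof (cases "y \<in> free_projection C n \<and> restrict (insert_constr C n y) {1..l} \<in> A")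
      case True
      then have m: "insert_constr C n y \<in> moments n"
        by (simp add: free_projection_iff[OF C(1) tn(1)] constr_moment_space_iff[OF C(1) tn(1)])
      show ?thesis unfolding step[OF y] using True nn_integral_next_width[OF m, of k] by simp
    next
      case False
      then have "indicator (free_projection C n) y * ?g y = 0" by (auto simp: indicator_def)
      then show ?thesis unfolding step[OF y] by (simp only: mult_zero_left mult_zero_right nn_integral_const)
    qed
  qed
  also have "\<dots> = beta_factor k * weight_integral C l n (Suc k) A"
    unfolding weight_integral_def
    by (rule nn_integral_cmult[OF weight_measurable[OF C(1) tn(1) l A]])
  finally show ?thesis .
qed

lemma weight_integral_reduce:
  assumes C: "is_constraint C" "top_index C \<le> l" and A: "A \<in> sets (real_borel l)"
  shows "weight_integral C l (l + m) k A = (\<Prod>i<m. beta_factor (k + i)) * weight_integral C l l (k + m) A"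
proof (induction m arbitrary: k)
  case (Suc m)
  have "(\<Prod>i<Suc m. beta_factor (k + i)) = beta_factor k * (\<Prod>i<m. beta_factor (Suc k + i))"
    by (subst prod.lessThan_Suc_shift) simp
  then show ?case using weight_integral_Suc[OF C _ A, of "l + m" k] Suc[of "Suc k"] by (simp add: mult_ac)
qed simp

lemma emeasure_first_moments_law:
  assumes C: "is_constraint C" and adm: "admissible C {0..1}" and l: "top_index C \<le> l" "l \<le> n"
  shows "prob_space (first_moments_law C l n)" "sets (first_moments_law C l n) = sets (real_borel l)"
    "A \<in> sets (real_borel l) \<Longrightarrow>
      emeasure (first_moments_law C l n) A = weight_integral C l l (n - l) A / weight_integral C l l (n - l) (space (real_borel l))"
proof -
  have tn: "top_index C \<le> n" using l by simp
  let ?L = "real_borel l" and ?N = "real_borel n"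
  let ?K = "free_projection C n" and ?F = "free_measure C n"
  note K = free_projection_sets[OF C tn]
  have pos: "emeasure ?F ?K \<noteq> 0" using emeasure_free_projection_pos[OF C adm tn] by simp
  have fin: "emeasure ?F ?K \<noteq> \<infinity>" using emeasure_free_projection_le[OF C tn] by (auto simp: top_unique)
  interpret U: prob_space "uniform_measure ?F ?K" by (rule prob_space_uniform_measure[OF pos fin])
  have ins: "insert_constr C n \<in> measurable (uniform_measure ?F ?K) ?N"
    using insert_constr_measurable by simp
  have res: "(\<lambda>x. restrict x {1..l}) \<in> measurable ?N ?L"
    using l by (intro measurable_restrict_subset) auto
  have law: "first_moments_law C l n = distr (uniform_measure ?F ?K) ?L (\<lambda>y. restrict (insert_constr C n y) {1..l})"
    unfolding first_moments_law_def uniform_constr_moments_def using distr_distr[OF res ins] by (simp add: o_def)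
  have comp: "(\<lambda>y. restrict (insert_constr C n y) {1..l}) \<in> measurable (uniform_measure ?F ?K) ?L"
    using measurable_comp[OF ins res] by (simp add: o_def)
  show "prob_space (first_moments_law C l n)" unfolding law by (rule U.prob_space_distr[OF comp])
  show "sets (first_moments_law C l n) = sets ?L" by (simp add: law)
  have W: "emeasure ?F (?K \<inter> ((\<lambda>y. restrict (insert_constr C n y) {1..l}) -` A \<inter> space ?F)) = weight_integral C l n 0 A"
    if A: "A \<in> sets ?L" for A
  proof -
    have m: "(\<lambda>y. restrict (insert_constr C n y) {1..l}) \<in> measurable ?F ?L"
      using measurable_comp[OF insert_constr_measurable res] by (simp add: o_def)
    have "?K \<inter> ((\<lambda>y. restrict (insert_constr C n y) {1..l}) -` A \<inter> space ?F) \<in> sets ?F"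
      using K measurable_sets[OF m A] by blast
    then have "emeasure ?F (?K \<inter> ((\<lambda>y. restrict (insert_constr C n y) {1..l}) -` A \<inter> space ?F)) =
      (\<integral>\<^sup>+y. indicator (?K \<inter> ((\<lambda>y. restrict (insert_constr C n y) {1..l}) -` A \<inter> space ?F)) y \<partial>?F)" by simp
    also have "\<dots> = weight_integral C l n 0 A"
      unfolding weight_integral_def by (intro nn_integral_cong) (auto simp: indicator_def)
    finally show ?thesis .
  qed
  have em: "emeasure (first_moments_law C l n) A = weight_integral C l n 0 A / emeasure ?F ?K" if A: "A \<in> sets ?L" for A
  proof -
    have "emeasure (first_moments_law C l n) A =
      emeasure (uniform_measure ?F ?K) ((\<lambda>y. restrict (insert_constr C n y) {1..l}) -` A \<inter> space ?F)"
      unfolding law using emeasure_distr[OF comp A] by simp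
    also have "\<dots> = emeasure ?F (?K \<inter> ((\<lambda>y. restrict (insert_constr C n y) {1..l}) -` A \<inter> space ?F)) / emeasure ?F ?K"
      using measurable_sets[OF comp A] K by (intro emeasure_uniform_measure) auto
    finally show ?thesis unfolding W[OF A] .
  qed
  have "?K \<inter> ((\<lambda>y. restrict (insert_constr C n y) {1..l}) -` space ?L \<inter> space ?F) = ?K"
    using sets.sets_into_space[OF K] by (auto simp: space_PiM)
  then have tot: "emeasure ?F ?K = weight_integral C l n 0 (space ?L)" using W[OF sets.top] by simp
  \<comment> \<open>The accumulated Beta factors do not depend on the set, so they cancel between
    numerator and total volume.\<close>
  define B where "B = (\<Prod>i<n - l. beta_factor i)"
  have B: "B \<noteq> 0" "B \<noteq> \<infinity>"
    using beta_factor_pos beta_factor_finite by (auto simp: B_def prod_zero_iff ennreal_prod_eq_top less_top[symmetric] zero_less_iff_neq_zero)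
  have red: "weight_integral C l n 0 A = B * weight_integral C l l (n - l) A" if "A \<in> sets ?L" for A
    using weight_integral_reduce[OF C l(1) that, of "n - l" 0] l(2) by (simp add: B_def)
  show "emeasure (first_moments_law C l n) A = weight_integral C l l (n - l) A / weight_integral C l l (n - l) (space ?L)"
    if A: "A \<in> sets ?L"
    unfolding em[OF A] tot red[OF A] red[OF sets.top] mult.commute[of B] by (rule divide_mult_eq[OF B])
qed

section \<open>The large deviations principle\<close>

lemma weight_integral_le:
  assumes C: "is_constraint C" "top_index C \<le> l" and W: "0 \<le> W"
    and le: "\<And>x. x \<in> A \<Longrightarrow> x \<in> constr_moments C l \<Longrightarrow> width l x \<le> W"
  shows "weight_integral C l l m A \<le> ennreal (W ^ m)"
proof -
  have "weight_integral C l l m A \<le> (\<integral>\<^sup>+y. ennreal (W ^ m) * indicator (free_projection C l) y \<partial>free_measure C l)"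
    unfolding weight_integral_def
  proof (rule nn_integral_mono)
    fix y
    have "restrict (insert_constr C l y) {1..l} = insert_constr C l y"
      by (rule extensional_restrict[OF insert_constr_extensional])
    moreover have "ennreal (width l (insert_constr C l y)) ^ m \<le> ennreal (W ^ m)"
      if "y \<in> free_projection C l" "insert_constr C l y \<in> A"
      unfolding ennreal_power[OF W, symmetric] using that
      by (intro power_mono ennreal_leI le) (auto simp: free_projection_iff[OF C])
    ultimately show "weight C l l m A y \<le> ennreal (W ^ m) * indicator (free_projection C l) y"
      by (cases "y \<in> free_projection C l \<and> insert_constr C l y \<in> A") (auto simp: indicator_def)
  qed
  also have "\<dots> = ennreal (W ^ m) * emeasure (free_measure C l) (free_projection C l)"
    by (rule nn_integral_cmult_indicator[OF free_projection_sets[OF C]])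
  also have "\<dots> \<le> ennreal (W ^ m) * 1"
    by (intro mult_left_mono emeasure_free_projection_le[OF C]) auto
  finally show ?thesis by simp
qed

text \<open>The volume factor does not depend on \<open>m\<close> and so disappears at exponential
  scale; the loss of (1 - t)^m can be made arbitrarily small in the rate by the choice of
  \<open>t\<close>.\<close>

lemma weight_integral_ge:
  assumes C: "is_constraint C" and adm: "admissible C {0..1}" and l: "top_index C \<le> l"
  obtains \<eta> where "0 < \<eta>"
    "\<And>x t A m. x \<in> constr_moments C l \<Longrightarrow> 0 < t \<Longrightarrow> t \<le> 1 \<Longrightarrow>
       (\<And>y. y \<in> extensional {1..l} \<Longrightarrow> (\<And>j. j \<in> {1..l} \<Longrightarrow> \<bar>y j - x j\<bar> \<le> t * (1 + \<eta>)) \<Longrightarrow> y \<in> A) \<Longrightarrow>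
       ennreal (((1 - t) * width l x) ^ m * (2 * t * \<eta>) ^ card (free_indices C l)) \<le> weight_integral C l l m A"
proof -
  obtain \<eta> where \<eta>: "0 < \<eta>" and box:
    "\<And>x t. x \<in> constr_moments C l \<Longrightarrow> 0 < t \<Longrightarrow> t \<le> 1 \<Longrightarrow>
      \<exists>B\<in>sets (free_measure C l). ennreal ((2 * t * \<eta>) ^ card (free_indices C l)) = emeasure (free_measure C l) B \<and>
        (\<forall>y\<in>B. y \<in> free_projection C l \<and> (1 - t) * width l x \<le> width l (insert_constr C l y) \<and>
          (\<forall>j\<in>{1..l}. \<bar>insert_constr C l y j - x j\<bar> \<le> t * (1 + \<eta>)))"
    by (rule shrunk_box[OF C adm l]) blast
  show ?thesis
  proof (rule that[OF \<eta>])
    fix x t A m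
    assume x: "x \<in> constr_moments C l" and t: "0 < t" "t \<le> (1::real)"
      and A: "\<And>y. y \<in> extensional {1..l} \<Longrightarrow> (\<And>j. j \<in> {1..l} \<Longrightarrow> \<bar>y j - x j\<bar> \<le> t * (1 + \<eta>)) \<Longrightarrow> y \<in> A"
    obtain B where B: "B \<in> sets (free_measure C l)"
      "ennreal ((2 * t * \<eta>) ^ card (free_indices C l)) = emeasure (free_measure C l) B"
      "\<And>y. y \<in> B \<Longrightarrow> y \<in> free_projection C l \<and> (1 - t) * width l x \<le> width l (insert_constr C l y) \<and>
          (\<forall>j\<in>{1..l}. \<bar>insert_constr C l y j - x j\<bar> \<le> t * (1 + \<eta>))"
      using box[OF x t] by blast
    have w: "0 \<le> (1 - t) * width l x"
      using t x width_nonneg by (auto simp: constr_moment_space_iff[OF C l])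
    have "ennreal (((1 - t) * width l x) ^ m * (2 * t * \<eta>) ^ card (free_indices C l)) =
        ennreal (((1 - t) * width l x) ^ m) * emeasure (free_measure C l) B"
      unfolding B(2)[symmetric] using w by (intro ennreal_mult') simp
    also have "\<dots> = (\<integral>\<^sup>+y. ennreal (((1 - t) * width l x) ^ m) * indicator B y \<partial>free_measure C l)"
      by (rule nn_integral_cmult_indicator[OF B(1), symmetric])
    also have "\<dots> \<le> weight_integral C l l m A"
      unfolding weight_integral_def
    proof (rule nn_integral_mono)
      fix y
      show "ennreal (((1 - t) * width l x) ^ m) * indicator B y \<le> weight C l l m A y"
      proof (cases "y \<in> B")
        case True
        have "insert_constr C l y \<in> A" using B(3)[OF True] by (intro A insert_constr_extensional) auto
        moreover have "restrict (insert_constr C l y) {1..l} = insert_constr C l y"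
          by (rule extensional_restrict[OF insert_constr_extensional])
        moreover have "ennreal (((1 - t) * width l x) ^ m) \<le> ennreal (width l (insert_constr C l y)) ^ m"
          unfolding ennreal_power[OF w, symmetric] using B(3)[OF True] by (intro power_mono ennreal_leI) auto
        ultimately show ?thesis using True B(3)[OF True] by simp
      qed simp
    qed
    finally show "ennreal (((1 - t) * width l x) ^ m * (2 * t * \<eta>) ^ card (free_indices C l)) \<le> weight_integral C l l m A" .
  qed
qed

section \<open>Exponential rates and the two bounds\<close>

lemma tendsto_shifted_average:
  "(\<lambda>n. 1 / real n * (real (n - l) * a + b)) \<longlonglongrightarrow> a"
proof (rule Lim_transform_eventually)
  have "(\<lambda>n. (b - real l * a) / real n) \<longlonglongrightarrow> 0" by (rule lim_const_over_n)
  from tendsto_add[OF tendsto_const[of a] this] show "(\<lambda>n. a + (b - real l * a) / real n) \<longlonglongrightarrow> a" by simp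
  show "\<forall>\<^sub>F n in sequentially. a + (b - real l * a) / real n = 1 / real n * (real (n - l) * a + b)"
    using eventually_ge_at_top[of "Suc l"]
    by eventually_elim (simp add: of_nat_diff field_simps)
qed

lemma elog_mono: "x \<le> y \<Longrightarrow> elog x \<le> elog y"
  by (auto simp: elog_def)

lemma elog_pos: "0 < x \<Longrightarrow> elog x = ereal (ln x)"
  by (simp add: elog_def)

lemma limsup_elog_le:
  assumes p: "\<And>n. l \<le> n \<Longrightarrow> p n \<le> A ^ (n - l) * B" and A: "0 < A" and B: "0 < B"
  shows "limsup (\<lambda>n. ereal (1 / real n) * elog (p n)) \<le> ereal (ln A)"
proof -
  have "\<forall>\<^sub>F n in sequentially. ereal (1 / real n) * elog (p n) \<le> ereal (1 / real n * (real (n - l) * ln A + ln B))"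
    using eventually_ge_at_top[of "Suc l"]
  proof eventually_elim
    case (elim n)
    have "elog (p n) \<le> elog (A ^ (n - l) * B)" using elim by (intro elog_mono p) simp
    also have "\<dots> = ereal (real (n - l) * ln A + ln B)"
      using A B by (simp add: elog_pos ln_mult ln_realpow)
    finally have "ereal (1 / real n) * elog (p n) \<le> ereal (1 / real n) * ereal (real (n - l) * ln A + ln B)"
      by (intro ereal_mult_left_mono) auto
    then show ?case by simp
  qed
  then have "limsup (\<lambda>n. ereal (1 / real n) * elog (p n)) \<le> limsup (\<lambda>n. ereal (1 / real n * (real (n - l) * ln A + ln B)))"
    by (rule Limsup_mono)
  also have "\<dots> = ereal (ln A)"
    by (intro lim_imp_Limsup tendsto_ereal tendsto_shifted_average) simp
  finally show ?thesis .
qed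

lemma liminf_elog_ge:
  assumes p: "\<And>n. l \<le> n \<Longrightarrow> A ^ (n - l) * B \<le> p n" and A: "0 < A" and B: "0 < B"
  shows "ereal (ln A) \<le> liminf (\<lambda>n. ereal (1 / real n) * elog (p n))"
proof -
  have "\<forall>\<^sub>F n in sequentially. ereal (1 / real n * (real (n - l) * ln A + ln B)) \<le> ereal (1 / real n) * elog (p n)"
    using eventually_ge_at_top[of "Suc l"]
  proof eventually_elim
    case (elim n)
    have "ereal (real (n - l) * ln A + ln B) = elog (A ^ (n - l) * B)"
      using A B by (simp add: elog_pos ln_mult ln_realpow)
    also have "\<dots> \<le> elog (p n)" using elim by (intro elog_mono p) simp
    finally have "ereal (1 / real n) * ereal (real (n - l) * ln A + ln B) \<le> ereal (1 / real n) * elog (p n)"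
      by (intro ereal_mult_left_mono) auto
    then show ?case by simp
  qed
  then have "liminf (\<lambda>n. ereal (1 / real n * (real (n - l) * ln A + ln B))) \<le> liminf (\<lambda>n. ereal (1 / real n) * elog (p n))"
    by (rule Liminf_mono)
  moreover have "liminf (\<lambda>n. ereal (1 / real n * (real (n - l) * ln A + ln B))) = ereal (ln A)"
    by (intro lim_imp_Liminf tendsto_ereal tendsto_shifted_average) simp
  ultimately show ?thesis by simp
qed

theorem theorem2p7:
  fixes C :: constr and l :: nat
  assumes "is_constraint C"
    and "admissible C {0..1}"
    and "top_index C \<le> l" and "1 \<le> l"
  defines "J \<equiv> \<lambda>x. rate_I C l x - rate_I C l (moment_vector l (entropy_minimizer C))"
  shows "LDP (real_space l) (first_moments_law C l) real J \<and> good_rate (real_space l) J"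
proof -
  note C = assms(1,3) and adm = assms(2)
  let ?K = "constr_moments C l" and ?L = "real_borel l"
  obtain x0 where x0: "x0 \<in> ?K" "0 < width l x0" using exists_positive_width[OF C(1) adm C(2)] by blast
  then obtain xm where xm: "xm \<in> ?K" and max: "\<And>y. y \<in> ?K \<Longrightarrow> width l y \<le> width l xm"
    using width_attains_max[OF C] by blast
  define M where "M = width l xm"
  have M: "0 < M" using x0 max[OF x0(1)] by (simp add: M_def)
  have minimizer: "moment_vector l (entropy_minimizer C) = xm"
    using entropy_minimizer_moments[OF C xm] M max by (simp add: M_def)
  \<comment> \<open>The subtracted value is the finite number \<open>- ln M\<close>, so
    \<open>J\<close> never involves a difference of infinities; points of width zero get the value
    \<infinity>, as do points outside the constrained space.\<close>
  have J_pos: "J x = ereal (ln M - ln (width l x))" if "x \<in> ?K" "0 < width l x" for x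
    using that xm M by (simp add: J_def minimizer rate_I_def elog_def width_def[symmetric] M_def)
  have J_inf: "J x = \<infinity>" if "\<not> (x \<in> ?K \<and> 0 < width l x)" for x
    using that xm M by (auto simp: J_def minimizer rate_I_def elog_def width_def[symmetric] M_def)
  \<comment> \<open>Sublevel sets of \<open>J\<close> are superlevel sets of the width. Their
    compactness gives goodness and, as compact sets are closed here, lower semicontinuity.\<close>
  have J_le: "J x \<le> ereal \<alpha> \<longleftrightarrow> x \<in> ?K \<and> M * exp (- \<alpha>) \<le> width l x" for x \<alpha>
  proof (cases "x \<in> ?K \<and> 0 < width l x")
    case True
    have "ln (M * exp (- \<alpha>)) = ln M - \<alpha>" using M by (simp add: ln_mult)
    then have "ln M - ln (width l x) \<le> \<alpha> \<longleftrightarrow> ln (M * exp (- \<alpha>)) \<le> ln (width l x)" by linarith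
    also have "\<dots> \<longleftrightarrow> M * exp (- \<alpha>) \<le> width l x" using True M by simp
    finally show ?thesis using True by (simp add: J_pos)
  next
    case False
    moreover have "0 < M * exp (- \<alpha>)" using M by simp
    ultimately have "\<not> (x \<in> ?K \<and> M * exp (- \<alpha>) \<le> width l x)" by linarith
    then show ?thesis unfolding J_inf[OF False] by simp
  qed
  have J_ge: "width l x \<le> M * exp (- c)" if "x \<in> ?K" "ereal c \<le> J x" for x c
  proof (cases "0 < width l x")
    case True
    have "c \<le> ln M - ln (width l x)" using that(2) unfolding J_pos[OF that(1) True] by simp
    then have "ln (width l x) \<le> ln (M * exp (- c))" using M by (simp add: ln_mult)
    then show ?thesis using True M by simp
  next
    case False
    moreover have "0 < M * exp (- c)" using M by simp
    ultimately show ?thesis by linarith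
  qed
  have sub: "compactin (real_space l) {x \<in> topspace (real_space l). J x \<le> ereal \<alpha>}" for \<alpha>
  proof -
    have "?K \<subseteq> topspace (real_space l)"
      using unit_moments_extensional by (auto simp: topspace_real_space constr_moment_space_iff[OF C])
    then have "{x \<in> topspace (real_space l). J x \<le> ereal \<alpha>} = {x \<in> ?K. M * exp (- \<alpha>) \<le> width l x}"
      unfolding J_le by blast
    then show ?thesis using compactin_width_ge[OF C] by simp
  qed
  have good: "good_rate (real_space l) J" using sub by (simp add: good_rate_def)
  have J0: "0 \<le> J x" for x
    using max[of x] J_pos[of x] J_inf[of x] by (cases "x \<in> ?K \<and> 0 < width l x") (auto simp: M_def)
  have lsc: "lower_semicontinuous (real_space l) J"
    unfolding lower_semicontinuous_def
  proof
    fix a :: ereal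
    show "openin (real_space l) {x \<in> topspace (real_space l). a < J x}"
    proof (cases a)
      case (real \<alpha>)
      have "{x \<in> topspace (real_space l). a < J x} = topspace (real_space l) - {x \<in> topspace (real_space l). J x \<le> ereal \<alpha>}"
        by (auto simp: real)
      moreover have "openin (real_space l) (topspace (real_space l) - {x \<in> topspace (real_space l). J x \<le> ereal \<alpha>})"
        using compactin_real_space_closedin[OF sub[of \<alpha>]] unfolding closedin_def by (rule conjunct2)
      ultimately show ?thesis by (simp only:)
    next
      case MInf
      have "a < J x" for x
      proof (rule less_le_trans[OF _ J0])
        show "a < 0" using MInf by simp
      qed
      then show ?thesis by simp
    qed simp
  qed
  obtain \<eta> where \<eta>: "0 < \<eta>" and lower: "\<And>x t A m. x \<in> ?K \<Longrightarrow> 0 < t \<Longrightarrow> t \<le> 1 \<Longrightarrow>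
       (\<And>y. y \<in> extensional {1..l} \<Longrightarrow> (\<And>j. j \<in> {1..l} \<Longrightarrow> \<bar>y j - x j\<bar> \<le> t * (1 + \<eta>)) \<Longrightarrow> y \<in> A) \<Longrightarrow>
       ennreal (((1 - t) * width l x) ^ m * (2 * t * \<eta>) ^ card (free_indices C l)) \<le> weight_integral C l l m A"
    by (rule weight_integral_ge[OF C(1) adm C(2)]) blast
  define v where "v t = (2 * t * \<eta>) ^ card (free_indices C l)" for t
  have v: "0 < v t" if "0 < t" for t using that \<eta> by (simp add: v_def)
  define e where "e m A = enn2real (weight_integral C l l m A)" for m A
  have fin: "weight_integral C l l m A = ennreal (e m A)" for m A
  proof -
    have "weight_integral C l l m A \<le> ennreal (1 ^ m)"
      by (rule weight_integral_le[OF C]) (auto intro: width_le_1 simp: constr_moment_space_iff[OF C])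
    from le_less_trans[OF this ennreal_less_top] show ?thesis by (simp add: e_def)
  qed
  have e_le: "e m A \<le> W ^ m" if "0 \<le> W" "\<And>x. x \<in> A \<Longrightarrow> x \<in> ?K \<Longrightarrow> width l x \<le> W" for m A W
    using weight_integral_le[OF C that, where m = m] that(1) unfolding fin by simp
  have e_ge: "((1 - t) * width l x) ^ m * v t \<le> e m A"
    if "x \<in> ?K" "0 < t" "t \<le> 1" "\<And>y. y \<in> extensional {1..l} \<Longrightarrow> (\<And>j. j \<in> {1..l} \<Longrightarrow> \<bar>y j - x j\<bar> \<le> t * (1 + \<eta>)) \<Longrightarrow> y \<in> A" for x t m A
    using lower[OF that, where m = m] unfolding fin by (simp add: v_def ennreal_le_iff e_def)
  have e_top: "0 < e m (space ?L)" for m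
  proof -
    have "((1 - 1/2) * width l xm) ^ m * v (1/2) \<le> e m (space ?L)"
      by (rule e_ge[OF xm]) (auto simp: space_PiM PiE_def)
    moreover have "0 < ((1 - 1/2) * width l xm) ^ m * v (1/2)"
      using M v[of "1/2"] by (simp add: M_def)
    ultimately show ?thesis by linarith
  qed
  have law: "measure (first_moments_law C l n) \<Gamma> = e (n - l) \<Gamma> / e (n - l) (space ?L)"
    if "l \<le> n" "\<Gamma> \<in> sets (borel_of (real_space l))" for n \<Gamma>
    using emeasure_first_moments_law(3)[OF C(1) adm C(2) that(1), of \<Gamma>] that(2) e_top[of "n - l"]
    unfolding sets_borel_of_real_space fin measure_def
    by (simp add: divide_ennreal e_def)
  have prob: "\<forall>\<^sub>F n in sequentially. prob_space (first_moments_law C l n) \<and>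
      sets (first_moments_law C l n) = sets (borel_of (real_space l))"
    unfolding sets_borel_of_real_space
    using emeasure_first_moments_law(1,2)[OF C(1) adm C(2)] by (intro eventually_sequentiallyI[of l]) blast
  have le_neg: "a \<le> - b \<longleftrightarrow> b \<le> - a" and neg_le: "- a \<le> b \<longleftrightarrow> - b \<le> a" for a b :: ereal
    by (cases a; cases b; auto)+
  have upper: "limsup (\<lambda>n. ereal (1 / real n) * elog (measure (first_moments_law C l n) \<Gamma>)) \<le>
      - (INF x\<in>real_space l closure_of \<Gamma>. J x)" if \<Gamma>: "\<Gamma> \<in> sets (borel_of (real_space l))" for \<Gamma>
  proof -
    let ?S = "limsup (\<lambda>n. ereal (1 / real n) * elog (measure (first_moments_law C l n) \<Gamma>))"
    have bound: "?S \<le> ereal (- c)" if c: "ereal c \<le> (INF x\<in>real_space l closure_of \<Gamma>. J x)" for c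
    proof (rule ereal_le_epsilon2)
      fix \<epsilon> :: real assume \<epsilon>: "0 < \<epsilon>"
      \<comment> \<open>Shrinking by \<open>t\<close> costs the factor 1 - t = exp(- \<epsilon>) per
        power, that is, exactly \<epsilon> in the rate.\<close>
      define t where "t = 1 - exp (- \<epsilon>)"
      have t: "0 < t" "t < 1" using \<epsilon> by (auto simp: t_def)
      have "\<Gamma> \<subseteq> real_space l closure_of \<Gamma>"
        using sets.sets_into_space[OF \<Gamma>] by (intro closure_of_subset) (simp add: space_borel_of)
      then have Jc: "ereal c \<le> J x" if "x \<in> \<Gamma>" for x
        using that c by (meson INF_lower order_trans subsetD)
      have "measure (first_moments_law C l n) \<Gamma> \<le> (exp (- c) / (1 - t)) ^ (n - l) * (1 / v t)" if n: "l \<le> n" for n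
      proof -
        have "e (n - l) \<Gamma> \<le> (M * exp (- c)) ^ (n - l)"
          using J_ge Jc M by (intro e_le) auto
        \<comment> \<open>The normalising constant is bounded below on a box shrunk towards the
          maximiser \<open>xm\<close>.\<close>
        moreover have "((1 - t) * M) ^ (n - l) * v t \<le> e (n - l) (space ?L)"
          unfolding M_def using t by (intro e_ge[OF xm]) (auto simp: space_PiM PiE_def)
        moreover have "0 < ((1 - t) * M) ^ (n - l) * v t" using t M v by simp
        ultimately have "e (n - l) \<Gamma> / e (n - l) (space ?L) \<le> (M * exp (- c)) ^ (n - l) / (((1 - t) * M) ^ (n - l) * v t)"
          using M by (intro frac_le) auto
        also have "\<dots> = (exp (- c) / (1 - t)) ^ (n - l) * (1 / v t)"
          using M by (simp add: power_mult_distrib power_divide)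
        finally show ?thesis unfolding law[OF n \<Gamma>] .
      qed
      then have "?S \<le> ereal (ln (exp (- c) / (1 - t)))"
        using t v by (intro limsup_elog_le[where B = "1 / v t"]) auto
      also have "ln (exp (- c) / (1 - t)) = - c + \<epsilon>" by (simp add: t_def ln_div)
      finally show "?S \<le> ereal (- c) + ereal \<epsilon>" by simp
    qed
    \<comment> \<open>The infimum may be \<infinity>, so the bound is obtained for every real
      \<open>c\<close> below it rather than for the infimum itself.\<close>
    have "(INF x\<in>real_space l closure_of \<Gamma>. J x) \<le> - ?S"
    proof (rule ereal_le_real)
      fix z assume z: "- ?S \<le> ereal z"
      show "(INF x\<in>real_space l closure_of \<Gamma>. J x) \<le> ereal z"
      proof (rule ccontr)
        assume "\<not> ?thesis"
        then have "ereal z < (INF x\<in>real_space l closure_of \<Gamma>. J x)" by simp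
        then obtain c where c: "z < c" "ereal c < (INF x\<in>real_space l closure_of \<Gamma>. J x)"
          using ereal_dense2 by fastforce
        then have "?S \<le> ereal (- c)" using bound less_imp_le by blast
        then have "ereal c \<le> - ?S" unfolding uminus_ereal.simps(1)[symmetric] by (rule le_neg[THEN iffD1])
        from order_trans[OF this z] have "ereal c \<le> ereal z" .
        with c(1) show False by simp
      qed
    qed
    then show ?thesis by (rule le_neg[THEN iffD1])
  qed
  have lowerb: "- (INF x\<in>real_space l interior_of \<Gamma>. J x) \<le>
      liminf (\<lambda>n. ereal (1 / real n) * elog (measure (first_moments_law C l n) \<Gamma>))"
    if \<Gamma>: "\<Gamma> \<in> sets (borel_of (real_space l))" for \<Gamma>
  proof -
    let ?S = "liminf (\<lambda>n. ereal (1 / real n) * elog (measure (first_moments_law C l n) \<Gamma>))"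
    have "- ?S \<le> J x" if x: "x \<in> real_space l interior_of \<Gamma>" for x
    proof (cases "x \<in> ?K \<and> 0 < width l x")
      case True
      then have xK: "x \<in> ?K" and w: "0 < width l x" by auto
      obtain \<delta> where \<delta>: "0 < \<delta>"
        "\<And>y. y \<in> extensional {1..l} \<Longrightarrow> (\<And>j. j \<in> {1..l} \<Longrightarrow> \<bar>y j - x j\<bar> < \<delta>) \<Longrightarrow> y \<in> \<Gamma>"
        using real_space_interior_box[OF x] by blast
      have "- ereal (ln M - ln (width l x)) \<le> ?S"
      proof (rule ereal_le_epsilon2)
        fix \<epsilon> :: real assume \<epsilon>: "0 < \<epsilon>"
        \<comment> \<open>The first entry keeps the loss in the rate within \<epsilon>; the second
          keeps the shrunk box strictly inside the \<delta>-neighbourhood of \<open>x\<close>, the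
          factor 2 giving strictness.\<close>
        define t where "t = min (1 - exp (- \<epsilon>)) (\<delta> / (2 * (1 + \<eta>)))"
        have t: "0 < t" "t \<le> 1 - exp (- \<epsilon>)" "t \<le> \<delta> / (2 * (1 + \<eta>))" using \<epsilon> \<eta> \<delta>(1) by (auto simp: t_def)
        then have t1: "t < 1" by (smt (verit) exp_gt_zero)
        have t\<delta>: "t * (1 + \<eta>) < \<delta>" using t(3) \<eta> \<delta>(1) by (simp add: field_simps)
        have "((1 - t) * width l x / M) ^ (n - l) * v t \<le> measure (first_moments_law C l n) \<Gamma>" if n: "l \<le> n" for n
        proof -
          have "((1 - t) * width l x) ^ (n - l) * v t \<le> e (n - l) \<Gamma>"
          proof (rule e_ge[OF xK t(1)])
            fix y assume y: "y \<in> extensional {1..l}" "\<And>j. j \<in> {1..l} \<Longrightarrow> \<bar>y j - x j\<bar> \<le> t * (1 + \<eta>)"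
            show "y \<in> \<Gamma>" by (rule \<delta>(2)[OF y(1)]) (rule le_less_trans[OF y(2) t\<delta>])
          qed (use t1 in simp)
          \<comment> \<open>The free projection has volume at most 1, so the total mass is at most
            the maximal weight.\<close>
          moreover have "e (n - l) (space ?L) \<le> M ^ (n - l)"
            using M max by (intro e_le) (auto simp: M_def)
          moreover have "0 \<le> ((1 - t) * width l x) ^ (n - l) * v t" using t1 w v[OF t(1)] by simp
          ultimately have "((1 - t) * width l x) ^ (n - l) * v t / M ^ (n - l) \<le> e (n - l) \<Gamma> / e (n - l) (space ?L)"
            using e_top by (intro frac_le) auto
          then show ?thesis unfolding law[OF n \<Gamma>] by (simp add: power_divide)
        qed
        then have "ereal (ln ((1 - t) * width l x / M)) \<le> ?S"
          using t1 w M v[OF t(1)] by (intro liminf_elog_ge[where B = "v t"]) auto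
        note a = this
        have b: "- (ln M - ln (width l x)) \<le> ln ((1 - t) * width l x / M) + \<epsilon>"
        proof -
          have "ln (exp (- \<epsilon>)) \<le> ln (1 - t)" using t(2) t1 by (subst ln_le_cancel_iff) auto
          then show ?thesis using t1 w M by (simp add: ln_mult ln_div)
        qed
        have "- ereal (ln M - ln (width l x)) \<le> ereal (ln ((1 - t) * width l x / M)) + ereal \<epsilon>"
          using b by simp
        also have "\<dots> \<le> ?S + ereal \<epsilon>" using a by (rule add_right_mono)
        finally show "- ereal (ln M - ln (width l x)) \<le> ?S + ereal \<epsilon>" .
      qed
      then show ?thesis unfolding J_pos[OF xK w] by (rule neg_le[THEN iffD1])
    qed (simp add: J_inf)
    then have "- ?S \<le> (INF x\<in>real_space l interior_of \<Gamma>. J x)" by (rule INF_greatest)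
    then show ?thesis by (rule neg_le[THEN iffD1])
  qed
  have "filterlim real at_top sequentially" by (rule filterlim_real_sequentially)
  then show ?thesis
    using good J0 lsc prob upper lowerb by (simp add: LDP_def)
qed

end
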